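(* Let $G$ be an amenable unimodular lcsc group and let $(F_t)_{t>0}$ be a weakly admissible F\o lner sequence of compact subsets of $G$. If the punctured hull $X^\times=X_{P_0}^\times$ of a subset $P_0\subset G$ of finite local complexity is compact and uniquely ergodic, then \[\eta_{P_0}(f)=\lim_{t\to\infty}\frac{1}{m_G(F_t)}\sum_{x\in P_0\cap F_t}\ \sum_{y\in P_0}f(x^{-1}y)\qquad\text{for all } f\in C_c(G).\]
   Context: lcsc means locally compact second countable; $m_G$ denotes a fixed Haar measure. A subset $P\subset G$ has finite local complexity if $P^{-1}P$ is closed and discrete in $G$. The Chabauty--Fell topology on the set $\mathcal C(G)$ of closed subsets of $G$ is generated by the sets $\{C : C\cap V\neq\emptyset\}$ ($V$ open) and $\{C : C\cap K=\emptyset\}$ ($K$ compact). $G$ acts on $\mathcal C(G)$ by left translation; $X_{P_0}$ is the closure of $G.P_0$, and $X_{P_0}^\times := X_{P_0}\setminus\{\emptyset\}$. Uniquely ergodic means that $X_{P_0}^\times$ admits a unique $G$-invariant probability measure $\nu$. For $f\in C_c(G)$ put $\mathcal Pf(P):=\sum_{x\in P}f(x)$. The auto-correlation measure $\eta_{P_0}$ is the unique positive-definite Radon measure on $G$ with $\eta_{P_0}(f^**f)=\|\mathcal Pf\|^2_{L^2(X_{P_0}^\times,\nu)}$ for all $f\in C_c(G)$, where $f^*(g)=\overline{f(g^{-1})}$, $(f_1*f_2)(g)=\int_G f_1(r)f_2(r^{-1}g)\,dm_G(r)$, and $\eta$ is positive-definite if $\eta(f^**f)\ge 0$ for all $f\in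 C_c(G)$. Weak admissibility: fix an admissible metric on $G$ (proper, left-invariant, inducing the topology), let $B_\delta$ be the open ball of radius $\delta$ around $e$, and write $L_\delta=LB_\delta$ for $L\subset G$. A sequence $(F_t)_{t>0}$ of compact subsets of $G$ is weakly admissible if each $F_t$ has positive Haar measure and there are continuous functions $\alpha,\beta:[0,1)\to\mathbb R_+$ with $\alpha(0)=\beta(0)=0$ such that $(F_t)_\delta\subset F_{t+\alpha(\delta)}$ and $\sup_s\frac{m_G(F_{s+\delta})}{m_G(F_s)}=1+\beta(\delta)$ for all $t>0$ and $\delta\in(0,1)$. F\o lner: $m_G(F_tg\,\triangle\,F_t)/m_G(F_t)\to0$ as $t\to\infty$ for every $g\in G$. *)

theory Defs
  imports "HOL-Analysis.Analysis" "HOL-Probability.Probability_Measure" "HOL-Library.Set_Algebras"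
begin

text \<open>
  The group \<open>G\<close> is a type of class \<^class>\<open>topological_group_add\<close>. This class is written additively
  but is not commutative: \<open>x + y\<close> is the product \<open>xy\<close>, \<open>- x\<close> the inverse of \<open>x\<close> and \<open>0\<close> the
  identity.
\<close>

section \<open>Haar measure, amenability\<close>

text \<open>
  Regularity is not required of a Borel measure that is finite on compact sets: on an lcsc space it is
  automatic.
\<close>

definition left_haar_measure :: "'g :: topological_group_add measure \<Rightarrow> bool" where
  "left_haar_measure m \<longleftrightarrow>
     sets m = sets borel \<and>
     (\<forall>K. compact K \<longrightarrow> emeasure m K < \<infinity>) \<and>
     emeasure m UNIV \<noteq> 0 \<and>
     (\<forall>g. \<forall>A\<in>sets borel. emeasure m ((+) g ` A) = emeasure m A)"

definition unimodular :: "'g :: topological_group_add measure \<Rightarrow> bool" where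
  "unimodular m \<longleftrightarrow> (\<forall>g. \<forall>A\<in>sets borel. emeasure m ((\<lambda>x. x + g) ` A) = emeasure m A)"

text \<open>
  Amenability is the existence of a left-invariant mean on real \<open>L\<^sup>\<infinity>(G)\<close>, whose elements are
  represented by bounded measurable functions. Linearity together with positivity almost everywhere
  makes \<open>M\<close> well defined on almost-everywhere classes.
\<close>

definition bounded_measurable :: "'g measure \<Rightarrow> ('g \<Rightarrow> real) set" where
  "bounded_measurable m = {f \<in> borel_measurable m. bounded (range f)}"

definition amenable :: "'g :: topological_group_add measure \<Rightarrow> bool" where
  "amenable m \<longleftrightarrow> (\<exists>M :: ('g \<Rightarrow> real) \<Rightarrow> real.
     (\<forall>f\<in>bounded_measurable m. \<forall>h\<in>bounded_measurable m. M (\<lambda>x. f x + h x) = M f + M h) \<and>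
     (\<forall>f\<in>bounded_measurable m. \<forall>c. M (\<lambda>x. c * f x) = c * M f) \<and>
     (\<forall>f\<in>bounded_measurable m. (AE x in m. 0 \<le> f x) \<longrightarrow> 0 \<le> M f) \<and>
     M (\<lambda>x. 1) = 1 \<and>
     (\<forall>f\<in>bounded_measurable m. \<forall>g. M (\<lambda>x. f (g + x)) = M f))"

section \<open>Weakly admissible families and the Folner condition\<close>

definition admissible_metric :: "('g :: topological_group_add \<Rightarrow> 'g \<Rightarrow> real) \<Rightarrow> bool" where
  "admissible_metric d \<longleftrightarrow>
     Metric_space UNIV d \<and>
     Metric_space.mtopology UNIV d = euclidean \<and>
     (\<forall>x r. compact {y. d x y \<le> r}) \<and>
     (\<forall>g x y. d (g + x) (g + y) = d x y)"

definition thicken :: "('g :: topological_group_add \<Rightarrow> 'g \<Rightarrow> real) \<Rightarrow> 'g set \<Rightarrow> real \<Rightarrow> 'g set" where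
  "thicken d L \<delta> = L + {b. d 0 b < \<delta>}"

definition weakly_admissible ::
    "('g :: topological_group_add \<Rightarrow> 'g \<Rightarrow> real) \<Rightarrow> 'g measure \<Rightarrow> (real \<Rightarrow> 'g set) \<Rightarrow> bool" where
  "weakly_admissible d m F \<longleftrightarrow>
     (\<forall>t>0. compact (F t) \<and> emeasure m (F t) > 0) \<and>
     (\<exists>\<alpha> \<beta> :: real \<Rightarrow> real.
        continuous_on {0..<1} \<alpha> \<and> continuous_on {0..<1} \<beta> \<and>
        (\<forall>\<delta>\<in>{0..<1}. 0 \<le> \<alpha> \<delta> \<and> 0 \<le> \<beta> \<delta>) \<and>
        \<alpha> 0 = 0 \<and> \<beta> 0 = 0 \<and>
        (\<forall>\<delta>\<in>{0<..<1}.
           (\<forall>t>0. thicken d (F t) \<delta> \<subseteq> F (t + \<alpha> \<delta>)) \<and>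
           (SUP s\<in>{0<..}. emeasure m (F (s + \<delta>)) / emeasure m (F s)) = ennreal (1 + \<beta> \<delta>)))"

definition folner :: "'g :: topological_group_add measure \<Rightarrow> (real \<Rightarrow> 'g set) \<Rightarrow> bool" where
  "folner m F \<longleftrightarrow>
     (\<forall>g. ((\<lambda>t. measure m (sym_diff ((\<lambda>x. x + g) ` F t) (F t)) / measure m (F t)) \<longlongrightarrow> 0) at_top)"

section \<open>The hull of a set of finite local complexity\<close>

definition finite_local_complexity :: "'g :: topological_group_add set \<Rightarrow> bool" where
  "finite_local_complexity P \<longleftrightarrow>
     closed (uminus ` P + P) \<and> discrete (uminus ` P + P)"

text \<open>The carrier of this topology is the set of closed subsets of the space (take \<open>K = {}\<close>).\<close>

definition chabauty_fell :: "'a :: topological_space set topology" where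
  "chabauty_fell = topology_generated_by
     ({{C. closed C \<and> C \<inter> V \<noteq> {}} | V. open V} \<union> {{C. closed C \<and> C \<inter> K = {}} | K. compact K})"

definition translation_hull :: "'g :: topological_group_add set \<Rightarrow> 'g set set" where
  "translation_hull P\<^sub>0 = chabauty_fell closure_of (range (\<lambda>g. (+) g ` P\<^sub>0))"

definition punctured_hull :: "'g :: topological_group_add set \<Rightarrow> 'g set set" where
  "punctured_hull P\<^sub>0 = translation_hull P\<^sub>0 - {{}}"

definition borel_of_topology :: "'a topology \<Rightarrow> 'a measure" where
  "borel_of_topology T = sigma (topspace T) {U. openin T U}"

definition invariant_probability ::
    "'g :: topological_group_add set \<Rightarrow> 'g set measure \<Rightarrow> bool" where
  "invariant_probability P\<^sub>0 \<nu> \<longleftrightarrow>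
     space \<nu> = punctured_hull P\<^sub>0 \<and>
     sets \<nu> = sets (borel_of_topology (subtopology chabauty_fell (punctured_hull P\<^sub>0))) \<and>
     prob_space \<nu> \<and>
     (\<forall>g. distr \<nu> \<nu> (\<lambda>P. (+) g ` P) = \<nu>)"

definition uniquely_ergodic :: "'g :: topological_group_add set \<Rightarrow> bool" where
  "uniquely_ergodic P\<^sub>0 \<longleftrightarrow> (\<exists>!\<nu>. invariant_probability P\<^sub>0 \<nu>)"

definition hull_measure :: "'g :: topological_group_add set \<Rightarrow> 'g set measure" where
  "hull_measure P\<^sub>0 = (THE \<nu>. invariant_probability P\<^sub>0 \<nu>)"

section \<open>The auto-correlation measure\<close>

definition Cc :: "('g :: topological_space \<Rightarrow> complex) set" where
  "Cc = {f. continuous_on UNIV f \<and> compact (closure {x. f x \<noteq> 0})}"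

definition star :: "('g :: topological_group_add \<Rightarrow> complex) \<Rightarrow> 'g \<Rightarrow> complex" where
  "star f g = cnj (f (- g))"

definition conv ::
    "'g :: topological_group_add measure \<Rightarrow> ('g \<Rightarrow> complex) \<Rightarrow> ('g \<Rightarrow> complex) \<Rightarrow> 'g \<Rightarrow> complex" where
  "conv m f\<^sub>1 f\<^sub>2 g = (\<integral>r. f\<^sub>1 r * f\<^sub>2 (- r + g) \<partial>m)"

text \<open>
  A Radon measure is a Borel measure that is finite on compact sets, with
  \<open>\<eta>(f) = \<integral>x. f x \<partial>\<eta>\<close>.
\<close>

definition radon_measure :: "'g :: topological_space measure \<Rightarrow> bool" where
  "radon_measure \<eta> \<longleftrightarrow> sets \<eta> = sets borel \<and> (\<forall>K. compact K \<longrightarrow> emeasure \<eta> K < \<infinity>)"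

definition positive_definite ::
    "'g :: topological_group_add measure \<Rightarrow> 'g measure \<Rightarrow> bool" where
  "positive_definite m \<eta> \<longleftrightarrow> (\<forall>f\<in>Cc. (\<integral>x. conv m (star f) f x \<partial>\<eta>) \<in> \<real>\<^sub>\<ge>\<^sub>0)"

text \<open>
  For \<open>P\<close> in the hull of a set of finite local complexity, \<open>P\<close> meets the support of \<open>f\<close> in a finite
  set, so that the sum has finitely many nonzero terms.
\<close>

definition periodization :: "('g \<Rightarrow> complex) \<Rightarrow> 'g set \<Rightarrow> complex" where
  "periodization f P = (\<Sum>\<^sub>\<infinity>x\<in>P. f x)"

definition autocorrelation :: "'g :: topological_group_add measure \<Rightarrow> 'g set \<Rightarrow> 'g measure" where
  "autocorrelation m P\<^sub>0 = (THE \<eta>. radon_measure \<eta> \<and> positive_definite m \<eta> \<and>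
     (\<forall>f\<in>Cc. (\<integral>x. conv m (star f) f x \<partial>\<eta>) =
              complex_of_real (\<integral>P. (cmod (periodization f P))\<^sup>2 \<partial>hull_measure P\<^sub>0)))"

end

theory Submission
  imports Defs
begin

text \<open>
  The double sum over pairs \<open>(x, y)\<close> with \<open>x\<close> in the window \<open>F t\<close> depends on \<open>(x, y)\<close> only through \<open>x\<close> and the
  difference \<open>z = - x + y\<close>. By finite local complexity the differences form a closed discrete set, so for \<open>f\<close> of
  compact support only finitely many \<open>z\<close> matter, and the double sum divided by \<open>m (F t)\<close> is a finite
  combination of the frequencies with which a point \<open>x\<close> of \<open>P\<^sub>0\<close> in \<open>F t\<close> has \<open>x + z\<close> in \<open>P\<^sub>0\<close>
  as well. Therefore it suffices to show that each of these frequencies has a limit, the density of \<open>z\<close>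
  (\<open>pair_frequency_tendsto\<close>), and that the auto-correlation is the sum of point masses at the differences
  weighted by these densities (\<open>autocorrelation_eq_difference_measure\<close>).

  For the limit, count pairs with continuous weights: for \<open>h\<close> of compact support, summing \<open>h\<close> over all \<open>x \<in> P\<close> with
  \<open>x + z \<in> P\<close> is a continuous function of \<open>P\<close> in the punctured hull (\<open>continuous_pair_sum\<close>). Its averages over the
  translates of \<open>P\<^sub>0\<close> by \<open>- g\<close>, \<open>g \<in> F t\<close>, converge to its \<open>\<nu>\<close>-integral by unique ergodicity
  (\<open>orbit_average_tendsto\<close>). If \<open>h\<close> is supported near the identity, weak admissibility
  sandwiches these averages between multiples of the frequencies at nearby parameters
  (\<open>orbit_average_frequency\<close>), with an error that disappears as the support shrinks. This shows convergence
  and also computes the \<open>\<nu>\<close>-integral for functions of small support; a partition of unity and the invariance of \<open>\<nu>\<close>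
  extend the computation to all \<open>h\<close> (\<open>campbell_formula\<close>).

  Expanding the square of the periodization of \<open>f\<close> and applying this formula to \<open>\<lambda>x. cnj (f x) * f (x + z)\<close> for each
  \<open>z\<close> shows that the sum of point masses has the property that defines the auto-correlation
  (\<open>difference_measure_squares\<close>). Polarization and approximation by convolutions with bumps show that no
  other Radon measure has it (\<open>radon_measure_determined_by_squares\<close>).

  Unique ergodicity is a statement about measures, whereas averages along \<open>F\<close> accumulate at invariant
  positive functionals on the continuous functions of the compact hull. The representation of such
  functionals by measures is therefore established first, for any compact Hausdorff space, by
  Caratheodory's construction from the outer measure attached to the functional
  (\<open>functional_eq_integral\<close>, \<open>distr_representing_measure\<close>).
\<close>

section \<open>Positive functionals on a compact Hausdorff space\<close>

locale normalized_positive_functional =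
  fixes T :: "'a topology" and \<Lambda> :: "('a \<Rightarrow> real) \<Rightarrow> real"
  assumes compact: "compact_space T" and Hausdorff: "Hausdorff_space T"
    and add: "\<And>f g. continuous_map T euclideanreal f \<Longrightarrow> continuous_map T euclideanreal g \<Longrightarrow>
               \<Lambda> (\<lambda>x. f x + g x) = \<Lambda> f + \<Lambda> g"
    and scale: "\<And>f c. continuous_map T euclideanreal f \<Longrightarrow> \<Lambda> (\<lambda>x. c * f x) = c * \<Lambda> f"
    and nonneg: "\<And>f. continuous_map T euclideanreal f \<Longrightarrow> (\<And>x. x \<in> topspace T \<Longrightarrow> 0 \<le> f x) \<Longrightarrow> 0 \<le> \<Lambda> f"
    and one: "\<Lambda> (\<lambda>x. 1) = 1"
begin

lemma const: "\<Lambda> (\<lambda>x. c) = c"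
  using scale[of "\<lambda>x. 1" c] one by simp

lemma diff:
  assumes "continuous_map T euclideanreal f" "continuous_map T euclideanreal g"
  shows "\<Lambda> (\<lambda>x. f x - g x) = \<Lambda> f - \<Lambda> g"
  using add[of f "\<lambda>x. (-1) * g x"] scale[of g "-1"] assms by (simp add: continuous_intros)

lemma mono:
  assumes "continuous_map T euclideanreal f" "continuous_map T euclideanreal g"
    and "\<And>x. x \<in> topspace T \<Longrightarrow> f x \<le> g x"
  shows "\<Lambda> f \<le> \<Lambda> g"
  using nonneg[of "\<lambda>x. g x - f x"] diff[of g f] assms by (simp add: continuous_intros)

lemma sum:
  assumes "\<And>i. i \<in> I \<Longrightarrow> continuous_map T euclideanreal (f i)"
  shows "\<Lambda> (\<lambda>x. \<Sum>i\<in>I. f i x) = (\<Sum>i\<in>I. \<Lambda> (f i))"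
proof (cases "finite I")
  case True
  then show ?thesis using assms
  proof (induction I)
    case empty
    then show ?case using const[of 0] by simp
  next
    case (insert i I)
    then show ?case
      by (simp add: add continuous_map_sum)
  qed
next
  case False
  then show ?thesis using const[of 0] by simp
qed

text \<open>Test functions for \<open>U\<close> are only required to vanish off \<open>U\<close>, not to
  have their support inside \<open>U\<close>. Compactness is regained by truncation:
  \<open>max 0 (f - \<epsilon>)\<close> lives on the compact set
  \<open>{f \<ge> \<epsilon>}\<close>, which lies inside \<open>U\<close>.\<close>

definition test_functions :: "'a set \<Rightarrow> ('a \<Rightarrow> real) set" where
  "test_functions U = {f. continuous_map T euclideanreal f \<and>
     (\<forall>x\<in>topspace T. 0 \<le> f x \<and> f x \<le> 1 \<and> (x \<notin> U \<longrightarrow> f x = 0))}"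

definition open_content :: "'a set \<Rightarrow> ennreal" where
  "open_content U = (SUP f\<in>test_functions U. ennreal (\<Lambda> f))"

definition outer :: "'a set \<Rightarrow> ennreal" where
  "outer E = (INF U\<in>{U. openin T U \<and> E \<subseteq> U}. open_content U)"

lemma test_functionsD:
  assumes "f \<in> test_functions U"
  shows "continuous_map T euclideanreal f" "x \<in> topspace T \<Longrightarrow> 0 \<le> f x"
    "x \<in> topspace T \<Longrightarrow> f x \<le> 1" "x \<in> topspace T \<Longrightarrow> x \<notin> U \<Longrightarrow> f x = 0" "0 \<le> \<Lambda> f"
  using assms nonneg[of f] unfolding test_functions_def by auto

lemma test_functions_mono: "U \<subseteq> V \<Longrightarrow> test_functions U \<subseteq> test_functions V"
  unfolding test_functions_def by auto

lemma zero_test_function: "(\<lambda>x. 0) \<in> test_functions U"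
  unfolding test_functions_def by auto

lemma open_content_mono: "U \<subseteq> V \<Longrightarrow> open_content U \<le> open_content V"
  unfolding open_content_def by (rule SUP_subset_mono[OF test_functions_mono]) auto

lemma open_content_ge: "f \<in> test_functions U \<Longrightarrow> ennreal (\<Lambda> f) \<le> open_content U"
  unfolding open_content_def by (rule SUP_upper)

lemma open_content_topspace: "open_content (topspace T) = 1"
proof (rule antisym)
  show "open_content (topspace T) \<le> 1"
    unfolding open_content_def
  proof (rule SUP_least)
    fix f assume f: "f \<in> test_functions (topspace T)"
    have "\<Lambda> f \<le> \<Lambda> (\<lambda>x. 1)"
      by (rule mono) (use test_functionsD[OF f] in auto)
    then show "ennreal (\<Lambda> f) \<le> 1" using one by simp
  qed
  have "(\<lambda>x. 1) \<in> test_functions (topspace T)" unfolding test_functions_def by auto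
  from open_content_ge[OF this] show "1 \<le> open_content (topspace T)" using one by simp
qed

lemma test_function_at_point:
  assumes "openin T U" "x \<in> U"
  shows "\<exists>g\<in>test_functions U. g x = 1"
proof -
  have "completely_regular_space T"
    using normal_imp_completely_regular_space_A[of T] compact Hausdorff
      compact_Hausdorff_or_regular_imp_normal_space Hausdorff_imp_t1_space by blast
  then obtain f where f: "continuous_map T euclideanreal f" "f x = 0" "f ` (topspace T - U) \<subseteq> {1}"
    using assms unfolding completely_regular_space_alt' by blast
  have "(\<lambda>y. max 0 (min 1 (1 - f y))) \<in> test_functions U"
    using f unfolding test_functions_def by (auto intro!: continuous_intros)
  then show ?thesis using f(2) by (auto intro!: bexI[of _ "\<lambda>y. max 0 (min 1 (1 - f y))"])
qed

text \<open>A compact substitute for a partition of unity: finitely many of the open sets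
  \<open>U i\<close> suffice for \<open>K\<close>, and the bumps subordinate to the same
  \<open>U i\<close> are merged into one function, so that each \<open>U i\<close> is charged only
  once.\<close>

lemma subordinate_functions:
  fixes U :: "nat \<Rightarrow> 'a set"
  assumes U: "\<And>i. openin T (U i)" and K: "compactin T K" "K \<subseteq> (\<Union>i. U i)"
  shows "\<exists>n h. (\<forall>i. h i \<in> test_functions (U i)) \<and> (\<forall>x\<in>K. 1 \<le> (\<Sum>i<n. h i x))"
proof -
  define W :: "nat \<times> ('a \<Rightarrow> real) \<Rightarrow> 'a set" where "W = (\<lambda>p. {x \<in> topspace T. snd p x \<in> {1/2<..}})"
  define Q where "Q = {p. snd p \<in> test_functions (U (fst p))}"
  have "openin T (W p)" if "p \<in> Q" for p
    unfolding W_def using test_functionsD(1)[of "snd p"] that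
    by (intro openin_continuous_map_preimage[where Y=euclideanreal]) (auto simp: Q_def)
  moreover have "K \<subseteq> \<Union> (W ` Q)"
  proof
    fix x assume x: "x \<in> K"
    then obtain i where "x \<in> U i" using K by auto
    then obtain g where "g \<in> test_functions (U i)" "g x = 1" using test_function_at_point[OF U] by blast
    moreover have "x \<in> topspace T" using x K compactin_subset_topspace by blast
    ultimately have "(i, g) \<in> Q" "x \<in> W (i, g)" by (auto simp: Q_def W_def)
    then show "x \<in> \<Union> (W ` Q)" by blast
  qed
  ultimately obtain \<F> where "finite \<F>" "\<F> \<subseteq> W ` Q" "K \<subseteq> \<Union>\<F>"
    using compactinD[OF K(1), of "W ` Q"] by blast
  then obtain C where C: "finite C" "C \<subseteq> Q" "K \<subseteq> \<Union> (W ` C)"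
    by (metis finite_subset_image)
  \<comment> \<open>The covering sets are \<open>{g > 1 / 2}\<close>, hence the factor \<open>2\<close>.\<close>
  define h where "h = (\<lambda>i x. min 1 (2 * (\<Sum>p\<in>{p\<in>C. fst p = i}. snd p x)))"
  obtain n where n: "fst ` C \<subseteq> {..<n}"
    using finite_nat_iff_bounded[of "fst ` C"] C(1) by auto
  have h: "h i \<in> test_functions (U i)" for i
  proof -
    have *: "snd p \<in> test_functions (U i)" if "p \<in> {p\<in>C. fst p = i}" for p
      using that C(2) by (auto simp: Q_def)
    have "continuous_map T euclideanreal (h i)"
      unfolding h_def using C(1) test_functionsD(1)[OF *]
      by (intro continuous_intros) auto
    moreover have "0 \<le> h i x \<and> h i x \<le> 1 \<and> (x \<notin> U i \<longrightarrow> h i x = 0)" if "x \<in> topspace T" for x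
    proof -
      have "0 \<le> (\<Sum>p\<in>{p\<in>C. fst p = i}. snd p x)"
        using test_functionsD(2)[OF * that] by (intro sum_nonneg) auto
      moreover have "(\<Sum>p\<in>{p\<in>C. fst p = i}. snd p x) = 0" if "x \<notin> U i"
        using test_functionsD(4)[OF * \<open>x \<in> topspace T\<close> that] by (intro sum.neutral) auto
      ultimately show ?thesis unfolding h_def by auto
    qed
    ultimately show ?thesis unfolding test_functions_def by auto
  qed
  have "1 \<le> (\<Sum>i<n. h i x)" if x: "x \<in> K" for x
  proof -
    obtain p where p: "p \<in> C" "x \<in> W p" using C x by auto
    have xT: "x \<in> topspace T" using p unfolding W_def by auto
    have "snd p x \<le> (\<Sum>q\<in>{q\<in>C. fst q = fst p}. snd q x)"
      using p C(1) C(2) test_functionsD(2)[OF _ xT] by (intro member_le_sum) (auto simp: Q_def)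
    then have "1 \<le> h (fst p) x" using p(2) unfolding h_def W_def by auto
    also have "\<dots> \<le> (\<Sum>i<n. h i x)"
      using n p(1) test_functionsD(2)[OF h xT] by (intro member_le_sum) auto
    finally show ?thesis .
  qed
  then show ?thesis using h by blast
qed

lemma truncation_test_function:
  assumes f: "f \<in> test_functions U" and "0 < \<epsilon>"
  shows "(\<lambda>x. max 0 (f x - \<epsilon>)) \<in> test_functions U" "\<Lambda> f \<le> \<Lambda> (\<lambda>x. max 0 (f x - \<epsilon>)) + \<epsilon>"
    "compactin T {x\<in>topspace T. f x \<in> {\<epsilon>..}}" "{x\<in>topspace T. f x \<in> {\<epsilon>..}} \<subseteq> U"
proof -
  note c = test_functionsD(1)[OF f]
  have c': "continuous_map T euclideanreal (\<lambda>x. max 0 (f x - \<epsilon>))"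
    by (intro continuous_intros c) 
  then show "(\<lambda>x. max 0 (f x - \<epsilon>)) \<in> test_functions U"
    using test_functionsD[OF f] \<open>0 < \<epsilon>\<close> unfolding test_functions_def by fastforce
  have "\<Lambda> f \<le> \<Lambda> (\<lambda>x. max 0 (f x - \<epsilon>) + \<epsilon>)"
    by (intro mono c continuous_intros c') auto
  also have "\<dots> = \<Lambda> (\<lambda>x. max 0 (f x - \<epsilon>)) + \<epsilon>"
    using add[OF c', of "\<lambda>x. \<epsilon>"] const by simp
  finally show "\<Lambda> f \<le> \<Lambda> (\<lambda>x. max 0 (f x - \<epsilon>)) + \<epsilon>" .
  have "closedin T {x\<in>topspace T. f x \<in> {\<epsilon>..}}"
    by (intro closedin_continuous_map_preimage[where Y=euclideanreal] c) auto
  then show "compactin T {x\<in>topspace T. f x \<in> {\<epsilon>..}}"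
    using compact closedin_compact_space by blast
  show "{x\<in>topspace T. f x \<in> {\<epsilon>..}} \<subseteq> U"
    using test_functionsD(4)[OF f] \<open>0 < \<epsilon>\<close> by force
qed

lemma open_content_Union:
  fixes U :: "nat \<Rightarrow> 'a set"
  assumes U: "\<And>i. openin T (U i)"
  shows "open_content (\<Union>i. U i) \<le> (\<Sum>i. open_content (U i))"
  unfolding open_content_def[of "\<Union>i. U i"]
proof (rule SUP_least, rule ennreal_le_epsilon)
  fix f and \<epsilon> :: real
  assume f: "f \<in> test_functions (\<Union>i. U i)" and e: "0 < \<epsilon>"
  let ?f = "\<lambda>x. max 0 (f x - \<epsilon>)"
  note tr = truncation_test_function[OF f e]
  from subordinate_functions[OF U tr(3,4)] obtain n h
    where h: "\<And>i. h i \<in> test_functions (U i)"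
      and n: "\<And>x. x \<in> topspace T \<Longrightarrow> f x \<ge> \<epsilon> \<Longrightarrow> 1 \<le> (\<Sum>i<n. h i x)"
    by auto
  have "\<Lambda> ?f \<le> \<Lambda> (\<lambda>x. \<Sum>i<n. h i x)"
  proof (rule mono)
    fix x assume x: "x \<in> topspace T"
    show "?f x \<le> (\<Sum>i<n. h i x)"
    proof (cases "f x \<ge> \<epsilon>")
      case True
      then show ?thesis using n[OF x] test_functionsD(3)[OF tr(1) x] by linarith
    next
      case False
      then have "?f x = 0" by simp
      also have "0 \<le> (\<Sum>i<n. h i x)" using test_functionsD(2)[OF h x] by (simp add: sum_nonneg)
      finally show ?thesis .
    qed
  qed (use test_functionsD(1)[OF tr(1)] test_functionsD(1)[OF h] in \<open>auto intro!: continuous_map_sum\<close>)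
  also have "\<dots> = (\<Sum>i<n. \<Lambda> (h i))"
    by (rule sum) (use test_functionsD(1)[OF h] in auto)
  finally have "\<Lambda> f \<le> (\<Sum>i<n. \<Lambda> (h i)) + \<epsilon>" using tr(2) by linarith
  then have "ennreal (\<Lambda> f) \<le> ennreal ((\<Sum>i<n. \<Lambda> (h i)) + \<epsilon>)" by (rule ennreal_leI)
  also have "\<dots> = (\<Sum>i<n. ennreal (\<Lambda> (h i))) + ennreal \<epsilon>"
    using test_functionsD(5)[OF h] e by (simp add: sum_nonneg)
  also have "\<dots> \<le> (\<Sum>i<n. open_content (U i)) + ennreal \<epsilon>"
    by (intro add_right_mono sum_mono open_content_ge h)
  also have "\<dots> \<le> (\<Sum>i. open_content (U i)) + ennreal \<epsilon>"
    by (intro add_right_mono sum_le_suminf) auto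
  finally show "ennreal (\<Lambda> f) \<le> (\<Sum>i. open_content (U i)) + ennreal \<epsilon>" .
qed

lemma outer_le: "openin T U \<Longrightarrow> E \<subseteq> U \<Longrightarrow> outer E \<le> open_content U"
  unfolding outer_def by (rule INF_lower) auto

lemma outer_open: "openin T U \<Longrightarrow> outer U = open_content U"
  by (rule antisym) (auto simp: outer_def intro: INF_lower INF_greatest open_content_mono)

lemma outer_mono: "E \<subseteq> E' \<Longrightarrow> outer E \<le> outer E'"
  unfolding outer_def by (rule INF_superset_mono) auto

lemma outer_approx:
  assumes "E \<subseteq> topspace T" "0 < \<epsilon>"
  shows "\<exists>U. openin T U \<and> E \<subseteq> U \<and> open_content U \<le> outer E + ennreal \<epsilon>"
proof -
  have "outer E \<le> open_content (topspace T)" using assms by (intro outer_le) auto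
  then have fin: "outer E < top" unfolding open_content_topspace using ennreal_one_less_top by (rule le_less_trans)
  then have "outer E < outer E + ennreal \<epsilon>" using assms(2)
    by (simp add: ennreal_add_left_cancel_less less_top)
  then obtain U where "U \<in> {U. openin T U \<and> E \<subseteq> U}" "open_content U < outer E + ennreal \<epsilon>"
    unfolding outer_def INF_less_iff by blast
  then show ?thesis by (auto intro: less_imp_le)
qed

lemma outer_measure_space_outer: "outer_measure_space (Pow (topspace T)) outer"
  unfolding outer_measure_space_def
proof (intro conjI)
  have "open_content {} = 0"
  proof -
    have "\<Lambda> f \<le> 0" if "f \<in> test_functions {}" for f
      using mono[of f "\<lambda>x. 0"] const[of 0] test_functionsD[OF that] by simp
    then show ?thesis unfolding open_content_def by (auto simp: ennreal_neg bot_ennreal[symmetric])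
  qed
  then show "positive (Pow (topspace T)) outer"
    unfolding positive_def by (simp add: outer_open)
  show "increasing (Pow (topspace T)) outer"
    unfolding increasing_def by (auto intro: outer_mono)
  show "countably_subadditive (Pow (topspace T)) outer"
    unfolding countably_subadditive_def
  proof (intro allI impI, rule ennreal_le_epsilon)
    fix A :: "nat \<Rightarrow> 'a set" and \<epsilon> :: real
    assume A: "range A \<subseteq> Pow (topspace T)" and e: "0 < \<epsilon>"
    have "\<exists>U. openin T U \<and> A i \<subseteq> U \<and> open_content U \<le> outer (A i) + ennreal (\<epsilon> * (1/2) ^ Suc i)" for i
      using A e by (intro outer_approx) auto
    then obtain U where U: "\<And>i. openin T (U i)" "\<And>i. A i \<subseteq> U i"
      "\<And>i. open_content (U i) \<le> outer (A i) + ennreal (\<epsilon> * (1/2) ^ Suc i)" by metis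
    have "outer (\<Union>i. A i) \<le> open_content (\<Union>i. U i)"
      using U by (intro outer_le) auto
    also have "\<dots> \<le> (\<Sum>i. open_content (U i))" by (rule open_content_Union[OF U(1)])
    also have "\<dots> \<le> (\<Sum>i. outer (A i) + ennreal (\<epsilon> * (1/2) ^ Suc i))"
      by (intro suminf_le U(3)) auto
    also have "\<dots> = (\<Sum>i. outer (A i)) + (\<Sum>i. ennreal (\<epsilon> * (1/2) ^ Suc i))"
      by (rule suminf_add[symmetric]) auto
    also have "(\<Sum>i. ennreal (\<epsilon> * (1/2) ^ Suc i)) = ennreal \<epsilon>"
    proof (rule suminf_ennreal_eq)
      show "(\<lambda>i. \<epsilon> * (1/2) ^ Suc i) sums \<epsilon>" using sums_mult[OF power_half_series, of \<epsilon>] by simp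
    qed (use e in auto)
    finally show "outer (\<Union>i. A i) \<le> (\<Sum>i. outer (A i)) + ennreal \<epsilon>" .
  qed
qed

text \<open>The supremum defining \<open>open_content (V \<inter> U)\<close> is nearly attained by a
  function that lives on a compact subset \<open>K\<close> of \<open>V \<inter> U\<close>; any function
  living on \<open>V - K\<close>, hence one nearly attaining the content of a neighbourhood of
  \<open>V - U\<close>, can be added to it and stays below the indicator of \<open>V\<close>.\<close>

lemma open_content_split:
  assumes V: "openin T V" and U: "openin T U"
  shows "outer (V \<inter> U) + outer (V - U) \<le> outer V"
proof -
  have VU: "openin T (V \<inter> U)" using V U by auto
  have *: "ennreal (\<Lambda> f) + outer (V - U) \<le> open_content V" if f: "f \<in> test_functions (V \<inter> U)" for f
  proof (rule ennreal_le_epsilon)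
    fix \<epsilon> :: real assume e: "0 < \<epsilon>"
    let ?f = "\<lambda>x. max 0 (f x - \<epsilon>)"
    define K where "K = {x\<in>topspace T. f x \<in> {\<epsilon>..}}"
    note tr = truncation_test_function[OF f e, folded K_def]
    have cK: "closedin T K" using tr(3) Hausdorff compactin_imp_closedin by blast
    then have VK: "openin T (V - K)" using V by auto
    have "ennreal (\<Lambda> ?f) + open_content (V - K) = (SUP h\<in>test_functions (V - K). ennreal (\<Lambda> ?f) + ennreal (\<Lambda> h))"
      unfolding open_content_def by (rule ennreal_SUP_add_right) (use zero_test_function in blast)
    also have "\<dots> \<le> open_content V"
    proof (rule SUP_least)
      fix h assume h: "h \<in> test_functions (V - K)"
      have "(\<lambda>x. ?f x + h x) \<in> test_functions V"
      proof -
        have "continuous_map T euclideanreal (\<lambda>x. ?f x + h x)"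
          by (rule continuous_map_add[OF test_functionsD(1)[OF tr(1)] test_functionsD(1)[OF h]])
        moreover have "0 \<le> ?f x + h x \<and> ?f x + h x \<le> 1 \<and> (x \<notin> V \<longrightarrow> ?f x + h x = 0)"
          if x: "x \<in> topspace T" for x
        proof -
          have "x \<in> K \<Longrightarrow> h x = 0" using test_functionsD(4)[OF h x] by auto
          moreover have "x \<notin> K \<Longrightarrow> ?f x = 0" using x unfolding K_def by auto
          ultimately show ?thesis
            using test_functionsD(2-4)[OF h x] test_functionsD(2-4)[OF tr(1) x] by (cases "x \<in> K") auto
        qed
        ultimately show ?thesis unfolding test_functions_def by auto
      qed
      from open_content_ge[OF this] add[OF test_functionsD(1)[OF tr(1)] test_functionsD(1)[OF h]]
      show "ennreal (\<Lambda> ?f) + ennreal (\<Lambda> h) \<le> open_content V"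
        using test_functionsD(5)[OF h] test_functionsD(5)[OF tr(1)] by simp
    qed
    finally have 1: "ennreal (\<Lambda> ?f) + open_content (V - K) \<le> open_content V" .
    have "outer (V - U) \<le> open_content (V - K)" using VK tr(4) by (intro outer_le) auto
    moreover have "ennreal (\<Lambda> f) \<le> ennreal (\<Lambda> ?f) + ennreal \<epsilon>"
      using ennreal_leI[OF tr(2)] test_functionsD(5)[OF tr(1)] e by simp
    ultimately have "ennreal (\<Lambda> f) + outer (V - U) \<le> (ennreal (\<Lambda> ?f) + ennreal \<epsilon>) + open_content (V - K)"
      by (rule add_mono[rotated])
    also have "\<dots> = (ennreal (\<Lambda> ?f) + open_content (V - K)) + ennreal \<epsilon>" by (simp add: ac_simps)
    also have "\<dots> \<le> open_content V + ennreal \<epsilon>" by (rule add_right_mono[OF 1])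
    finally show "ennreal (\<Lambda> f) + outer (V - U) \<le> open_content V + ennreal \<epsilon>" .
  qed
  have "outer (V \<inter> U) + outer (V - U) = (SUP f\<in>test_functions (V \<inter> U). ennreal (\<Lambda> f) + outer (V - U))"
    unfolding outer_open[OF VU] open_content_def
    using zero_test_function by (intro ennreal_SUP_add_left[symmetric]) blast
  also have "\<dots> \<le> open_content V" by (rule SUP_least) (rule *)
  finally show ?thesis by (simp add: outer_open V)
qed

lemma open_in_lambda_system:
  assumes U: "openin T U"
  shows "U \<in> lambda_system (topspace T) (Pow (topspace T)) outer"
proof -
  interpret sigma_algebra "topspace T" "Pow (topspace T)" by (rule sigma_algebra_Pow)
  have "outer (E \<inter> U) + outer (E - U) = outer E" if E: "E \<subseteq> topspace T" for E
  proof (rule antisym)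
    show "outer (E \<inter> U) + outer (E - U) \<le> outer E"
    proof (rule ennreal_le_epsilon)
      fix \<epsilon> :: real assume e: "0 < \<epsilon>"
      obtain V where V: "openin T V" "E \<subseteq> V" "open_content V \<le> outer E + ennreal \<epsilon>"
        using outer_approx[OF E e] by blast
      have "outer (E \<inter> U) + outer (E - U) \<le> outer (V \<inter> U) + outer (V - U)"
        using V by (intro add_mono outer_mono) auto
      also have "\<dots> \<le> outer V" by (rule open_content_split[OF V(1) U])
      also have "\<dots> \<le> outer E + ennreal \<epsilon>" using V outer_open by simp
      finally show "outer (E \<inter> U) + outer (E - U) \<le> outer E + ennreal \<epsilon>" .
    qed
    have "subadditive (Pow (topspace T)) outer"
      using outer_measure_space_outer countably_subadditive_subadditive
      unfolding outer_measure_space_def by blast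
    then have "outer ((E \<inter> U) \<union> (E - U)) \<le> outer (E \<inter> U) + outer (E - U)"
      using E by (intro subadditiveD[of "Pow (topspace T)"]) auto
    moreover have "(E \<inter> U) \<union> (E - U) = E" by auto
    ultimately show "outer E \<le> outer (E \<inter> U) + outer (E - U)" by simp
  qed
  then show ?thesis using openin_subset[OF U] by (auto simp: lambda_system_eq)
qed

definition representing_measure :: "'a measure" where
  "representing_measure = measure_of (topspace T) {U. openin T U} outer"

lemma space_representing_measure: "space representing_measure = topspace T"
  unfolding representing_measure_def by (rule space_measure_of) (auto dest: openin_subset)

lemma sets_representing_measure: "sets representing_measure = sets (borel_of_topology T)"
  unfolding representing_measure_def borel_of_topology_def
  by (subst (1 2) sets_measure_of) (auto dest: openin_subset)

lemma emeasure_representing_measure: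
  assumes "E \<in> sets representing_measure"
  shows "emeasure representing_measure E = outer E"
proof (rule emeasure_measure_of[OF representing_measure_def])
  let ?L = "lambda_system (topspace T) (Pow (topspace T)) outer"
  have L: "measure_space (topspace T) ?L outer"
    by (rule sigma_algebra.caratheodory_lemma[OF sigma_algebra_Pow outer_measure_space_outer])
  then interpret L: sigma_algebra "topspace T" ?L unfolding measure_space_def by simp
  have "sigma_sets (topspace T) {U. openin T U} \<subseteq> ?L"
    by (rule L.sigma_sets_subset) (auto intro: open_in_lambda_system)
  from measure_down[OF L sigma_algebra_sigma_sets this]
  have ms: "measure_space (topspace T) (sigma_sets (topspace T) {U. openin T U}) outer"
    by (auto dest: openin_subset)
  have s: "sets representing_measure = sigma_sets (topspace T) {U. openin T U}"
    unfolding representing_measure_def by (rule sets_measure_of) (auto dest: openin_subset)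
  show "positive (sets representing_measure) outer" "countably_additive (sets representing_measure) outer"
    using ms unfolding measure_space_def s by auto
qed (use assms in \<open>auto dest: openin_subset\<close>)

lemma open_in_sets: "openin T U \<Longrightarrow> U \<in> sets representing_measure"
  unfolding sets_representing_measure borel_of_topology_def
  by (auto dest: openin_subset)

lemma emeasure_open: "openin T U \<Longrightarrow> emeasure representing_measure U = open_content U"
  by (simp add: emeasure_representing_measure open_in_sets outer_open)

lemma prob_space_representing_measure: "prob_space representing_measure"
  by (rule prob_spaceI) (simp add: space_representing_measure emeasure_open open_content_topspace)

lemma continuous_map_measurable:
  assumes "continuous_map T euclideanreal f"
  shows "f \<in> borel_measurable representing_measure"
proof (rule borel_measurableI)
  fix S :: "real set" assume "open S"
  then have "openin T {x\<in>topspace T. f x \<in> S}"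
    by (intro openin_continuous_map_preimage[OF assms]) auto
  moreover have "f -` S \<inter> space representing_measure = {x\<in>topspace T. f x \<in> S}"
    by (auto simp: space_representing_measure)
  ultimately show "f -` S \<inter> space representing_measure \<in> sets representing_measure"
    using open_in_sets by simp
qed

text \<open>Slice a function with values in \<open>[0, 1]\<close> into \<open>n\<close> layers of height
  \<open>1 / n\<close>. The \<open>k\<close>-th layer is \<open>1 / n\<close> times a test function
  for \<open>{f > k / n}\<close>, which bounds \<open>\<Lambda> f\<close> by a lower Riemann sum for
  the integral, up to the bottom layer.\<close>

lemma functional_le_integral:
  assumes f: "continuous_map T euclideanreal f" "\<And>x. x \<in> topspace T \<Longrightarrow> 0 \<le> f x \<and> f x \<le> 1"
  shows "\<Lambda> f \<le> (\<integral>x. f x \<partial>representing_measure)"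
proof -
  interpret prob_space representing_measure by (rule prob_space_representing_measure)
  have int: "integrable representing_measure f"
    using f(2) continuous_map_measurable[OF f(1)]
    by (intro integrable_const_bound[where B=1]) (auto intro!: AE_I2 simp: space_representing_measure)
  have *: "\<Lambda> f \<le> (\<integral>x. f x \<partial>representing_measure) + 1 / real n" if n: "n > 0" for n :: nat
  proof -
    define g where "g = (\<lambda>(k::nat) x. max 0 (min 1 (real n * f x - real k)))"
    define U where "U = (\<lambda>k::nat. {x\<in>topspace T. f x \<in> {real k / real n<..}})"
    have U: "openin T (U k)" for k
      unfolding U_def by (intro openin_continuous_map_preimage[OF f(1)]) auto
    have g: "g k \<in> test_functions (U k)" for k
    proof -
      have "continuous_map T euclideanreal (g k)" unfolding g_def by (intro continuous_intros f(1))
      then show ?thesis using n by (auto simp: test_functions_def g_def U_def field_simps)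
    qed
    have sum_g: "(\<Sum>k<n. g k x) = real n * f x" if x: "x \<in> topspace T" for x
    proof -
      have "(\<Sum>k<j. g k x) = min (real j) (real n * f x)" for j :: nat
      proof (induction j)
        case 0
        then show ?case using f(2)[OF x] by simp
      next
        case (Suc j)
        then show ?case unfolding g_def by (auto simp: min_def max_def)
      qed
      then show ?thesis using f(2)[OF x] n by (simp add: min_def mult_left_le)
    qed
    have ind_le: "(\<Sum>k<n. indicat_real (U k) x) \<le> 1 + real n * f x" if x: "x \<in> topspace T" for x
    proof -
      have "indicat_real (U (Suc k)) x \<le> g k x" for k
        using n x by (auto simp: g_def U_def indicator_def field_simps)
      then have "(\<Sum>k<n-1. indicat_real (U (Suc k)) x) \<le> (\<Sum>k<n-1. g k x)" by (intro sum_mono)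
      also have "\<dots> \<le> (\<Sum>k<n. g k x)"
        by (intro sum_mono2) (auto intro: test_functionsD(2)[OF g x])
      finally have "(\<Sum>k<n-1. indicat_real (U (Suc k)) x) \<le> real n * f x" using sum_g[OF x] by simp
      moreover have "(\<Sum>k<n. indicat_real (U k) x) = indicat_real (U 0) x + (\<Sum>k<n-1. indicat_real (U (Suc k)) x)"
        using n sum.lessThan_Suc_shift[of "\<lambda>k. indicat_real (U k) x" "n-1"] by simp
      moreover have "indicat_real (U 0) x \<le> 1" by (simp add: indicator_def)
      ultimately show ?thesis by linarith
    qed
    have le: "\<Lambda> (g k) \<le> measure representing_measure (U k)" for k
    proof -
      have "ennreal (\<Lambda> (g k)) \<le> ennreal (measure representing_measure (U k))"
        using open_content_ge[OF g] emeasure_open[OF U] by (simp add: emeasure_eq_measure)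
      then show ?thesis by simp
    qed
    have "real n * \<Lambda> f = \<Lambda> (\<lambda>x. real n * f x)" using scale[OF f(1)] by simp
    also have "\<dots> \<le> \<Lambda> (\<lambda>x. \<Sum>k<n. g k x)"
      using sum_g f(1) test_functionsD(1)[OF g] by (intro mono continuous_intros) auto
    also have "\<dots> = (\<Sum>k<n. \<Lambda> (g k))" by (rule sum) (use test_functionsD(1)[OF g] in auto)
    also have "\<dots> \<le> (\<Sum>k<n. measure representing_measure (U k))" by (intro sum_mono le)
    also have "\<dots> = (\<integral>x. (\<Sum>k<n. indicat_real (U k) x) \<partial>representing_measure)"
      using open_in_sets[OF U]
      by (subst Bochner_Integration.integral_sum) (auto simp: emeasure_eq_measure)
    also have "\<dots> \<le> (\<integral>x. 1 + real n * f x \<partial>representing_measure)"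
      using open_in_sets[OF U] int ind_le
      by (intro integral_mono Bochner_Integration.integrable_sum)
         (auto simp: emeasure_eq_measure space_representing_measure)
    also have "\<dots> = 1 + real n * (\<integral>x. f x \<partial>representing_measure)"
      using int prob_space by simp
    finally show ?thesis using n by (simp add: field_simps)
  qed
  show ?thesis
  proof (rule field_le_epsilon)
    fix e :: real assume "0 < e"
    then obtain n :: nat where "0 < n" "1 / real n < e"
      using reals_Archimedean[of e] by (metis inverse_eq_divide zero_less_Suc)
    then show "\<Lambda> f \<le> (\<integral>x. f x \<partial>representing_measure) + e" using *[of n] by linarith
  qed
qed

text \<open>Applying the one-sided bound to \<open>1 - f\<close> gives the other one, since both sides
  give the constant \<open>1\<close> the value \<open>1\<close>.\<close>

theorem functional_eq_integral:
  assumes f: "continuous_map T euclideanreal f" "\<And>x. x \<in> topspace T \<Longrightarrow> 0 \<le> f x \<and> f x \<le> 1"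
  shows "\<Lambda> f = (\<integral>x. f x \<partial>representing_measure)"
proof (rule antisym[OF functional_le_integral[OF f]])
  interpret prob_space representing_measure by (rule prob_space_representing_measure)
  have int: "integrable representing_measure f"
    using f(2) continuous_map_measurable[OF f(1)]
    by (intro integrable_const_bound[where B=1]) (auto intro!: AE_I2 simp: space_representing_measure)
  have "\<Lambda> (\<lambda>x. 1 - f x) \<le> (\<integral>x. 1 - f x \<partial>representing_measure)"
    using f by (intro functional_le_integral continuous_intros) auto
  also have "\<Lambda> (\<lambda>x. 1 - f x) = 1 - \<Lambda> f" using diff[of "\<lambda>x. 1" f] f(1) one by simp
  also have "(\<integral>x. 1 - f x \<partial>representing_measure) = 1 - (\<integral>x. f x \<partial>representing_measure)"
    using int prob_space by simp
  finally show "(\<integral>x. f x \<partial>representing_measure) \<le> \<Lambda> f" by simp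
qed

text \<open>The outer measure is built from \<open>\<Lambda>\<close> and the topology alone, so a
  homeomorphism that preserves both preserves it.\<close>

lemma distr_representing_measure:
  assumes h: "homeomorphic_maps T T h h'"
    and inv: "\<And>f. continuous_map T euclideanreal f \<Longrightarrow> \<Lambda> (\<lambda>x. f (h x)) = \<Lambda> f"
  shows "distr representing_measure representing_measure h = representing_measure"
proof -
  have ch: "continuous_map T T h" and ch': "continuous_map T T h'"
    and hh': "\<And>x. x \<in> topspace T \<Longrightarrow> h' (h x) = x" "\<And>x. x \<in> topspace T \<Longrightarrow> h (h' x) = x"
    using h unfolding homeomorphic_maps_def by auto
  have hT: "h x \<in> topspace T" "h' x \<in> topspace T" if "x \<in> topspace T" for x
    using that continuous_map_image_subset_topspace[OF ch] continuous_map_image_subset_topspace[OF ch'] by auto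
  define pre where "pre = (\<lambda>E. {x\<in>topspace T. h x \<in> E})"
  have pre_open: "openin T (pre U)" if "openin T U" for U
    unfolding pre_def by (rule openin_continuous_map_preimage[OF ch that])
  have inv': "\<Lambda> (\<lambda>x. f (h' x)) = \<Lambda> f" if f: "continuous_map T euclideanreal f" for f
  proof -
    have c: "continuous_map T euclideanreal (\<lambda>x. f (h' x))"
      using continuous_map_compose[OF ch' f] by (simp add: o_def)
    have c': "continuous_map T euclideanreal (\<lambda>x. f (h' (h x)))"
      using continuous_map_compose[OF ch c] by (simp add: o_def)
    have "\<Lambda> (\<lambda>x. f (h' x)) = \<Lambda> (\<lambda>x. f (h' (h x)))" using inv[OF c] by simp
    also have "\<dots> = \<Lambda> f" by (intro antisym mono c' f) (auto simp: hh')
    finally show ?thesis .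
  qed
  have content: "open_content (pre U) = open_content U" if U: "openin T U" for U
  proof (rule antisym)
    show "open_content (pre U) \<le> open_content U"
      unfolding open_content_def[of "pre U"]
    proof (rule SUP_least)
      fix f assume f: "f \<in> test_functions (pre U)"
      have "(\<lambda>x. f (h' x)) \<in> test_functions U"
        using continuous_map_compose[OF ch' test_functionsD(1)[OF f]] test_functionsD(2-4)[OF f] hT hh'
        unfolding test_functions_def by (auto simp: o_def pre_def)
      from open_content_ge[OF this] show "ennreal (\<Lambda> f) \<le> open_content U"
        using inv'[OF test_functionsD(1)[OF f]] by simp
    qed
    show "open_content U \<le> open_content (pre U)"
      unfolding open_content_def[of "U"]
    proof (rule SUP_least)
      fix f assume f: "f \<in> test_functions U"
      have "(\<lambda>x. f (h x)) \<in> test_functions (pre U)"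
        using continuous_map_compose[OF ch test_functionsD(1)[OF f]] test_functionsD(2-4)[OF f] hT hh'
        unfolding test_functions_def by (auto simp: o_def pre_def)
      from open_content_ge[OF this] show "ennreal (\<Lambda> f) \<le> open_content (pre U)"
        using inv[OF test_functionsD(1)[OF f]] by simp
    qed
  qed
  have meas: "h \<in> measurable representing_measure representing_measure"
  proof (rule measurable_measure_of[of "{U. openin T U}" "topspace T" h representing_measure outer, folded representing_measure_def])
    show "h \<in> space representing_measure \<rightarrow> topspace T"
      using hT by (auto simp: space_representing_measure)
    show "h -` U \<inter> space representing_measure \<in> sets representing_measure"
      if "U \<in> {U. openin T U}" for U
    proof -
      have "h -` U \<inter> space representing_measure = pre U" by (auto simp: pre_def space_representing_measure)
      then show ?thesis using pre_open[of U] that open_in_sets by simp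
    qed
  qed (auto dest: openin_subset)
  show ?thesis
  proof (rule measure_eqI)
    fix E assume "E \<in> sets (distr representing_measure representing_measure h)"
    then have E: "E \<in> sets representing_measure" by simp
    then have ET: "E \<subseteq> topspace T" using sets.sets_into_space space_representing_measure by metis
    have preE: "h -` E \<inter> space representing_measure = pre E" by (auto simp: pre_def space_representing_measure)
    have "outer (pre E) = outer E"
    proof (rule antisym)
      show "outer (pre E) \<le> outer E"
        unfolding outer_def[of E]
      proof (rule INF_greatest)
        fix U assume U: "U \<in> {U. openin T U \<and> E \<subseteq> U}"
        then have "outer (pre E) \<le> open_content (pre U)"
          by (intro outer_le pre_open) (auto simp: pre_def)
        then show "outer (pre E) \<le> open_content U" using content U by simp
      qed
      show "outer E \<le> outer (pre E)"
        unfolding outer_def[of "pre E"]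
      proof (rule INF_greatest)
        fix V assume V: "V \<in> {V. openin T V \<and> pre E \<subseteq> V}"
        define U where "U = {y\<in>topspace T. h' y \<in> V}"
        have U: "openin T U" unfolding U_def by (rule openin_continuous_map_preimage[OF ch']) (use V in auto)
        have "V \<subseteq> topspace T" using V openin_subset by auto
        then have preU: "pre U = V" using hh' hT by (auto simp: pre_def U_def)
        have "E \<subseteq> U"
        proof
          fix y assume y: "y \<in> E"
          then have "h' y \<in> pre E" using hh'(2)[of y] hT(2)[of y] ET by (auto simp: pre_def)
          then show "y \<in> U" using V y ET by (auto simp: U_def)
        qed
        then have "outer E \<le> open_content U" by (rule outer_le[OF U])
        then show "outer E \<le> open_content V" using content[OF U] preU by simp
      qed
    qed
    then show "emeasure (distr representing_measure representing_measure h) E = emeasure representing_measure E"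
      using measurable_sets[OF meas E]
      by (simp add: emeasure_distr[OF meas E] preE emeasure_representing_measure E)
  qed simp
qed

end

section \<open>Groups with an admissible metric\<close>

lemma closed_translate:
  fixes S :: "'g :: topological_group_add set"
  assumes "closed S"
  shows "closed ((+) g ` S)"
proof -
  have "(+) g ` S = (\<lambda>x. - g + x) -` S"
  proof (intro equalityI subsetI)
    fix x assume "x \<in> (\<lambda>x. - g + x) -` S"
    then show "x \<in> (+) g ` S" by (intro image_eqI[of _ _ "- g + x"]) (auto simp: add.assoc[symmetric])
  qed (auto simp: add.assoc[symmetric])
  then show ?thesis using assms by (auto intro!: closed_vimage continuous_intros)
qed

locale admissible_group =
  fixes d :: "'g :: {topological_group_add, second_countable_topology, t2_space} \<Rightarrow> 'g \<Rightarrow> real"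
  assumes admissible: "admissible_metric d"
begin

sublocale Metric_space UNIV d
  using admissible unfolding admissible_metric_def by blast

lemma dist_translate: "d (g + x) (g + y) = d x y"
  using admissible unfolding admissible_metric_def by blast

lemma dist_eq: "d x y = d 0 (- x + y)"
  using dist_translate[of "-x" x y] by simp

lemma dist_zero_minus: "d 0 (- x) = d 0 x"
  using dist_translate[of x 0 "-x"] commute[of x 0] by simp

lemma compact_closed_ball: "compact {y. d x y \<le> r}"
  using admissible unfolding admissible_metric_def by blast

lemma open_iff: "open U \<longleftrightarrow> (\<forall>x\<in>U. \<exists>r>0. {y. d x y < r} \<subseteq> U)"
proof -
  have "open U \<longleftrightarrow> openin mtopology U"
    using admissible open_openin[of U] unfolding admissible_metric_def by metis
  then show ?thesis unfolding openin_mtopology by (auto simp: mball_def)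
qed

lemma open_contains_ball: "open U \<Longrightarrow> x \<in> U \<Longrightarrow> \<exists>r>0. {y. d x y < r} \<subseteq> U"
  using open_iff by simp

lemma open_ball: "open {y. d x y < r}"
  unfolding open_iff
proof safe
  fix y assume y: "d x y < r"
  have "{z. d y z < r - d x y} \<subseteq> {z. d x z < r}"
  proof safe
    fix z assume "d y z < r - d x y"
    then show "d x z < r" using triangle[of x y z] by simp
  qed
  then show "\<exists>s>0. {z. d y z < s} \<subseteq> {z. d x z < r}" using y by (intro exI[of _ "r - d x y"]) auto
qed

lemma continuous_dist: "continuous_on UNIV (d x)"
  unfolding continuous_on_open_vimage[OF open_UNIV]
proof (intro allI impI, unfold open_iff, safe)
  fix B :: "real set" and y assume "open B" and y: "d x y \<in> B"
  then obtain e where e: "e > 0" "\<And>t. \<bar>t - d x y\<bar> < e \<Longrightarrow> t \<in> B"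
    unfolding open_dist dist_real_def by blast
  have "\<bar>d x z - d x y\<bar> \<le> d y z" for z
    using triangle[of x y z] triangle[of x z y] commute[of y z] by simp
  then have "{z. d y z < e} \<subseteq> d x -` B \<inter> UNIV" using e(2) by (fastforce intro: le_less_trans)
  then show "\<exists>r>0. {z. d y z < r} \<subseteq> d x -` B \<inter> UNIV" using e(1) by blast
qed

lemma finite_ball_cover:
  assumes K: "compact K" and r: "\<And>x. x \<in> K \<Longrightarrow> r x > 0"
  shows "\<exists>I. finite I \<and> I \<subseteq> K \<and> K \<subseteq> (\<Union>x\<in>I. {y. d x y < r x})"
proof -
  have "K \<subseteq> (\<Union>x\<in>K. {y. d x y < r x})" using r by auto
  from compactE_image[OF K open_ball this] show ?thesis by metis
qed

lemma compact_bounded: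
  assumes "compact K"
  shows "\<exists>R>0. K \<subseteq> {y. d 0 y \<le> R}"
proof -
  obtain I where I: "finite I" "K \<subseteq> (\<Union>x\<in>I. {y. d x y < 1})"
    using finite_ball_cover[OF assms, of "\<lambda>x. 1", OF zero_less_one] by blast
  have "d 0 y \<le> 1 + (\<Sum>x\<in>I. d 0 x)" if "y \<in> K" for y
  proof -
    obtain x where x: "x \<in> I" "d x y < 1" using I(2) \<open>y \<in> K\<close> by blast
    have "d 0 x \<le> (\<Sum>x\<in>I. d 0 x)" using x(1) I(1) by (intro member_le_sum) auto
    then show ?thesis using triangle[of 0 x y, OF UNIV_I UNIV_I UNIV_I] x(2) by linarith
  qed
  moreover have "0 \<le> (\<Sum>x\<in>I. d 0 x)" by (intro sum_nonneg) auto
  ultimately show ?thesis by (intro exI[of _ "1 + (\<Sum>x\<in>I. d 0 x)"]) auto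
qed

lemma Cc_iff: "f \<in> Cc \<longleftrightarrow> continuous_on UNIV f \<and> (\<exists>R. \<forall>x. f x \<noteq> 0 \<longrightarrow> d 0 x \<le> R)"
proof safe
  assume f: "f \<in> Cc"
  then show "continuous_on UNIV f" unfolding Cc_def by simp
  have "compact (closure {x. f x \<noteq> 0})" using f unfolding Cc_def by simp
  then obtain R where "closure {x. f x \<noteq> 0} \<subseteq> {y. d 0 y \<le> R}"
    using compact_bounded by blast
  then show "\<exists>R. \<forall>x. f x \<noteq> 0 \<longrightarrow> d 0 x \<le> R"
    using closure_subset[of "{x. f x \<noteq> 0}"] by (intro exI[of _ R]) blast
next
  fix R assume f: "continuous_on UNIV f" "\<forall>x. f x \<noteq> 0 \<longrightarrow> d 0 x \<le> R"
  have "closure {x. f x \<noteq> 0} \<subseteq> {y. d 0 y \<le> R}"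
    using f compact_imp_closed[OF compact_closed_ball] by (intro closure_minimal) auto
  then have "compact (closure {x. f x \<noteq> 0})"
    using compact_closed_ball closed_closure compact_Int_closed by (metis inf.absorb2)
  then show "f \<in> Cc" unfolding Cc_def using f by simp
qed

lemma uniformly_continuous:
  fixes f :: "'g \<Rightarrow> 'b::real_normed_vector"
  assumes f: "continuous_on UNIV f" "\<And>x. f x \<noteq> 0 \<Longrightarrow> d 0 x \<le> R" and e: "\<epsilon> > 0"
  shows "\<exists>\<delta>>0. \<forall>x y. d x y < \<delta> \<longrightarrow> norm (f x - f y) < \<epsilon>"
proof -
  have "\<exists>r>0. {y. d x y < r} \<subseteq> {y. norm (f y - f x) < \<epsilon>/2}" for x
  proof -
    have "open {y. norm (f y - f x) < \<epsilon>/2}"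
      using f(1) by (intro open_Collect_less continuous_intros) auto
    from open_contains_ball[OF this, of x] e show ?thesis by simp
  qed
  then obtain r where r: "\<And>x. r x > 0" "\<And>x y. d x y < r x \<Longrightarrow> norm (f y - f x) < \<epsilon>/2"
    by (metis mem_Collect_eq subset_eq)
  let ?K = "{y. d 0 y \<le> R + 1}"
  have "0 < r x / 2" for x using r(1) by simp
  then obtain I where I: "finite I" "?K \<subseteq> (\<Union>x\<in>I. {y. d x y < r x / 2})"
    using finite_ball_cover[OF compact_closed_ball, of 0 "R + 1" "\<lambda>x. r x / 2"] by blast
  define \<delta> where "\<delta> = Min (insert 1 ((\<lambda>x. r x / 2) ` I))"
  have \<delta>: "\<delta> > 0" "\<delta> \<le> 1"
    unfolding \<delta>_def using I(1) r(1) by auto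
  have \<delta>_le: "\<delta> \<le> r x / 2" if "x \<in> I" for x
    unfolding \<delta>_def using I(1) that by (intro Min_le) auto
  have "norm (f x - f y) < \<epsilon>" if xy: "d x y < \<delta>" for x y
  proof (cases "d 0 x \<le> R + 1")
    case True
    then obtain c where c: "c \<in> I" "d c x < r c / 2" using I(2) by blast
    have "d c y < r c" using triangle[of c x y] c xy \<delta>_le[OF c(1)] by simp
    moreover have "d c x < r c" using c r(1)[of c] by simp
    ultimately have "norm (f y - f c) < \<epsilon>/2" "norm (f x - f c) < \<epsilon>/2" using r(2) by auto
    then show ?thesis using norm_triangle_ineq4[of "f x - f c" "f y - f c"] by simp
  next
    case False
    then have "\<not> d 0 y \<le> R" using triangle[of 0 y x] commute[of x y] xy \<delta>(2) by simp
    moreover have "\<not> d 0 x \<le> R" using False by simp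
    ultimately have "f x = 0" "f y = 0" using f(2) by blast+
    then show ?thesis using e by simp
  qed
  then show ?thesis using \<delta>(1) by blast
qed

text \<open>Two points of a set with minimal distance \<open>r\<close> cannot share a ball of radius
  \<open>r / 2\<close>, and finitely many such balls cover a compact set.\<close>

lemma finite_separated_bounded:
  assumes sep: "\<And>x y. x \<in> P \<Longrightarrow> y \<in> P \<Longrightarrow> d x y < r \<Longrightarrow> x = y" and "r > 0" and K: "compact K"
  shows "finite (P \<inter> K)"
proof -
  obtain I where I: "finite I" "K \<subseteq> (\<Union>x\<in>I. {y. d x y < r / 2})"
    using finite_ball_cover[OF K, of "\<lambda>x. r / 2", OF half_gt_zero] \<open>r > 0\<close> by blast
  have "finite (P \<inter> {y. d x y < r / 2})" for x
  proof -
    have "a = b" if "a \<in> P \<inter> {y. d x y < r / 2}" "b \<in> P \<inter> {y. d x y < r / 2}" for a b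
      using that sep[of a b] triangle[of a x b] commute[of x a] by simp
    then have "\<exists>c. P \<inter> {y. d x y < r / 2} \<subseteq> {c}" by blast
    then show ?thesis using finite_subset by blast
  qed
  then have "finite (\<Union>x\<in>I. P \<inter> {y. d x y < r / 2})" using I(1) by blast
  then show ?thesis by (rule finite_subset[rotated]) (use I(2) in auto)
qed

end

section \<open>The Chabauty--Fell topology\<close>

lemma topspace_chabauty_fell: "topspace chabauty_fell = {C. closed C}"
proof -
  have "{C. closed C} = {C. closed C \<and> C \<inter> {} = {}}" by auto
  then have "{C. closed C} \<in> {{C. closed C \<and> C \<inter> K = {}} | K. compact K}" by blast
  then have "{C. closed C} \<subseteq> \<Union> ({{C. closed C \<and> C \<inter> V \<noteq> {}} | V. open V} \<union> {{C. closed C \<and> C \<inter> K = {}} | K. compact K})"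
    by (intro Union_upper) blast
  then show ?thesis unfolding chabauty_fell_def topology_generated_by_topspace
    by (intro equalityI) auto
qed

lemma openin_chabauty_fell_hit: "open V \<Longrightarrow> openin chabauty_fell {C. closed C \<and> C \<inter> V \<noteq> {}}"
  unfolding chabauty_fell_def by (rule topology_generated_by_Basis) blast

lemma openin_chabauty_fell_miss: "compact K \<Longrightarrow> openin chabauty_fell {C. closed C \<and> C \<inter> K = {}}"
  unfolding chabauty_fell_def by (rule topology_generated_by_Basis) blast

lemma continuous_map_into_chabauty_fell:
  fixes f :: "'a \<Rightarrow> 'b :: topological_space set"
  assumes "\<And>x. x \<in> topspace X \<Longrightarrow> closed (f x)"
    and hit: "\<And>V. open V \<Longrightarrow> openin X {x\<in>topspace X. f x \<inter> V \<noteq> {}}"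
    and miss: "\<And>K. compact K \<Longrightarrow> openin X {x\<in>topspace X. f x \<inter> K = {}}"
  shows "continuous_map X chabauty_fell f"
  unfolding chabauty_fell_def
proof (rule continuous_on_generated_topo)
  fix U :: "'b set set"
  assume "U \<in> {{C. closed C \<and> C \<inter> V \<noteq> {}} |V. open V} \<union> {{C. closed C \<and> C \<inter> K = {}} |K. compact K}"
  then consider V where "open V" "U = {C. closed C \<and> C \<inter> V \<noteq> {}}"
    | K where "compact K" "U = {C. closed C \<and> C \<inter> K = {}}" by blast
  then show "openin X (f -` U \<inter> topspace X)"
  proof cases
    case 1
    then have "f -` U \<inter> topspace X = {x\<in>topspace X. f x \<inter> V \<noteq> {}}" using assms(1) by auto
    then show ?thesis using hit 1 by simp
  next
    case 2
    then have "f -` U \<inter> topspace X = {x\<in>topspace X. f x \<inter> K = {}}" using assms(1) by auto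
    then show ?thesis using miss 2 by simp
  qed
next
  show "f ` topspace X \<subseteq> \<Union> ({{C. closed C \<and> C \<inter> V \<noteq> {}} |V. open V} \<union> {{C. closed C \<and> C \<inter> K = {}} |K. compact K})"
    using assms(1) topspace_chabauty_fell[unfolded chabauty_fell_def topology_generated_by_topspace] by auto
qed

text \<open>A translate \<open>g + P\<close> misses \<open>K\<close> if
  \<open>- g + x \<notin> P\<close> for all \<open>x \<in> K\<close>. The set of pairs
  \<open>(g, x)\<close> with this property is open, so with a slice \<open>{g} \<times> K\<close> it
  contains a tube around it.\<close>

lemma continuous_map_orbit:
  fixes P :: "'g :: topological_group_add set"
  assumes P: "closed P"
  shows "continuous_map euclidean chabauty_fell (\<lambda>g. (+) g ` P)"
proof (rule continuous_map_into_chabauty_fell)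
  show "closed ((+) g ` P)" for g by (rule closed_translate[OF P])
next
  fix V :: "'g set" assume V: "open V"
  have "{g. (+) g ` P \<inter> V \<noteq> {}} = (\<Union>p\<in>P. (\<lambda>g. g + p) -` V)" by auto
  then have "open {g. (+) g ` P \<inter> V \<noteq> {}}"
    using V by (auto intro!: open_vimage continuous_intros)
  then show "openin euclidean {g \<in> topspace euclidean. (+) g ` P \<inter> V \<noteq> {}}" by simp
next
  fix K :: "'g set" assume K: "compact K"
  have mem: "x \<in> (+) g ` P \<longleftrightarrow> - g + x \<in> P" for g x
    by (metis add_minus_cancel imageE image_eqI minus_add_cancel)
  define W where "W = (\<lambda>p::'g \<times> 'g. - fst p + snd p) -` (- P)"
  have W: "open W" unfolding W_def using P by (auto intro!: open_vimage continuous_intros simp: open_Compl)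
  have "open {g. (+) g ` P \<inter> K = {}}"
  proof (subst open_subopen, intro ballI)
    fix g assume g: "g \<in> {g. (+) g ` P \<inter> K = {}}"
    then have "- g + x \<notin> P" if "x \<in> K" for x using that mem[of x g] by blast
    then have "{g} \<times> K \<subseteq> W" unfolding W_def by auto
    then obtain X where X: "g \<in> X" "open X" "X \<times> K \<subseteq> W" using Elementary_Topology.tube_lemma[OF K W] by blast
    have "- h + x \<notin> P" if "h \<in> X" "x \<in> K" for h x using X(3) that unfolding W_def by auto
    then have "X \<subseteq> {g. (+) g ` P \<inter> K = {}}" using mem by blast
    then show "\<exists>T. open T \<and> g \<in> T \<and> T \<subseteq> {g. (+) g ` P \<inter> K = {}}" using X by blast
  qed
  then show "openin euclidean {g \<in> topspace euclidean. (+) g ` P \<inter> K = {}}" by simp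
qed

lemma continuous_map_translate:
  fixes g :: "'g :: {topological_group_add, t2_space}"
  shows "continuous_map chabauty_fell chabauty_fell (\<lambda>P. (+) g ` P)"
proof (rule continuous_map_into_chabauty_fell)
  show "closed ((+) g ` P)" if "P \<in> topspace chabauty_fell" for P
    using that by (simp add: topspace_chabauty_fell closed_translate)
  have eq: "(+) g ` P \<inter> S = {} \<longleftrightarrow> P \<inter> (\<lambda>x. - g + x) ` S = {}" for P S
  proof -
    have *: "g + x \<in> S \<longleftrightarrow> x \<in> (\<lambda>x. - g + x) ` S" for x
      by (auto simp: image_iff) (metis minus_add_cancel)
    have "(+) g ` P \<inter> S = {} \<longleftrightarrow> (\<forall>x\<in>P. g + x \<notin> S)" by auto
    then show ?thesis unfolding * by auto
  qed
  show "openin chabauty_fell {P \<in> topspace chabauty_fell. (+) g ` P \<inter> V \<noteq> {}}" if V: "open V" for V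
  proof -
    have "(\<lambda>x. - g + x) ` V = (\<lambda>x. g + x) -` V"
      by (auto simp: image_iff) (metis minus_add_cancel)
    then have "open ((\<lambda>x. - g + x) ` V)" using V by (auto intro!: open_vimage continuous_intros)
    from openin_chabauty_fell_hit[OF this] show ?thesis by (simp add: topspace_chabauty_fell eq)
  qed
  show "openin chabauty_fell {P \<in> topspace chabauty_fell. (+) g ` P \<inter> K = {}}" if K: "compact K" for K
  proof -
    have "compact ((\<lambda>x. - g + x) ` K)" using K by (intro compact_continuous_image continuous_intros)
    from openin_chabauty_fell_miss[OF this] show ?thesis by (simp add: topspace_chabauty_fell eq)
  qed
qed

context admissible_group
begin

lemma Hausdorff_chabauty_fell: "Hausdorff_space (chabauty_fell :: 'g set topology)"
proof -
  have sep: "\<exists>U V. openin chabauty_fell U \<and> openin chabauty_fell V \<and> C \<in> U \<and> D \<in> V \<and> disjnt U V"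
    if CD: "closed C" "closed D" "x \<in> C" "x \<notin> D" for C D :: "'g set" and x
  proof -
    obtain r where r: "r > 0" "{y. d x y < r} \<subseteq> - D" using open_contains_ball[of "-D" x] CD by (auto simp: open_Compl)
    let ?V = "{y. d x y < r/2}" and ?K = "{y. d x y \<le> r/2}"
    have "C \<inter> ?V \<noteq> {}" using CD(3) r(1) by force
    moreover have "?K \<subseteq> {y. d x y < r}" using r(1) by auto
    then have "D \<inter> ?K = {}" using r(2) by auto
    moreover have "disjnt {C. closed C \<and> C \<inter> ?V \<noteq> {}} {C. closed C \<and> C \<inter> ?K = {}}"
      unfolding disjnt_def by force
    ultimately show ?thesis using CD(1,2)
    proof (intro exI conjI)
      show "openin chabauty_fell {C. closed C \<and> C \<inter> ?V \<noteq> {}}"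
        by (rule openin_chabauty_fell_hit[OF open_ball])
      show "openin chabauty_fell {C. closed C \<and> C \<inter> ?K = {}}"
        by (rule openin_chabauty_fell_miss[OF compact_closed_ball])
    qed auto
  qed
  show ?thesis unfolding Hausdorff_space_def topspace_chabauty_fell
  proof (intro allI impI, elim conjE)
    fix C D :: "'g set" assume CD: "C \<in> {C. closed C}" "D \<in> {C. closed C}" "C \<noteq> D"
    then obtain x where "x \<in> C \<and> x \<notin> D \<or> x \<in> D \<and> x \<notin> C" by blast
    then show "\<exists>U V. openin chabauty_fell U \<and> openin chabauty_fell V \<and> C \<in> U \<and> D \<in> V \<and> disjnt U V"
      using sep[of C D x] sep[of D C x] CD disjnt_sym by blast
  qed
qed

definition separated_sets :: "real \<Rightarrow> 'g set set" where
  "separated_sets r = {C. closed C \<and> (\<forall>x\<in>C. \<forall>y\<in>C. d x y < r \<longrightarrow> x = y)}"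

end

text \<open>Only the points of \<open>P\<close> where \<open>h\<close> does not vanish enter, so that for
  \<open>h\<close> of compact support and locally finite \<open>P\<close> this is a finite sum.\<close>

definition point_sum :: "('g \<Rightarrow> 'b::comm_monoid_add) \<Rightarrow> 'g set \<Rightarrow> 'b" where
  "point_sum h P = (\<Sum>x | x \<in> P \<and> h x \<noteq> 0. h x)"

lemma point_sum_eq:
  assumes "finite A" "A \<subseteq> P" "\<And>x. x \<in> P \<Longrightarrow> h x \<noteq> 0 \<Longrightarrow> x \<in> A"
  shows "point_sum h P = (\<Sum>x\<in>A. h x)"
  unfolding point_sum_def using assms by (intro sum.mono_neutral_left) auto

context admissible_group
begin

text \<open>Around each of the finitely many points \<open>x\<close> of \<open>C\<close> in the support
  of \<open>h\<close> put a ball so small that the balls are disjoint, that a separated set has at most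
  one point in each of them, and that \<open>h\<close> varies by less than \<open>\<epsilon>\<close> on
  it. A set near \<open>C\<close> has exactly one point in each ball and none in the rest of the
  support.\<close>

lemma continuous_point_sum:
  fixes h :: "'g \<Rightarrow> 'b::real_normed_vector"
  assumes h: "continuous_on UNIV h" "\<And>x. h x \<noteq> 0 \<Longrightarrow> d 0 x \<le> R" and r: "r > 0"
  shows "continuous_map (subtopology chabauty_fell (separated_sets r)) euclidean (point_sum h)"
proof -
  let ?X = "subtopology chabauty_fell (separated_sets r)"
  have top: "topspace ?X = separated_sets r"
    unfolding topspace_subtopology topspace_chabauty_fell by (auto simp: separated_sets_def)
  have "\<exists>U. openin ?X U \<and> C \<in> U \<and> (\<forall>C'\<in>U. dist (point_sum h C) (point_sum h C') < \<epsilon>)"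
    if C: "C \<in> separated_sets r" and e: "\<epsilon> > 0" for C \<epsilon>
  proof -
    define B where "B = {y. d 0 y \<le> R}"
    define A where "A = C \<inter> B"
    have A: "finite A" unfolding A_def B_def
      using C r by (intro finite_separated_bounded[where r=r] compact_closed_ball) (auto simp: separated_sets_def)
    define e' where "e' = \<epsilon> / (real (card A) + 1)"
    have e': "e' > 0" "real (card A) * e' < \<epsilon>" unfolding e'_def using e by (auto simp: field_simps)
    obtain \<delta>0 where \<delta>0: "\<delta>0 > 0" "\<And>x y. d x y < \<delta>0 \<Longrightarrow> norm (h x - h y) < e'"
      using uniformly_continuous[OF h e'(1)] by blast
    define \<delta> where "\<delta> = min \<delta>0 (r / 2)"
    have \<delta>: "\<delta> > 0" "\<delta> \<le> \<delta>0" "2 * \<delta> \<le> r" unfolding \<delta>_def using \<delta>0 r by auto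
    define V where "V = (\<lambda>x. {y. d x y < \<delta>})"
    define K where "K = B - (\<Union>x\<in>A. V x)"
    have K: "compact K" unfolding K_def B_def V_def
      by (intro compact_diff compact_closed_ball open_UN ballI open_ball)
    have CK: "C \<inter> K = {}" unfolding K_def A_def V_def using \<delta>(1) by auto
    define U where "U = separated_sets r \<inter> ((\<Inter>x\<in>A. {C'. closed C' \<and> C' \<inter> V x \<noteq> {}}) \<inter> {C'. closed C' \<and> C' \<inter> K = {}})"
    have "openin chabauty_fell ((\<Inter>x\<in>A. {C'. closed C' \<and> C' \<inter> V x \<noteq> {}}) \<inter> {C'. closed C' \<and> C' \<inter> K = {}})"
    proof (cases "A = {}")
      case True
      then show ?thesis using openin_chabauty_fell_miss[OF K] by simp
    next
      case False
      then show ?thesis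
        using A openin_chabauty_fell_miss[OF K] openin_chabauty_fell_hit[OF open_ball] unfolding V_def
        by (intro openin_Int openin_INT) auto
    qed
    then have U: "openin ?X U" unfolding U_def openin_subtopology by (auto simp: Int_commute)
    have "C \<inter> V x \<noteq> {}" if "x \<in> A" for x using that \<delta>(1) by (auto simp: A_def V_def)
    then have CU: "C \<in> U" unfolding U_def using C CK by (auto simp: separated_sets_def)
    have "dist (point_sum h C) (point_sum h C') < \<epsilon>" if C': "C' \<in> U" for C'
    proof -
      have "\<exists>y. y \<in> C' \<and> d x y < \<delta>" if "x \<in> A" for x
        using C' that unfolding U_def V_def by auto
      then obtain p where p: "\<And>x. x \<in> A \<Longrightarrow> p x \<in> C'" "\<And>x. x \<in> A \<Longrightarrow> d x (p x) < \<delta>" by metis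
      have sep': "x = y" if "x \<in> C'" "y \<in> C'" "d x y < r" for x y
        using C' that unfolding U_def separated_sets_def by auto
      have inj: "inj_on p A"
      proof (rule inj_onI)
        fix x y assume xy: "x \<in> A" "y \<in> A" "p x = p y"
        then have "d x y < r" using p(2)[of x] p(2)[of y] triangle[of x "p x" y] commute[of y "p y"] \<delta>(3) by simp
        then show "x = y" using xy C unfolding A_def separated_sets_def by auto
      qed
      have "point_sum h C' = (\<Sum>y\<in>p ` A. h y)"
      proof (rule point_sum_eq)
        fix y assume y: "y \<in> C'" "h y \<noteq> 0"
        then have "y \<in> B" using h(2) by (auto simp: B_def)
        moreover have "y \<notin> K" using C' y unfolding U_def by auto
        ultimately obtain x where x: "x \<in> A" "d x y < \<delta>" unfolding K_def V_def by auto
        then have "d (p x) y < r"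
          using p(2)[of x] triangle[of "p x" x y] commute[of x "p x"] \<delta>(3) by simp
        then have "p x = y" using sep' p(1) x y by blast
        then show "y \<in> p ` A" using x by blast
      qed (use A p in auto)
      also have "\<dots> = (\<Sum>x\<in>A. h (p x))" by (rule sum.reindex[OF inj, unfolded o_def])
      finally have 1: "point_sum h C' = (\<Sum>x\<in>A. h (p x))" .
      have 2: "point_sum h C = (\<Sum>x\<in>A. h x)"
        using A h(2) by (intro point_sum_eq) (auto simp: A_def B_def)
      have "dist (point_sum h C) (point_sum h C') = norm (\<Sum>x\<in>A. h x - h (p x))"
        unfolding 1 2 dist_norm by (simp add: sum_subtractf)
      also have "\<dots> \<le> (\<Sum>x\<in>A. norm (h x - h (p x)))" by (rule norm_sum)
      also have "\<dots> \<le> (\<Sum>x\<in>A. e')"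
        using p(2) \<delta>(2) \<delta>0(2) by (intro sum_mono less_imp_le) (meson less_le_trans)
      finally show ?thesis using e' by simp
    qed
    then show ?thesis using U CU by blast
  qed
  then show ?thesis
    unfolding mtopology_is_euclidean[symmetric] Met_TC.continuous_map_to_metric top
    by (simp add: Met_TC.mball_def)
qed

end

section \<open>Sets of finite local complexity and their hulls\<close>

definition pair_points :: "'g :: plus \<Rightarrow> 'g set \<Rightarrow> 'g set" where
  "pair_points z P = {x \<in> P. x + z \<in> P}"

lemma closed_subset_discrete:
  assumes "closed S" "discrete S" "T \<subseteq> S"
  shows "closed T"
  unfolding closed_limpt
proof (intro allI impI)
  fix x assume x: "x islimpt T"
  then have "x islimpt S" using assms(3) by (rule islimpt_subset)
  moreover from this have "x \<in> S" using assms(1) by (simp add: closed_limpt)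
  ultimately show "x \<in> T" using assms(2) unfolding discrete_def isolated_in_islimpt_iff by blast
qed

lemma difference_avoids_closed:
  fixes x y :: "'g :: topological_group_add"
  assumes "closed D" "- x + y \<notin> D"
  shows "\<exists>V W. open V \<and> open W \<and> x \<in> V \<and> y \<in> W \<and> (\<forall>v\<in>V. \<forall>w\<in>W. - v + w \<notin> D)"
proof -
  have "open ((\<lambda>p. - fst p + snd p) -` (- D))"
    using assms(1) by (intro open_vimage open_Compl continuous_intros)
  moreover have "(x, y) \<in> (\<lambda>p. - fst p + snd p) -` (- D)" using assms(2) by simp
  ultimately have "\<exists>A B. open A \<and> open B \<and> (x, y) \<in> A \<times> B \<and> A \<times> B \<subseteq> (\<lambda>p. - fst p + snd p) -` (- D)"
    unfolding open_prod_def by (rule bspec)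
  then show ?thesis by (auto simp: subset_iff)
qed

locale flc_hull = admissible_group d
  for d :: "'g :: {topological_group_add, second_countable_topology, t2_space} \<Rightarrow> 'g \<Rightarrow> real" +
  fixes P\<^sub>0 :: "'g set"
  assumes flc: "finite_local_complexity P\<^sub>0"
begin

definition differences :: "'g set" where
  "differences = uminus ` P\<^sub>0 + P\<^sub>0"

lemma differencesI: "x \<in> P\<^sub>0 \<Longrightarrow> y \<in> P\<^sub>0 \<Longrightarrow> - x + y \<in> differences"
  unfolding differences_def by (auto intro: set_plus_intro)

lemma closed_subset_differences: "S \<subseteq> differences \<Longrightarrow> closed S"
  using flc unfolding finite_local_complexity_def differences_def by (blast intro: closed_subset_discrete)

lemma finite_differences_bounded: "finite (differences \<inter> {y. d 0 y \<le> R})"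
proof -
  have "discrete (differences \<inter> {y. d 0 y \<le> R})"
    using flc unfolding finite_local_complexity_def differences_def by (blast intro: discrete_subset)
  moreover have "compact (differences \<inter> {y. d 0 y \<le> R})"
    by (intro closed_Int_compact closed_subset_differences compact_closed_ball order.refl)
  ultimately show ?thesis using discrete_compact_finite_iff by blast
qed

lemma closed_P0: "closed P\<^sub>0"
proof (cases "P\<^sub>0 = {}")
  case False
  then obtain x where x: "x \<in> P\<^sub>0" by blast
  have "P\<^sub>0 = (+) x ` ((\<lambda>y. - x + y) ` P\<^sub>0)"
    by (simp add: image_image add.assoc[symmetric])
  moreover have "closed ((\<lambda>y. - x + y) ` P\<^sub>0)"
    using x by (intro closed_subset_differences) (auto intro: differencesI)
  ultimately show ?thesis using closed_translate by metis
qed simp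

lemma differences_gap: "\<exists>r>0. \<forall>z\<in>differences. d 0 z < r \<longrightarrow> z = 0"
proof -
  have "open (- (differences - {0}))" by (intro open_Compl closed_subset_differences) auto
  from open_contains_ball[OF this, of 0] show ?thesis by blast
qed

text \<open>A lower bound for the distance of distinct points of \<open>P\<close>, valid for every
  \<open>P\<close> in the hull.\<close>

definition gap :: real where
  "gap = (SOME r. r > 0 \<and> (\<forall>z\<in>differences. d 0 z < r \<longrightarrow> z = 0))"

lemma gap_pos: "gap > 0" and gap: "z \<in> differences \<Longrightarrow> d 0 z < gap \<Longrightarrow> z = 0"
  using someI_ex[OF differences_gap[unfolded Bex_def]] unfolding gap_def by auto

abbreviation \<Omega> :: "'g set set" where "\<Omega> \<equiv> translation_hull P\<^sub>0"
abbreviation \<Omega>\<^sub>1 :: "'g set set" where "\<Omega>\<^sub>1 \<equiv> punctured_hull P\<^sub>0"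
abbreviation X\<^sub>1 :: "'g set topology" where "X\<^sub>1 \<equiv> subtopology chabauty_fell (punctured_hull P\<^sub>0)"

lemma hull_closed: "P \<in> \<Omega> \<Longrightarrow> closed P"
  using closure_of_subset_topspace[of chabauty_fell] unfolding translation_hull_def topspace_chabauty_fell by blast

lemma hull_open_meets_orbit: "P \<in> \<Omega> \<Longrightarrow> P \<in> U \<Longrightarrow> openin chabauty_fell U \<Longrightarrow> \<exists>g. (+) g ` P\<^sub>0 \<in> U"
  unfolding translation_hull_def in_closure_of by auto

lemma topspace_X1: "topspace X\<^sub>1 = \<Omega>\<^sub>1"
  unfolding topspace_subtopology topspace_chabauty_fell punctured_hull_def using hull_closed by blast

lemma translate_mem_hull: "(+) g ` P\<^sub>0 \<in> \<Omega>"
  unfolding translation_hull_def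
  by (rule subsetD[OF closure_of_subset]) (auto simp: topspace_chabauty_fell closed_translate closed_P0)

lemma translate_mem_hull1: "P\<^sub>0 \<noteq> {} \<Longrightarrow> (+) g ` P\<^sub>0 \<in> \<Omega>\<^sub>1"
  using translate_mem_hull unfolding punctured_hull_def by auto

lemma hull_translate: "P \<in> \<Omega> \<Longrightarrow> (+) g ` P \<in> \<Omega>"
proof -
  assume P: "P \<in> \<Omega>"
  have "(\<lambda>P. (+) g ` P) ` \<Omega> \<subseteq> chabauty_fell closure_of ((\<lambda>P. (+) g ` P) ` range (\<lambda>g. (+) g ` P\<^sub>0))"
    unfolding translation_hull_def by (rule continuous_map_image_closure_subset[OF continuous_map_translate])
  also have "\<dots> \<subseteq> \<Omega>" unfolding translation_hull_def
    by (rule closure_of_mono) (auto simp: image_image add.assoc[symmetric])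
  finally show ?thesis using P by auto
qed

lemma hull1_translate: "P \<in> \<Omega>\<^sub>1 \<Longrightarrow> (+) g ` P \<in> \<Omega>\<^sub>1"
  using hull_translate unfolding punctured_hull_def by auto

text \<open>A pair of points of \<open>P\<close> with a difference outside the closed set
  \<open>differences\<close> would persist in all sets near \<open>P\<close>, in particular in a translate
  of \<open>P\<^sub>0\<close>.\<close>

lemma hull_differences:
  assumes P: "P \<in> \<Omega>" and xy: "x \<in> P" "y \<in> P"
  shows "- x + y \<in> differences"
proof (rule ccontr)
  assume "- x + y \<notin> differences"
  then obtain V W where VW: "open V" "open W" "x \<in> V" "y \<in> W"
    and VW_sub: "\<And>v w. v \<in> V \<Longrightarrow> w \<in> W \<Longrightarrow> - v + w \<notin> differences"
    using difference_avoids_closed[OF closed_subset_differences[OF order.refl]] by metis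
  have "openin chabauty_fell ({C. closed C \<and> C \<inter> V \<noteq> {}} \<inter> {C. closed C \<and> C \<inter> W \<noteq> {}})"
    using VW by (intro openin_Int openin_chabauty_fell_hit)
  moreover have "P \<in> {C. closed C \<and> C \<inter> V \<noteq> {}} \<inter> {C. closed C \<and> C \<inter> W \<noteq> {}}"
    using VW xy hull_closed[OF P] by auto
  ultimately have "\<exists>g. (+) g ` P\<^sub>0 \<in> {C. closed C \<and> C \<inter> V \<noteq> {}} \<inter> {C. closed C \<and> C \<inter> W \<noteq> {}}"
    by (intro hull_open_meets_orbit[OF P])
  then obtain g where g: "(+) g ` P\<^sub>0 \<inter> V \<noteq> {}" "(+) g ` P\<^sub>0 \<inter> W \<noteq> {}"
    by auto
  then obtain a b where ab: "a \<in> P\<^sub>0" "b \<in> P\<^sub>0" "g + a \<in> V" "g + b \<in> W" by blast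
  then have "- (g + a) + (g + b) \<notin> differences" using VW_sub by blast
  moreover have "- (g + a) + (g + b) = - a + b" by (simp add: minus_add add.assoc del: add_uminus_conv_diff)
  ultimately show False using differencesI ab by simp
qed

lemma hull_separated: "\<Omega> \<subseteq> separated_sets gap"
proof
  fix P assume P: "P \<in> \<Omega>"
  have "x = y" if "x \<in> P" "y \<in> P" "d x y < gap" for x y
  proof -
    have "- x + y = 0" using gap[OF hull_differences[OF P that(1,2)]] that(3) dist_eq[of x y] by simp
    then show ?thesis by (metis add_minus_cancel add.right_neutral)
  qed
  then show "P \<in> separated_sets gap" unfolding separated_sets_def using hull_closed[OF P] by auto
qed

lemma finite_hull_bounded: "P \<in> \<Omega> \<Longrightarrow> compact K \<Longrightarrow> finite (P \<inter> K)"
  using hull_separated gap_pos unfolding separated_sets_def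
  by (intro finite_separated_bounded[where r=gap]) auto

text \<open>A pair with difference \<open>z\<close> persists under small perturbations within the hull
  because of finite local complexity: points near \<open>x\<close> and \<open>x + z\<close> have a
  difference near \<open>z\<close> in the discrete set \<open>differences\<close>, hence the difference
  \<open>z\<close>. Conversely, no such pair appears in a compact set \<open>K\<close> that contains none
  of \<open>P\<close>: each point of \<open>K\<close> has a small compact ball such that \<open>P\<close>
  misses the ball or its translate by \<open>z\<close>, and finitely many of these balls cover
  \<open>K\<close>.\<close>

lemma continuous_pair_points:
  "continuous_map (subtopology chabauty_fell \<Omega>) (subtopology chabauty_fell (separated_sets gap)) (pair_points z)"
proof -
  let ?Y = "subtopology chabauty_fell \<Omega>"
  have top: "topspace ?Y = \<Omega>"
    unfolding topspace_subtopology topspace_chabauty_fell using hull_closed by blast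
  have cl: "closed (pair_points z P)" if "P \<in> \<Omega>" for P
  proof -
    have "pair_points z P = P \<inter> (\<lambda>x. x + z) -` P" unfolding pair_points_def by auto
    then show ?thesis using hull_closed[OF that] by (auto intro!: closed_Int closed_vimage continuous_intros)
  qed
  have "continuous_map ?Y chabauty_fell (pair_points z)"
  proof (rule continuous_map_into_chabauty_fell, unfold top)
    show "closed (pair_points z P)" if "P \<in> \<Omega>" for P using cl[OF that] .
  next
    fix V :: "'g set" assume V: "open V"
    show "openin ?Y {P \<in> \<Omega>. pair_points z P \<inter> V \<noteq> {}}"
    proof (subst openin_subopen, intro ballI)
      fix P assume "P \<in> {P \<in> \<Omega>. pair_points z P \<inter> V \<noteq> {}}"
      then obtain x where P: "P \<in> \<Omega>" and x: "x \<in> P" "x + z \<in> P" "x \<in> V"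
        by (auto simp: pair_points_def)
      have "closed (differences - {z})" by (rule closed_subset_differences) auto
      moreover have "- x + (x + z) \<notin> differences - {z}" by simp
      ultimately obtain A B where AB: "open A" "open B" "x \<in> A" "x + z \<in> B"
        and AB_sub: "\<And>a b. a \<in> A \<Longrightarrow> b \<in> B \<Longrightarrow> - a + b \<notin> differences - {z}"
        using difference_avoids_closed by metis
      let ?U = "{C. closed C \<and> C \<inter> (A \<inter> V) \<noteq> {}} \<inter> {C. closed C \<and> C \<inter> B \<noteq> {}}"
      have "openin chabauty_fell ?U" using AB V by (intro openin_Int openin_chabauty_fell_hit) auto
      then have "openin ?Y (\<Omega> \<inter> ?U)" unfolding openin_subtopology by (auto simp: Int_commute)
      moreover have "P \<in> \<Omega> \<inter> ?U" using P x AB hull_closed[OF P] by auto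
      moreover have "\<Omega> \<inter> ?U \<subseteq> {P \<in> \<Omega>. pair_points z P \<inter> V \<noteq> {}}"
      proof
        fix Q assume Q: "Q \<in> \<Omega> \<inter> ?U"
        then obtain a b where ab: "a \<in> Q" "a \<in> A" "a \<in> V" "b \<in> Q" "b \<in> B" by auto
        then have "- a + b \<notin> differences - {z}" using AB_sub by blast
        then have "- a + b = z" using hull_differences[of Q a b] Q ab by auto
        then have "a + z = b" by (metis add_minus_cancel)
        then show "Q \<in> {P \<in> \<Omega>. pair_points z P \<inter> V \<noteq> {}}" using Q ab by (auto simp: pair_points_def)
      qed
      ultimately show "\<exists>T. openin ?Y T \<and> P \<in> T \<and> T \<subseteq> {P \<in> \<Omega>. pair_points z P \<inter> V \<noteq> {}}" by blast
    qed
  next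
    fix K :: "'g set" assume K: "compact K"
    show "openin ?Y {P \<in> \<Omega>. pair_points z P \<inter> K = {}}"
    proof (subst openin_subopen, intro ballI)
      fix P assume "P \<in> {P \<in> \<Omega>. pair_points z P \<inter> K = {}}"
      then have P: "P \<in> \<Omega>" and PK: "\<And>x. x \<in> K \<Longrightarrow> x \<notin> P \<or> x + z \<notin> P" by (auto simp: pair_points_def)
      have "\<exists>r>0. {y. d x y \<le> r} \<inter> P = {} \<or> (\<lambda>y. y + z) ` {y. d x y \<le> r} \<inter> P = {}" if "x \<in> K" for x
      proof -
        have "open (- P)" "open ((\<lambda>y. y + z) -` (- P))"
          using hull_closed[OF P] by (auto intro!: open_vimage continuous_intros)
        moreover have "x \<in> - P \<or> x \<in> (\<lambda>y. y + z) -` (- P)" using PK[OF that] by auto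
        ultimately obtain r where r: "r > 0" "{y. d x y < r} \<subseteq> - P \<or> {y. d x y < r} \<subseteq> (\<lambda>y. y + z) -` (- P)"
          using open_contains_ball[of "- P" x] open_contains_ball[of "(\<lambda>y. y + z) -` (- P)" x] by metis
        have "{y. d x y \<le> r / 2} \<subseteq> {y. d x y < r}" using r(1) by auto
        then have "{y. d x y \<le> r / 2} \<inter> P = {} \<or> (\<lambda>y. y + z) ` {y. d x y \<le> r / 2} \<inter> P = {}"
          using r(2) by blast
        then show ?thesis using r(1) by (intro exI[of _ "r/2"]) auto
      qed
      then obtain r where r: "\<And>x. x \<in> K \<Longrightarrow> r x > 0"
        "\<And>x. x \<in> K \<Longrightarrow> {y. d x y \<le> r x} \<inter> P = {} \<or> (\<lambda>y. y + z) ` {y. d x y \<le> r x} \<inter> P = {}" by metis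
      define b where "b = (\<lambda>x. {y. d x y \<le> r x})"
      obtain I where I: "I \<subseteq> K" "finite I" "K \<subseteq> (\<Union>x\<in>I. {y. d x y < r x})"
        using finite_ball_cover[OF K, of r] r(1) by blast
      have "{y. d x y < r x} \<subseteq> b x" for x unfolding b_def by auto
      then have Kb: "K \<subseteq> (\<Union>x\<in>I. b x)" using I(3) by blast
      define L where "L = (\<Union>x\<in>{x\<in>I. b x \<inter> P = {}}. b x) \<union> (\<Union>x\<in>{x\<in>I. (\<lambda>y. y + z) ` b x \<inter> P = {}}. (\<lambda>y. y + z) ` b x)"
      have "compact L" unfolding L_def b_def using I(2)
        by (intro compact_Un compact_UN compact_closed_ball compact_continuous_image continuous_intros) auto
      from openin_chabauty_fell_miss[OF this]
      have "openin ?Y (\<Omega> \<inter> {C. closed C \<and> C \<inter> L = {}})" unfolding openin_subtopology by (auto simp: Int_commute)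
      moreover have "P \<in> \<Omega> \<inter> {C. closed C \<and> C \<inter> L = {}}"
        unfolding L_def using P hull_closed[OF P] by auto
      moreover have "\<Omega> \<inter> {C. closed C \<and> C \<inter> L = {}} \<subseteq> {P \<in> \<Omega>. pair_points z P \<inter> K = {}}"
      proof
        fix Q assume Q: "Q \<in> \<Omega> \<inter> {C. closed C \<and> C \<inter> L = {}}"
        have False if a: "a \<in> pair_points z Q" "a \<in> K" for a
        proof -
          obtain x where x: "x \<in> I" "a \<in> b x" using Kb a(2) by blast
          have "b x \<inter> P = {} \<or> (\<lambda>y. y + z) ` b x \<inter> P = {}" using r(2)[of x] x(1) I(1) unfolding b_def by blast
          then have "a \<in> L \<or> a + z \<in> L" using x unfolding L_def by blast
          then show False using a(1) Q unfolding pair_points_def by blast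
        qed
        then show "Q \<in> {P \<in> \<Omega>. pair_points z P \<inter> K = {}}" using Q by auto
      qed
      ultimately show "\<exists>T. openin ?Y T \<and> P \<in> T \<and> T \<subseteq> {P \<in> \<Omega>. pair_points z P \<inter> K = {}}" by blast
    qed
  qed
  moreover have "pair_points z P \<in> separated_sets gap" if "P \<in> \<Omega>" for P
    using subsetD[OF hull_separated that] cl[OF that] unfolding separated_sets_def pair_points_def by auto
  ultimately show ?thesis by (auto simp: continuous_map_in_subtopology top)
qed

lemma continuous_pair_sum:
  fixes h :: "'g \<Rightarrow> 'b::real_normed_vector"
  assumes h: "continuous_on UNIV h" "\<And>x. h x \<noteq> 0 \<Longrightarrow> d 0 x \<le> R"
  shows "continuous_map X\<^sub>1 euclidean (\<lambda>P. point_sum h (pair_points z P))"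
proof -
  have "continuous_map (subtopology chabauty_fell \<Omega>) euclidean (point_sum h \<circ> pair_points z)"
    by (rule continuous_map_compose[OF continuous_pair_points continuous_point_sum[OF h gap_pos]])
  then have "continuous_map X\<^sub>1 euclidean (point_sum h \<circ> pair_points z)"
    by (rule continuous_map_from_subtopology_mono) (auto simp: punctured_hull_def)
  then show ?thesis by (simp add: o_def)
qed

end

section \<open>Haar measure and averages over a Folner family\<close>

context admissible_group
begin

lemma radon_measureD:
  assumes "radon_measure \<mu>"
  shows "sets \<mu> = sets borel" "emeasure \<mu> {y. d x y \<le> r} < \<infinity>"
  using assms compact_closed_ball unfolding radon_measure_def by auto

lemma closed_ball_in_sets: "{y. d x y \<le> r} \<in> sets borel"
  using compact_imp_closed[OF compact_closed_ball] by (rule borel_closed)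

lemma bounded_range:
  fixes f :: "'g \<Rightarrow> 'b::real_normed_vector"
  assumes f: "continuous_on UNIV f" "\<And>x. f x \<noteq> 0 \<Longrightarrow> d 0 x \<le> R"
  shows "\<exists>B>0. \<forall>x. norm (f x) \<le> B"
proof -
  have "compact (f ` {y. d 0 y \<le> R})"
    using f(1) compact_closed_ball by (intro compact_continuous_image) (auto intro: continuous_on_subset)
  then obtain B where B: "B > 0" "\<And>y. y \<in> f ` {y. d 0 y \<le> R} \<Longrightarrow> norm y \<le> B"
    using compact_imp_bounded bounded_pos by metis
  have "norm (f x) \<le> B" for x
    using B f(2)[of x] by (cases "f x = 0") auto
  then show ?thesis using B(1) by blast
qed

lemma integrable_continuous_bounded_support:
  fixes f :: "'g \<Rightarrow> 'b::{banach, second_countable_topology}"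
  assumes \<mu>: "radon_measure \<mu>" and f: "continuous_on UNIV f" "\<And>x. f x \<noteq> 0 \<Longrightarrow> d 0 x \<le> R"
  shows "integrable \<mu> f"
proof -
  note [measurable_cong] = radon_measureD(1)[OF \<mu>]
  obtain B where B: "\<And>x. norm (f x) \<le> B" using bounded_range[OF f] by metis
  have "f \<in> borel_measurable borel" using f(1) by (rule borel_measurable_continuous_onI)
  then have fm: "f \<in> borel_measurable \<mu>" by simp
  show ?thesis
    using B f(2) fm closed_ball_in_sets radon_measureD[OF \<mu>]
    by (intro integrableI_bounded_set[where A="{y. d 0 y \<le> R}" and B=B]) auto
qed

end

locale haar_group = admissible_group d
  for d :: "'g :: {topological_group_add, second_countable_topology, t2_space} \<Rightarrow> 'g \<Rightarrow> real" +
  fixes m :: "'g measure"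
  assumes haar: "left_haar_measure m" and unimodular_m: "unimodular m"
begin

lemma sets_m [measurable_cong]: "sets m = sets borel"
  using haar unfolding left_haar_measure_def by blast

lemma space_m: "space m = UNIV"
  using sets_eq_imp_space_eq[OF sets_m] by simp

lemma radon_m: "radon_measure m"
  using haar unfolding left_haar_measure_def radon_measure_def by blast

lemma emeasure_compact: "compact K \<Longrightarrow> emeasure m K < \<infinity>"
  using radon_m unfolding radon_measure_def by blast

lemma compact_in_sets: "compact K \<Longrightarrow> K \<in> sets m"
  by (simp add: sets_m borel_closed compact_imp_closed)

lemma distr_left: "distr m m ((+) g) = m"
proof (rule measure_eqI)
  fix A assume "A \<in> sets (distr m m ((+) g))"
  then have A: "A \<in> sets borel" by (simp add: sets_m)
  have meas: "(+) g \<in> measurable m m" by measurable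
  have "(+) g -` A \<inter> space m = (+) (- g) ` A"
    by (auto simp: space_m image_iff) (metis minus_add_cancel)
  then show "emeasure (distr m m ((+) g)) A = emeasure m A"
    using A haar emeasure_distr[OF meas] unfolding left_haar_measure_def by (simp add: sets_m)
qed simp

lemma distr_right: "distr m m (\<lambda>x. x + g) = m"
proof (rule measure_eqI)
  fix A assume "A \<in> sets (distr m m (\<lambda>x. x + g))"
  then have A: "A \<in> sets borel" by (simp add: sets_m)
  have meas: "(\<lambda>x. x + g) \<in> measurable m m" by measurable
  have "x \<in> (\<lambda>x. x + - g) ` A" if "x + g \<in> A" for x
    using that by (intro image_eqI[of _ _ "x + g"]) (auto simp: add.assoc simp del: add_uminus_conv_diff)
  then have "(\<lambda>x. x + g) -` A \<inter> space m = (\<lambda>x. x + - g) ` A"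
    by (auto simp: space_m add.assoc simp del: add_uminus_conv_diff)
  moreover have "emeasure m ((\<lambda>x. x + - g) ` A) = emeasure m A"
    using A unimodular_m unfolding unimodular_def by blast
  ultimately show "emeasure (distr m m (\<lambda>x. x + g)) A = emeasure m A"
    using A emeasure_distr[OF meas] by (simp add: sets_m)
qed simp

lemma integral_left:
  fixes f :: "'g \<Rightarrow> 'b::{banach, second_countable_topology}"
  assumes "f \<in> borel_measurable borel"
  shows "(\<integral>x. f (g + x) \<partial>m) = (\<integral>x. f x \<partial>m)"
  using integral_distr[of "(+) g" m m f] assms by (simp add: distr_left)

lemma integral_right:
  fixes f :: "'g \<Rightarrow> 'b::{banach, second_countable_topology}"
  assumes "f \<in> borel_measurable borel"
  shows "(\<integral>x. f (x + g) \<partial>m) = (\<integral>x. f x \<partial>m)"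
  using integral_distr[of "\<lambda>x. x + g" m m f] assms by (simp add: distr_right)

text \<open>If one ball is null, so are all balls of that radius by left invariance; finitely many of
  them cover each of the compact balls that exhaust the group.\<close>

lemma emeasure_ball_pos:
  assumes r: "r > 0"
  shows "emeasure m {y. d x y < r} > 0"
proof (rule ccontr)
  assume "\<not> emeasure m {y. d x y < r} > 0"
  then have zero: "emeasure m {y. d x y < r} = 0" by simp
  have null: "{y. d z y < r} \<in> null_sets m" for z
  proof -
    have "(+) (z + - x) ` {y. d x y < r} = {y. d z y < r}"
    proof (intro equalityI subsetI)
      fix y assume "y \<in> (+) (z + - x) ` {y. d x y < r}"
      then obtain w where w: "d x w < r" "y = z + - x + w" by auto
      have "d z y = d x w" unfolding w(2) dist_eq[of z] dist_eq[of x]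
        by (simp add: add.assoc[symmetric] del: add_uminus_conv_diff)
      then show "y \<in> {y. d z y < r}" using w by simp
    next
      fix y assume y: "y \<in> {y. d z y < r}"
      have "d x (x + - z + y) = d z y" unfolding dist_eq[of z] dist_eq[of x]
        by (simp add: add.assoc[symmetric] del: add_uminus_conv_diff)
      moreover have "z + - x + (x + - z + y) = y"
        by (simp add: add.assoc del: add_uminus_conv_diff)
      ultimately show "y \<in> (+) (z + - x) ` {y. d x y < r}"
        using y by (intro image_eqI[of _ _ "x + - z + y"]) auto
    qed
    moreover have "emeasure m ((+) (z + - x) ` {y. d x y < r}) = emeasure m {y. d x y < r}"
      using haar borel_open[OF open_ball] unfolding left_haar_measure_def by blast
    ultimately show ?thesis using zero borel_open[OF open_ball, of z r] by (auto simp: null_sets_def sets_m)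
  qed
  have "{y. d 0 y \<le> real n} \<in> null_sets m" for n
  proof -
    obtain I where I: "finite I" "{y. d 0 y \<le> real n} \<subseteq> (\<Union>z\<in>I. {y. d z y < r})"
      using finite_ball_cover[OF compact_closed_ball, of 0 "real n" "\<lambda>x. r"] r by blast
    have "(\<Union>z\<in>I. {y. d z y < r}) \<in> null_sets m" using I(1) null by (intro null_sets.finite_UN) auto
    from null_sets_subset[OF this _ I(2)] show ?thesis using closed_ball_in_sets by (simp add: sets_m)
  qed
  then have "(\<Union>n::nat. {y. d 0 y \<le> real n}) \<in> null_sets m" by (rule null_sets_UN)
  moreover have "(\<Union>n::nat. {y. d 0 y \<le> real n}) = UNIV" using real_arch_simple by blast
  ultimately show False using haar unfolding left_haar_measure_def null_sets_def by auto
qed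

end

locale folner_group = haar_group d m
  for d :: "'g :: {topological_group_add, second_countable_topology, t2_space} \<Rightarrow> 'g \<Rightarrow> real" and m :: "'g measure" +
  fixes F :: "real \<Rightarrow> 'g set"
  assumes admissible_F: "weakly_admissible d m F" and folner_F: "folner m F"
begin

lemma compact_F: "t > 0 \<Longrightarrow> compact (F t)"
  using admissible_F unfolding weakly_admissible_def by blast

lemma F_in_sets: "t > 0 \<Longrightarrow> F t \<in> sets m"
  by (simp add: compact_F compact_in_sets)

lemma emeasure_F: "t > 0 \<Longrightarrow> emeasure m (F t) = ennreal (measure m (F t))"
  using emeasure_compact[OF compact_F] by (intro emeasure_eq_ennreal_measure) (auto simp: less_top)

lemma measure_F_pos: "t > 0 \<Longrightarrow> measure m (F t) > 0"
  using admissible_F emeasure_F unfolding weakly_admissible_def by (metis ennreal_less_zero_iff)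

text \<open>The quantitative form in which weak admissibility is used: a small thickening
  \<open>\<delta>\<close> costs a shift of the parameter by \<open>a = \<alpha> \<delta>\<close>, and
  that shift costs at most a factor \<open>1 + \<epsilon>\<close> in measure since
  \<open>\<beta> (\<alpha> \<delta>)\<close> tends to \<open>0\<close> with
  \<open>\<delta>\<close>.\<close>

lemma small_thickening:
  assumes e: "\<epsilon> > 0"
  shows "\<exists>\<delta>>0. \<exists>a\<ge>0. \<forall>t>0. (\<forall>x\<in>F t. \<forall>y. d x y < \<delta> \<longrightarrow> y \<in> F (t + a)) \<and>
           measure m (F (t + a)) \<le> (1 + \<epsilon>) * measure m (F t)"
proof -
  obtain \<alpha> \<beta> where \<alpha>: "continuous_on {0..<1} \<alpha>" "\<And>\<delta>. \<delta> \<in> {0..<1} \<Longrightarrow> 0 \<le> \<alpha> \<delta>" "\<alpha> 0 = 0"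
    and \<beta>: "continuous_on {0..<1} \<beta>" "\<beta> 0 = 0" "\<And>\<delta>. \<delta> \<in> {0..<1} \<Longrightarrow> 0 \<le> \<beta> \<delta>"
    and F: "\<And>\<delta> t. \<delta> \<in> {0<..<1} \<Longrightarrow> t > 0 \<Longrightarrow> thicken d (F t) \<delta> \<subseteq> F (t + \<alpha> \<delta>)"
    and sup: "\<And>\<delta>. \<delta> \<in> {0<..<1} \<Longrightarrow>
      (SUP s\<in>{0<..}. emeasure m (F (s + \<delta>)) / emeasure m (F s)) = ennreal (1 + \<beta> \<delta>)"
    using admissible_F unfolding weakly_admissible_def by blast
  have "0 \<in> {0..<1::real}" by simp
  from continuous_on_iff[THEN iffD1, OF \<beta>(1), rule_format, OF this e] \<beta>(2)
  obtain s where s: "s > 0" "\<And>x. x \<in> {0..<1} \<Longrightarrow> \<bar>x\<bar> < s \<Longrightarrow> \<bar>\<beta> x\<bar> < \<epsilon>"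
    by (auto simp: dist_real_def)
  have "min s 1 > 0" using s(1) by simp
  from continuous_on_iff[THEN iffD1, OF \<alpha>(1), rule_format, OF \<open>0 \<in> {0..<1::real}\<close> this] \<alpha>(3)
  obtain r where r: "r > 0" "\<And>x. x \<in> {0..<1} \<Longrightarrow> \<bar>x\<bar> < r \<Longrightarrow> \<bar>\<alpha> x\<bar> < min s 1"
    by (auto simp: dist_real_def)
  define \<delta> where "\<delta> = min (r / 2) (1 / 2)"
  have \<delta>: "0 < \<delta>" "\<delta> < 1" "\<delta> < r" unfolding \<delta>_def using r(1) by auto
  define a where "a = \<alpha> \<delta>"
  have a: "0 \<le> a" "a < 1" "a < s" unfolding a_def using r(2)[of \<delta>] \<alpha>(2)[of \<delta>] \<delta> by auto
  have 1: "y \<in> F (t + a)" if t: "t > 0" and xy: "x \<in> F t" "d x y < \<delta>" for t x y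
  proof -
    have "y = x + (- x + y)" by simp
    then have "y \<in> thicken d (F t) \<delta>"
      unfolding thicken_def using xy dist_eq[of x y] by (metis mem_Collect_eq set_plus_intro)
    then show ?thesis using F[of \<delta> t] t \<delta> unfolding a_def by auto
  qed
  have 2: "measure m (F (t + a)) \<le> (1 + \<epsilon>) * measure m (F t)" if t: "t > 0" for t
  proof (cases "a = 0")
    case True
    then show ?thesis using e by (simp add: algebra_simps)
  next
    case False
    then have a': "a \<in> {0<..<1}" using a by auto
    have "emeasure m (F (t + a)) / emeasure m (F t) \<le> ennreal (1 + \<beta> a)"
      unfolding sup[OF a', symmetric] using t by (intro SUP_upper) auto
    then have "ennreal (measure m (F (t + a)) / measure m (F t)) \<le> ennreal (1 + \<beta> a)"
      using t a emeasure_F[of "t + a"] emeasure_F[OF t] measure_F_pos[OF t] by (simp add: divide_ennreal)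
    moreover have "0 \<le> 1 + \<beta> a" using \<beta>(3)[of a] a by simp
    ultimately have "measure m (F (t + a)) / measure m (F t) \<le> 1 + \<beta> a" by simp
    also have "\<dots> \<le> 1 + \<epsilon>" using s(2)[of a] a by simp
    finally show ?thesis using measure_F_pos[OF t] by (simp add: divide_le_eq)
  qed
  show ?thesis using \<delta>(1) a(1) 1 2 by blast
qed

definition average :: "real \<Rightarrow> ('g \<Rightarrow> real) \<Rightarrow> real" where
  "average t \<phi> = (\<integral>g. indicat_real (F t) g * \<phi> g \<partial>m) / measure m (F t)"

lemma integrable_on_F:
  assumes "t > 0" "\<phi> \<in> borel_measurable borel" "\<And>g. \<bar>\<phi> g\<bar> \<le> B"
  shows "integrable m (\<lambda>g. indicat_real (F t) g * \<phi> g)"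
proof -
  have [measurable]: "\<phi> \<in> borel_measurable m" "F t \<in> sets m" using assms(2) F_in_sets[OF assms(1)] by auto
  show ?thesis
    using assms F_in_sets emeasure_F
    by (intro integrableI_bounded_set[where A="F t" and B=B]) (auto simp: indicator_def)
qed

lemma average_add:
  assumes "t > 0" "\<phi> \<in> borel_measurable borel" "\<And>g. \<bar>\<phi> g\<bar> \<le> B"
    "\<psi> \<in> borel_measurable borel" "\<And>g. \<bar>\<psi> g\<bar> \<le> B'"
  shows "average t (\<lambda>g. \<phi> g + \<psi> g) = average t \<phi> + average t \<psi>"
  using Bochner_Integration.integral_add[OF integrable_on_F[OF assms(1-3)] integrable_on_F[OF assms(1,4,5)]]
  unfolding average_def by (simp add: algebra_simps add_divide_distrib)

lemma average_scale: "average t (\<lambda>g. c * \<phi> g) = c * average t \<phi>"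
  unfolding average_def by (simp add: mult.left_commute[of _ c])

lemma average_nonneg: "(\<And>g. 0 \<le> \<phi> g) \<Longrightarrow> 0 \<le> average t \<phi>"
  unfolding average_def by (intro divide_nonneg_nonneg Bochner_Integration.integral_nonneg) auto

lemma average_const: "t > 0 \<Longrightarrow> average t (\<lambda>g. 1) = 1"
  unfolding average_def using measure_F_pos[of t] F_in_sets[of t] by (simp add: space_m)

lemma average_bound:
  assumes "t > 0" "\<phi> \<in> borel_measurable borel" "\<And>g. \<bar>\<phi> g\<bar> \<le> B"
  shows "\<bar>average t \<phi>\<bar> \<le> B"
proof -
  have "\<bar>\<integral>g. indicat_real (F t) g * \<phi> g \<partial>m\<bar> \<le> (\<integral>g. B * indicat_real (F t) g \<partial>m)"
  proof (rule order_trans[OF integral_abs_bound], rule integral_mono)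
    show "integrable m (\<lambda>g. \<bar>indicat_real (F t) g * \<phi> g\<bar>)"
      by (rule integrable_abs[OF integrable_on_F[OF assms]])
    show "integrable m (\<lambda>g. B * indicat_real (F t) g)"
      using F_in_sets[OF assms(1)] emeasure_F[OF assms(1)] by simp
  qed (use assms(3) in \<open>auto simp: indicator_def\<close>)
  also have "\<dots> = B * measure m (F t)" using F_in_sets[OF assms(1)] by (simp add: space_m)
  finally show ?thesis unfolding average_def using measure_F_pos[OF assms(1)] by (simp add: divide_le_eq)
qed

lemma average_right_translate:
  assumes \<phi>: "\<phi> \<in> borel_measurable borel" "\<And>g. \<bar>\<phi> g\<bar> \<le> B"
  shows "((\<lambda>t. average t (\<lambda>g. \<phi> (g + h)) - average t \<phi>) \<longlongrightarrow> 0) at_top"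
proof -
  define D where "D = (\<lambda>t. sym_diff ((\<lambda>x. x + h) ` F t) (F t))"
  have B: "B \<ge> 0" using \<phi>(2)[of 0] by simp
  have bound: "\<bar>average t (\<lambda>g. \<phi> (g + h)) - average t \<phi>\<bar> \<le> B * (measure m (D t) / measure m (F t))"
    if t: "t > 0" for t
  proof -
    have ch: "compact ((\<lambda>x. x + h) ` F t)"
      using compact_F[OF t] by (intro compact_continuous_image continuous_intros)
    note meas = compact_in_sets[OF ch] F_in_sets[OF t]
    have Dm: "D t \<in> sets m" unfolding D_def using meas by auto
    have fin: "emeasure m ((\<lambda>x. x + h) ` F t) < \<infinity>" "emeasure m (F t) < \<infinity>"
      using emeasure_compact ch compact_F[OF t] by auto
    have Dfin: "emeasure m (D t) < \<infinity>"
    proof -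
      have "emeasure m (D t) \<le> emeasure m ((\<lambda>x. x + h) ` F t \<union> F t)"
        unfolding D_def using meas by (intro emeasure_mono) auto
      also have "\<dots> < \<infinity>" using emeasure_compact[OF compact_Un[OF ch compact_F[OF t]]] .
      finally show ?thesis .
    qed
    have [measurable]: "\<phi> \<in> borel_measurable m" using \<phi>(1) by simp
    let ?i = "indicat_real ((\<lambda>x. x + h) ` F t)"
    have "?i \<in> borel_measurable borel" using meas by (simp add: sets_m)
    then have "(\<integral>g. ?i (g + h) * \<phi> (g + h) \<partial>m) = (\<integral>g. ?i g * \<phi> g \<partial>m)"
      using \<phi>(1) by (intro integral_right) simp
    moreover have "?i (g + h) = indicat_real (F t) g" for g by (auto simp: indicator_def)
    ultimately have 1: "(\<integral>g. indicat_real (F t) g * \<phi> (g + h) \<partial>m) = (\<integral>g. ?i g * \<phi> g \<partial>m)" by simp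
    have int1: "integrable m (\<lambda>g. ?i g * \<phi> g)"
      using meas fin \<phi>(2)
      by (intro integrableI_bounded_set[where A="(\<lambda>x. x + h) ` F t" and B=B]) (auto simp: indicator_def)
    have int2: "integrable m (\<lambda>g. indicat_real (F t) g * \<phi> g)" by (rule integrable_on_F[OF t \<phi>])
    have "\<bar>(\<integral>g. ?i g * \<phi> g \<partial>m) - (\<integral>g. indicat_real (F t) g * \<phi> g \<partial>m)\<bar>
        = \<bar>\<integral>g. ?i g * \<phi> g - indicat_real (F t) g * \<phi> g \<partial>m\<bar>"
      using int1 int2 by simp
    also have "\<dots> \<le> (\<integral>g. B * indicat_real (D t) g \<partial>m)"
    proof (rule order_trans[OF integral_abs_bound], rule integral_mono)
      show "integrable m (\<lambda>g. \<bar>?i g * \<phi> g - indicat_real (F t) g * \<phi> g\<bar>)" using int1 int2 by simp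
      show "integrable m (\<lambda>g. B * indicat_real (D t) g)" using Dm Dfin by simp
      show "\<bar>?i g * \<phi> g - indicat_real (F t) g * \<phi> g\<bar> \<le> B * indicat_real (D t) g" for g
        using \<phi>(2)[of g] B unfolding D_def by (auto simp: indicator_def)
    qed
    also have "\<dots> = B * measure m (D t)" using Dm by (simp add: space_m)
    finally have "\<bar>(\<integral>g. ?i g * \<phi> g \<partial>m) - (\<integral>g. indicat_real (F t) g * \<phi> g \<partial>m)\<bar> \<le> B * measure m (D t)" .
    then show ?thesis
      unfolding average_def 1 diff_divide_distrib[symmetric] using measure_F_pos[OF t]
      by (simp add: divide_le_eq)
  qed
  have "((\<lambda>t. B * (measure m (D t) / measure m (F t))) \<longlongrightarrow> B * 0) at_top"
    using folner_F unfolding folner_def D_def by (intro tendsto_mult_left) blast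
  then have lim: "((\<lambda>t. B * (measure m (D t) / measure m (F t))) \<longlongrightarrow> 0) at_top" by simp
  show ?thesis
  proof (rule Lim_null_comparison[OF _ lim])
    show "eventually (\<lambda>t. norm (average t (\<lambda>g. \<phi> (g + h)) - average t \<phi>) \<le> B * (measure m (D t) / measure m (F t))) at_top"
      using eventually_gt_at_top[of 0] by (rule eventually_mono) (use bound in simp)
  qed
qed

end

section \<open>Unique ergodicity\<close>

locale uniquely_ergodic_hull = folner_group d m F + flc_hull d P\<^sub>0
  for d :: "'g :: {topological_group_add, second_countable_topology, t2_space} \<Rightarrow> 'g \<Rightarrow> real"
    and m :: "'g measure" and F :: "real \<Rightarrow> 'g set" and P\<^sub>0 :: "'g set" +
  assumes compact_hull: "compactin chabauty_fell (punctured_hull P\<^sub>0)"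
    and unique: "uniquely_ergodic P\<^sub>0"
begin

abbreviation \<nu> :: "'g set measure" where "\<nu> \<equiv> hull_measure P\<^sub>0"

lemma invariant_nu: "invariant_probability P\<^sub>0 \<nu>"
  unfolding hull_measure_def using unique unfolding uniquely_ergodic_def by (rule theI')

lemma nu_unique: "invariant_probability P\<^sub>0 \<mu> \<Longrightarrow> \<mu> = \<nu>"
  using unique invariant_nu unfolding uniquely_ergodic_def by blast

lemma space_nu: "space \<nu> = \<Omega>\<^sub>1" and sets_nu: "sets \<nu> = sets (borel_of_topology X\<^sub>1)"
  and prob_nu: "prob_space \<nu>" and distr_nu: "distr \<nu> \<nu> (\<lambda>P. (+) g ` P) = \<nu>"
  using invariant_nu unfolding invariant_probability_def by auto

sublocale nu: prob_space "hull_measure P\<^sub>0" by (rule prob_nu)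

lemma P0_nonempty: "P\<^sub>0 \<noteq> {}"
proof
  assume "P\<^sub>0 = {}"
  have "False" if P: "P \<in> \<Omega>\<^sub>1" for P
  proof -
    have "P \<in> \<Omega>" "P \<noteq> {}" using P unfolding punctured_hull_def by auto
    then have "P \<in> {C. closed C \<and> C \<inter> UNIV \<noteq> {}}" using hull_closed by auto
    from hull_open_meets_orbit[OF \<open>P \<in> \<Omega>\<close> this openin_chabauty_fell_hit] show False
      using \<open>P\<^sub>0 = {}\<close> by auto
  qed
  then show False using nu.not_empty space_nu by blast
qed

lemma orbit_mem: "(+) g ` P\<^sub>0 \<in> \<Omega>\<^sub>1"
  using translate_mem_hull1[OF P0_nonempty] .

lemma compact_X1: "compact_space X\<^sub>1"
  by (rule compact_space_subtopology[OF compact_hull])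

lemma Hausdorff_X1: "Hausdorff_space X\<^sub>1"
  by (rule Hausdorff_space_subtopology[OF Hausdorff_chabauty_fell])

lemma continuous_bounded:
  fixes \<phi> :: "'g set \<Rightarrow> 'b :: real_normed_vector"
  assumes "continuous_map X\<^sub>1 euclidean \<phi>"
  shows "\<exists>B>0. \<forall>P\<in>\<Omega>\<^sub>1. norm (\<phi> P) \<le> B"
proof -
  have "compactin euclidean (\<phi> ` \<Omega>\<^sub>1)"
    using compact_X1 topspace_X1 image_compactin[OF _ assms] unfolding compact_space_def by metis
  then have "compact (\<phi> ` \<Omega>\<^sub>1)" by simp
  then obtain B where "B > 0" "\<forall>y\<in>\<phi> ` \<Omega>\<^sub>1. norm y \<le> B"
    using compact_imp_bounded bounded_pos by metis
  then show ?thesis by blast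
qed

lemma openin_sets_nu:
  assumes "openin X\<^sub>1 U"
  shows "U \<in> sets \<nu>"
proof -
  have "{U. openin X\<^sub>1 U} \<subseteq> Pow (topspace X\<^sub>1)" using openin_subset by blast
  from sets_measure_of[OF this] show ?thesis
    unfolding sets_nu borel_of_topology_def using assms by blast
qed

lemma measurable_nu:
  fixes \<phi> :: "'g set \<Rightarrow> 'b :: topological_space"
  assumes "continuous_map X\<^sub>1 euclidean \<phi>"
  shows "\<phi> \<in> borel_measurable \<nu>"
proof (rule borel_measurableI)
  fix S :: "'b set" assume "open S"
  then have "openin X\<^sub>1 {x\<in>topspace X\<^sub>1. \<phi> x \<in> S}"
    by (intro openin_continuous_map_preimage[OF assms]) auto
  moreover have "\<phi> -` S \<inter> space \<nu> = {x\<in>topspace X\<^sub>1. \<phi> x \<in> S}"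
    unfolding space_nu topspace_X1 by auto
  ultimately show "\<phi> -` S \<inter> space \<nu> \<in> sets \<nu>"
    using openin_sets_nu by metis
qed

lemma integrable_nu:
  fixes \<phi> :: "'g set \<Rightarrow> 'b :: {banach, second_countable_topology}"
  assumes "continuous_map X\<^sub>1 euclidean \<phi>"
  shows "integrable \<nu> \<phi>"
proof -
  obtain B where "\<forall>P\<in>\<Omega>\<^sub>1. norm (\<phi> P) \<le> B" using continuous_bounded[OF assms] by blast
  then show ?thesis using measurable_nu[OF assms]
    by (intro nu.integrable_const_bound[where B=B]) (auto intro!: AE_I2 simp: space_nu)
qed

lemma continuous_map_translate_X1: "continuous_map X\<^sub>1 X\<^sub>1 (\<lambda>P. (+) g ` P)"
  unfolding continuous_map_in_subtopology
  using continuous_map_translate hull1_translate topspace_X1 by (auto intro: continuous_map_from_subtopology)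

lemma homeomorphic_maps_translate: "homeomorphic_maps X\<^sub>1 X\<^sub>1 (\<lambda>P. (+) g ` P) (\<lambda>P. (+) (- g) ` P)"
  unfolding homeomorphic_maps_def using continuous_map_translate_X1
  by (auto simp: image_image add.assoc[symmetric])

lemma continuous_orbit_function:
  assumes "continuous_map X\<^sub>1 euclidean \<phi>"
  shows "continuous_on UNIV (\<lambda>g. \<phi> ((+) (- g) ` P\<^sub>0))"
proof -
  have "continuous_map euclidean X\<^sub>1 (\<lambda>g. (+) g ` P\<^sub>0)"
    unfolding continuous_map_in_subtopology using continuous_map_orbit[OF closed_P0] orbit_mem by auto
  from continuous_map_compose[OF this assms]
  have "continuous_on UNIV (\<lambda>g. \<phi> ((+) g ` P\<^sub>0))" by (simp add: o_def)
  moreover have "continuous_on UNIV (\<lambda>g::'g. - g)" by (intro continuous_intros)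
  ultimately show ?thesis by (rule continuous_on_compose2) simp
qed

definition orbit_average :: "real \<Rightarrow> ('g set \<Rightarrow> real) \<Rightarrow> real" where
  "orbit_average t \<phi> = average t (\<lambda>g. \<phi> ((+) (- g) ` P\<^sub>0))"

lemma orbit_function:
  assumes "continuous_map X\<^sub>1 euclideanreal \<phi>"
  shows "(\<lambda>g. \<phi> ((+) (- g) ` P\<^sub>0)) \<in> borel_measurable borel"
    "\<exists>B>0. (\<forall>P\<in>\<Omega>\<^sub>1. \<bar>\<phi> P\<bar> \<le> B) \<and> (\<forall>g. \<bar>\<phi> ((+) (- g) ` P\<^sub>0)\<bar> \<le> B)"
  using borel_measurable_continuous_onI[OF continuous_orbit_function[OF assms]]
    continuous_bounded[OF assms, unfolded real_norm_def] orbit_mem by blast+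

lemma orbit_average_translate:
  assumes \<phi>: "continuous_map X\<^sub>1 euclideanreal \<phi>"
  shows "((\<lambda>t. orbit_average t (\<lambda>P. \<phi> ((+) h ` P)) - orbit_average t \<phi>) \<longlongrightarrow> 0) at_top"
proof -
  obtain B where B: "\<And>g. \<bar>\<phi> ((+) (- g) ` P\<^sub>0)\<bar> \<le> B" using orbit_function(2)[OF \<phi>] by blast
  have "(+) h ` (+) (- g) ` P\<^sub>0 = (+) (- (g + - h)) ` P\<^sub>0" for g
    by (simp add: image_image minus_add add.assoc[symmetric] del: add_uminus_conv_diff)
  then show ?thesis
    unfolding orbit_average_def using average_right_translate[OF orbit_function(1)[OF \<phi>] B, of "- h"]
    by simp
qed

text \<open>Suppose the averages of \<open>\<phi>\<close> stay away from the integral along a filter. The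
  averages of all continuous functions together form a point of a product of compact intervals, so they
  have a cluster point along that filter. This is a normalized positive functional, invariant because the
  family is Folner; it is represented by an invariant probability measure, which must be
  \<open>\<nu>\<close>.\<close>

theorem orbit_average_tendsto:
  assumes \<phi>: "continuous_map X\<^sub>1 euclideanreal \<phi>"
  shows "((\<lambda>t. orbit_average t \<phi>) \<longlongrightarrow> (\<integral>P. \<phi> P \<partial>\<nu>)) at_top"
proof (rule ccontr)
  define C where "C = {\<phi>. continuous_map X\<^sub>1 euclideanreal \<phi>}"
  define I where "I = (\<integral>P. \<phi> P \<partial>\<nu>)"
  assume "\<not> ?thesis"
  then obtain \<epsilon> where e: "\<epsilon> > 0" "\<not> eventually (\<lambda>t. dist (orbit_average t \<phi>) I < \<epsilon>) at_top"
    unfolding tendsto_iff I_def by blast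
  define G where "G = inf at_top (principal {t. \<not> dist (orbit_average t \<phi>) I < \<epsilon>})"
  have G: "G \<noteq> bot" using e(2) unfolding G_def trivial_limit_def eventually_inf_principal by simp
  have far: "eventually (\<lambda>t. \<not> dist (orbit_average t \<phi>) I < \<epsilon>) G"
    unfolding G_def eventually_inf_principal by simp
  have G_top: "eventually Q G" if "eventually Q at_top" for Q
    using that unfolding G_def eventually_inf_principal by (rule eventually_mono) simp
  have pos: "eventually (\<lambda>t. t > 0) G" by (rule G_top) (rule eventually_gt_at_top)
  \<comment> \<open>The value \<open>0\<close> outside \<open>C\<close> makes every coordinate bounded.\<close>
  define a where "a = (\<lambda>t \<psi>. if \<psi> \<in> C then orbit_average t \<psi> else 0)"
  have ex_b: "\<exists>B. \<forall>t>0. \<bar>a t \<psi>\<bar> \<le> B" for \<psi>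
  proof (cases "\<psi> \<in> C")
    case True
    then have c: "continuous_map X\<^sub>1 euclideanreal \<psi>" by (simp add: C_def)
    then obtain B where B: "\<And>g. \<bar>\<psi> ((+) (- g) ` P\<^sub>0)\<bar> \<le> B" using orbit_function(2) by blast
    then show ?thesis
      using average_bound[OF _ orbit_function(1)[OF c] B] True unfolding a_def orbit_average_def by auto
  next
    case False
    then show ?thesis by (auto simp: a_def)
  qed
  define b where "b = (\<lambda>\<psi>. SOME B. \<forall>t>0. \<bar>a t \<psi>\<bar> \<le> B)"
  have b: "\<bar>a t \<psi>\<bar> \<le> b \<psi>" if "t > 0" for t \<psi>
    using someI_ex[OF ex_b[of \<psi>]] that unfolding b_def by blast
  define K where "K = (PiE UNIV (\<lambda>\<psi>. {- b \<psi>..b \<psi>}))"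
  have "compactin (product_topology (\<lambda>i. euclidean) UNIV) K"
    unfolding K_def compactin_PiE by simp
  then have K: "compact K" unfolding euclidean_product_topology by simp
  have "eventually (\<lambda>f. f \<in> K) (filtermap a G)"
    unfolding eventually_filtermap using pos
  proof (rule eventually_mono)
    fix t :: real assume "t > 0"
    have "a t \<psi> \<in> {- b \<psi>..b \<psi>}" for \<psi> using b[OF \<open>t > 0\<close>, of \<psi>] by (simp add: abs_le_iff)
    then show "a t \<in> K" unfolding K_def PiE_UNIV_domain by blast
  qed
  with K G obtain \<Lambda> where "inf (nhds \<Lambda>) (filtermap a G) \<noteq> bot"
    unfolding compact_filter by (metis filtermap_bot_iff)
  define H where "H = inf (nhds \<Lambda>) (filtermap a G)"
  have H: "H \<noteq> bot" unfolding H_def by fact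
  have ev: "((\<lambda>f. f \<psi>) \<longlongrightarrow> \<Lambda> \<psi>) H" for \<psi>
  proof -
    have "((\<lambda>f. f \<psi>) \<longlongrightarrow> \<Lambda> \<psi>) (nhds \<Lambda>)"
    proof (rule topological_tendstoI)
      fix S :: "real set" assume S: "open S" "\<Lambda> \<psi> \<in> S"
      have "open ((\<lambda>f::('g set \<Rightarrow> real) \<Rightarrow> real. f \<psi>) -` S)"
        using S(1) by (rule open_vimage) simp
      then show "eventually (\<lambda>f. f \<psi> \<in> S) (nhds \<Lambda>)"
        unfolding eventually_nhds using S(2) by (intro exI[of _ "(\<lambda>f. f \<psi>) -` S"]) auto
    qed
    then show ?thesis unfolding H_def by (rule tendsto_mono[rotated]) simp
  qed
  have H_ev: "eventually Q H" if "eventually (\<lambda>t. Q (a t)) G" for Q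
    using that unfolding H_def by (intro filter_leD[OF inf_le2]) (simp add: eventually_filtermap)
  have H_lim: "(Q \<longlongrightarrow> l) H" if "((\<lambda>t. Q (a t)) \<longlongrightarrow> l) G" for Q and l :: real
    unfolding H_def using that by (intro tendsto_mono[OF inf_le2]) (simp add: filterlim_filtermap)
  have lim_eq: "l = l'" if "(Q \<longlongrightarrow> l) H" "(Q' \<longlongrightarrow> l') H" "eventually (\<lambda>t. Q (a t) = Q' (a t)) G"
    for Q Q' and l l' :: real
  proof -
    have "(Q' \<longlongrightarrow> l) H" using that(1) by (rule Lim_transform_eventually) (rule H_ev[OF that(3)])
    then show ?thesis using tendsto_unique[OF H _ that(2)] by blast
  qed
  interpret functional: normalized_positive_functional X\<^sub>1 \<Lambda>
  proof
    fix f g and c :: real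
    assume f: "continuous_map X\<^sub>1 euclideanreal f"
    have "eventually (\<lambda>t. a t (\<lambda>P. c * f P) = c * a t f) G"
      using f by (simp add: a_def C_def orbit_average_def average_scale continuous_map_real_mult_left)
    then show "\<Lambda> (\<lambda>x. c * f x) = c * \<Lambda> f"
      by (intro lim_eq[OF ev[of "\<lambda>x. c * f x"] tendsto_mult_left[OF ev[of f], of c]])
    assume g: "continuous_map X\<^sub>1 euclideanreal g"
    obtain B B' where B: "\<And>x. \<bar>f ((+) (- x) ` P\<^sub>0)\<bar> \<le> B" "\<And>x. \<bar>g ((+) (- x) ` P\<^sub>0)\<bar> \<le> B'"
      using orbit_function(2)[OF f] orbit_function(2)[OF g] by metis
    have fg: "continuous_map X\<^sub>1 euclideanreal (\<lambda>P. f P + g P)" by (intro continuous_intros f g)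
    have "eventually (\<lambda>t. a t (\<lambda>P. f P + g P) = a t f + a t g) G"
      using pos
    proof (rule eventually_mono)
      fix t :: real assume "t > 0"
      from average_add[OF this orbit_function(1)[OF f] B(1) orbit_function(1)[OF g] B(2)]
      show "a t (\<lambda>P. f P + g P) = a t f + a t g" using f g fg by (simp add: a_def C_def orbit_average_def)
    qed
    then show "\<Lambda> (\<lambda>x. f x + g x) = \<Lambda> f + \<Lambda> g"
      by (intro lim_eq[OF ev[of "\<lambda>x. f x + g x"] tendsto_add[OF ev[of f] ev[of g]]])
  next
    fix f assume f: "continuous_map X\<^sub>1 euclideanreal f" "\<And>P. P \<in> topspace X\<^sub>1 \<Longrightarrow> 0 \<le> f P"
    have "0 \<le> f ((+) (- g) ` P\<^sub>0)" for g using f(2) orbit_mem unfolding topspace_X1 by blast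
    then have "0 \<le> orbit_average t f" for t unfolding orbit_average_def by (rule average_nonneg)
    then have "eventually (\<lambda>t. 0 \<le> a t f) G" by (simp add: a_def)
    then have "eventually (\<lambda>h. 0 \<le> h f) H" by (rule H_ev)
    then show "0 \<le> \<Lambda> f" using tendsto_lowerbound[OF ev _ H] by blast
  next
    have "eventually (\<lambda>t. a t (\<lambda>P. 1) = 1) G"
      using pos by (rule eventually_mono) (simp add: a_def C_def orbit_average_def average_const)
    then show "\<Lambda> (\<lambda>P. 1) = 1" by (intro lim_eq[OF ev[of "\<lambda>P. 1"] tendsto_const])
  qed (rule compact_X1 Hausdorff_X1)+
  have inv: "\<Lambda> (\<lambda>P. f ((+) h ` P)) = \<Lambda> f" if f: "continuous_map X\<^sub>1 euclideanreal f" for f h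
  proof -
    have fh: "continuous_map X\<^sub>1 euclideanreal (\<lambda>P. f ((+) h ` P))"
      using continuous_map_compose[OF continuous_map_translate_X1 f] by (simp add: o_def)
    have "((\<lambda>t. a t (\<lambda>P. f ((+) h ` P)) - a t f) \<longlongrightarrow> 0) G"
      using orbit_average_translate[OF f, of h] f fh unfolding G_def
      by (intro tendsto_mono[OF inf_le1]) (simp add: a_def C_def)
    then have "((\<lambda>k. k (\<lambda>P. f ((+) h ` P)) - k f) \<longlongrightarrow> 0) H" by (rule H_lim)
    moreover have "((\<lambda>k. k (\<lambda>P. f ((+) h ` P)) - k f) \<longlongrightarrow> \<Lambda> (\<lambda>P. f ((+) h ` P)) - \<Lambda> f) H"
      by (intro tendsto_diff ev)
    ultimately show ?thesis using tendsto_unique[OF H] by fastforce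
  qed
  have "invariant_probability P\<^sub>0 functional.representing_measure"
    unfolding invariant_probability_def
    using functional.space_representing_measure functional.sets_representing_measure
      functional.prob_space_representing_measure
      functional.distr_representing_measure[OF homeomorphic_maps_translate inv]
    by (simp add: topspace_X1 del: topspace_subtopology)
  then have rep: "functional.representing_measure = \<nu>" by (rule nu_unique)
  obtain B where B: "B > 0" "\<And>P. P \<in> \<Omega>\<^sub>1 \<Longrightarrow> \<bar>\<phi> P\<bar> \<le> B" using continuous_bounded[OF \<phi>, unfolded real_norm_def] by blast
  \<comment> \<open>Rescale \<open>\<phi>\<close> to take values in \<open>[0, 1]\<close>, as the representation theorem requires.\<close>
  define c where "c = 1 / (2 * B)"
  define \<psi> where "\<psi> = (\<lambda>P. c * \<phi> P + 1 / 2)"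
  have c: "c > 0" "\<And>y. \<bar>y\<bar> \<le> B \<Longrightarrow> \<bar>c * y\<bar> \<le> 1 / 2"
    using B(1) by (auto simp: c_def abs_mult field_simps)
  have c\<phi>: "continuous_map X\<^sub>1 euclideanreal (\<lambda>P. c * \<phi> P)" using \<phi> by (rule continuous_map_real_mult_left)
  have \<psi>: "continuous_map X\<^sub>1 euclideanreal \<psi>" unfolding \<psi>_def by (intro continuous_map_add c\<phi>) simp
  have "0 \<le> \<psi> P \<and> \<psi> P \<le> 1" if "P \<in> topspace X\<^sub>1" for P
    using c(2)[OF B(2)[of P]] that unfolding topspace_X1 \<psi>_def by (auto simp: abs_le_iff)
  then have "\<Lambda> \<psi> = (\<integral>P. \<psi> P \<partial>\<nu>)" using functional.functional_eq_integral[OF \<psi>] rep by simp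
  also have "\<dots> = c * I + 1 / 2"
    unfolding \<psi>_def I_def using integrable_nu[OF \<phi>] nu.prob_space
    by (subst Bochner_Integration.integral_add) auto
  finally have "\<Lambda> \<psi> = c * I + 1 / 2" .
  moreover have "\<Lambda> \<psi> = c * \<Lambda> \<phi> + 1 / 2"
    unfolding \<psi>_def using functional.add[OF c\<phi>, of "\<lambda>P. 1 / 2"]
      functional.scale[OF \<phi>, of c] functional.const[of "1/2"]
    by simp
  ultimately have "\<Lambda> \<phi> = I" using c(1) by simp
  then have "((\<lambda>f. f \<phi>) \<longlongrightarrow> I) H" using ev[of \<phi>] by simp
  then have "eventually (\<lambda>f. dist (f \<phi>) I < \<epsilon>) H" using e(1) by (rule tendstoD)
  moreover have "eventually (\<lambda>f. \<not> dist (f \<phi>) I < \<epsilon>) H"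
    using far \<phi> by (intro H_ev) (simp add: a_def C_def)
  ultimately have "eventually (\<lambda>f. False) H" by eventually_elim simp
  then show False using H by (simp add: trivial_limit_def)
qed

lemma integral_nu_translate:
  fixes \<phi> :: "'g set \<Rightarrow> 'b::{banach, second_countable_topology}"
  assumes \<phi>: "continuous_map X\<^sub>1 euclidean \<phi>"
  shows "(\<integral>P. \<phi> ((+) h ` P) \<partial>\<nu>) = (\<integral>P. \<phi> P \<partial>\<nu>)"
proof -
  have meas: "(\<lambda>P. (+) h ` P) \<in> measurable \<nu> \<nu>"
  proof (rule measurableI)
    show "(+) h ` P \<in> space \<nu>" if "P \<in> space \<nu>" for P using that hull1_translate by (simp add: space_nu)
    have "(\<lambda>P. (+) h ` P) \<in> measurable \<nu> (borel_of_topology X\<^sub>1)"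
      unfolding borel_of_topology_def
    proof (rule measurable_measure_of)
      show "(\<lambda>P. (+) h ` P) -` U \<inter> space \<nu> \<in> sets \<nu>" if "U \<in> {U. openin X\<^sub>1 U}" for U
      proof -
        have "openin X\<^sub>1 {P\<in>topspace X\<^sub>1. (+) h ` P \<in> U}"
          using that by (intro openin_continuous_map_preimage[OF continuous_map_translate_X1]) auto
        moreover have "(\<lambda>P. (+) h ` P) -` U \<inter> space \<nu> = {P\<in>topspace X\<^sub>1. (+) h ` P \<in> U}"
          unfolding space_nu topspace_X1 by auto
        ultimately show ?thesis using openin_sets_nu by metis
      qed
      show "{U. openin X\<^sub>1 U} \<subseteq> Pow (topspace X\<^sub>1)" using openin_subset by blast
      show "(\<lambda>P. (+) h ` P) \<in> space \<nu> \<rightarrow> topspace X\<^sub>1"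
        unfolding space_nu topspace_X1 using hull1_translate by blast
    qed
    then show "(\<lambda>P. (+) h ` P) -` A \<inter> space \<nu> \<in> sets \<nu>" if "A \<in> sets \<nu>" for A
      using that unfolding sets_nu using sets_nu by (metis measurable_sets)
  qed
  show ?thesis using integral_distr[OF meas measurable_nu[OF \<phi>]] by (simp add: distr_nu)
qed

end

section \<open>Continuous functions of compact support\<close>

lemma pair_points_translate:
  "pair_points z ((+) g ` P) = (+) g ` pair_points z (P :: 'g :: group_add set)"
  unfolding pair_points_def by (auto simp: add.assoc)

lemma point_sum_translate:
  fixes P :: "'g :: group_add set"
  shows "point_sum h ((+) g ` P) = point_sum (\<lambda>x. h (g + x)) P"
proof -
  have "{x. x \<in> (+) g ` P \<and> h x \<noteq> 0} = (+) g ` {x. x \<in> P \<and> h (g + x) \<noteq> 0}" by auto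
  then show ?thesis unfolding point_sum_def by (simp add: sum.reindex)
qed

context admissible_group
begin

text \<open>The class \<open>Cc\<close> for values in any normed space. Since closed balls are compact, a
  support is relatively compact if it is bounded.\<close>

definition compactly_supported :: "('g \<Rightarrow> 'b::real_normed_vector) \<Rightarrow> bool" where
  "compactly_supported h \<longleftrightarrow> continuous_on UNIV h \<and> (\<exists>R. \<forall>x. h x \<noteq> 0 \<longrightarrow> d 0 x \<le> R)"

lemma compactly_supportedI:
  "continuous_on UNIV h \<Longrightarrow> (\<And>x. h x \<noteq> 0 \<Longrightarrow> d 0 x \<le> R) \<Longrightarrow> compactly_supported h"
  unfolding compactly_supported_def by blast

lemma compactly_supportedE:
  assumes "compactly_supported h"
  obtains R where "continuous_on UNIV h" "\<And>x. h x \<noteq> 0 \<Longrightarrow> d 0 x \<le> R"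
  using assms unfolding compactly_supported_def by blast

lemma compactly_supported_Cc: "compactly_supported f \<longleftrightarrow> f \<in> Cc"
  unfolding Cc_iff compactly_supported_def ..

lemma compactly_supported_translate:
  assumes "compactly_supported h"
  shows "compactly_supported (\<lambda>x. h (g + x))"
proof -
  obtain R where R: "continuous_on UNIV h" "\<And>x. h x \<noteq> 0 \<Longrightarrow> d 0 x \<le> R"
    using assms unfolding compactly_supported_def by blast
  have "d 0 x \<le> d 0 (- g) + R" if "h (g + x) \<noteq> 0" for x
    using R(2)[OF that] triangle[of 0 "- g" x] dist_translate[of g "- g" x] by simp
  moreover have "continuous_on UNIV (\<lambda>x. h (g + x))"
    by (rule continuous_on_compose2[OF R(1)]) (auto intro!: continuous_intros)
  ultimately show ?thesis by (rule compactly_supportedI[rotated])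
qed

lemma compactly_supported_minus:
  assumes "compactly_supported h"
  shows "compactly_supported (\<lambda>x. h (- x))"
proof -
  obtain R where R: "continuous_on UNIV h" "\<And>x. h x \<noteq> 0 \<Longrightarrow> d 0 x \<le> R"
    using assms unfolding compactly_supported_def by blast
  have "continuous_on UNIV (\<lambda>x. h (- x))"
    by (rule continuous_on_compose2[OF R(1)]) (auto intro!: continuous_intros)
  then show ?thesis using R(2) dist_zero_minus by (intro compactly_supportedI[where R=R]) metis+
qed

lemma compactly_supported_times:
  fixes h k :: "'g \<Rightarrow> 'b::real_normed_algebra"
  assumes "compactly_supported h" "continuous_on UNIV k"
  shows "compactly_supported (\<lambda>x. h x * k x)"
proof -
  obtain R where R: "continuous_on UNIV h" "\<And>x. h x \<noteq> 0 \<Longrightarrow> d 0 x \<le> R"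
    using assms(1) unfolding compactly_supported_def by blast
  have "h x \<noteq> 0" if "h x * k x \<noteq> 0" for x using that by auto
  then show ?thesis using R assms(2)
    by (intro compactly_supportedI[where R=R] continuous_intros) blast+
qed

lemma compactly_supported_compose:
  assumes "compactly_supported h" "continuous_on UNIV T" "T 0 = 0"
  shows "compactly_supported (\<lambda>x. T (h x))"
proof -
  obtain R where R: "continuous_on UNIV h" "\<And>x. h x \<noteq> 0 \<Longrightarrow> d 0 x \<le> R"
    using assms(1) unfolding compactly_supported_def by blast
  have "h x \<noteq> 0" if "T (h x) \<noteq> 0" for x using that assms(3) by auto
  then show ?thesis using R assms(2)
    by (intro compactly_supportedI[where R=R] continuous_on_compose2[OF assms(2)]) blast+
qed

lemma integrable_compactly_supported:
  fixes f :: "'g \<Rightarrow> 'b::{banach, second_countable_topology}"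
  assumes "radon_measure \<mu>" "compactly_supported f"
  shows "integrable \<mu> f"
  using assms(2) by (rule compactly_supportedE) (rule integrable_continuous_bounded_support[OF assms(1)])

definition bump :: "real \<Rightarrow> 'g \<Rightarrow> real" where
  "bump \<delta> x = max 0 (\<delta> - d 0 x)"

lemma bump: "bump \<delta> x \<ge> 0" "bump \<delta> x \<noteq> 0 \<Longrightarrow> d 0 x < \<delta>" "bump \<delta> (- x) = bump \<delta> x"
  unfolding bump_def by (auto simp: dist_zero_minus)

lemma continuous_bump: "continuous_on UNIV (bump \<delta>)"
  unfolding bump_def by (intro continuous_intros continuous_dist)

lemma compactly_supported_bump: "compactly_supported (bump \<delta>)"
  using bump(2) by (intro compactly_supportedI[where R=\<delta>] continuous_bump) (auto intro: less_imp_le)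

end

context haar_group
begin

text \<open>The inversion comes from averaging over \<open>g\<close> the value
  \<open>h (- g + x)\<close> that \<open>x\<close> contributes to the translate of a set by
  \<open>- g\<close>.\<close>

definition reflected_integral :: "('g \<Rightarrow> 'b::{banach, second_countable_topology}) \<Rightarrow> 'b" where
  "reflected_integral h = (\<integral>g. h (- g) \<partial>m)"

lemma integrable_reflected:
  "compactly_supported (h :: 'g \<Rightarrow> 'b::{banach, second_countable_topology}) \<Longrightarrow> integrable m (\<lambda>g. h (- g))"
  by (rule integrable_compactly_supported[OF radon_m compactly_supported_minus])

lemma reflected_measurable:
  assumes "compactly_supported h"
  shows "(\<lambda>g. h (- g + x)) \<in> borel_measurable borel"
proof -
  have "continuous_on UNIV h" using assms by (simp add: compactly_supported_def)
  then have "continuous_on UNIV (\<lambda>g. h (- g + x))"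
    by (rule continuous_on_compose2) (auto intro!: continuous_intros)
  then show ?thesis by (rule borel_measurable_continuous_onI)
qed

lemma integral_reflected_translate:
  fixes h :: "'g \<Rightarrow> 'b::{banach, second_countable_topology}"
  assumes "compactly_supported h"
  shows "(\<integral>g. h (- g + x) \<partial>m) = reflected_integral h"
proof -
  have "(\<integral>g. h (- g + x) \<partial>m) = (\<integral>g. h (- (x + g) + x) \<partial>m)"
    by (rule integral_left[OF reflected_measurable[OF assms], symmetric])
  also have "\<dots> = reflected_integral h"
    unfolding reflected_integral_def by (simp add: minus_add add.assoc del: add_uminus_conv_diff)
  finally show ?thesis .
qed

lemma reflected_integral_translate:
  fixes h :: "'g \<Rightarrow> 'b::{banach, second_countable_topology}"
  assumes "compactly_supported h"
  shows "reflected_integral (\<lambda>x. h (g + x)) = reflected_integral h"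
proof -
  have "(\<integral>x. h (- (x + - g)) \<partial>m) = (\<integral>x. h (- x) \<partial>m)"
    using integral_right[OF reflected_measurable[OF assms, of 0], of "- g"] by simp
  then show ?thesis
    unfolding reflected_integral_def by (simp add: minus_add del: add_uminus_conv_diff)
qed

lemma reflected_integral_bump_pos:
  assumes "\<delta> > 0"
  shows "reflected_integral (bump \<delta>) > 0"
proof -
  let ?B = "{y. d 0 y < \<delta> / 2}"
  have B: "?B \<in> sets m" unfolding sets_m by (rule borel_open[OF open_ball])
  have "emeasure m ?B \<le> emeasure m {y. d 0 y \<le> \<delta> / 2}"
    by (rule emeasure_mono) (auto simp only: closed_ball_in_sets sets_m intro: less_imp_le)
  also have "\<dots> < \<infinity>" by (rule emeasure_compact[OF compact_closed_ball])
  finally have fin: "emeasure m ?B < \<infinity>" .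
  then have "measure m ?B > 0"
    using emeasure_ball_pos[of "\<delta>/2" 0] assms by (simp add: measure_def enn2real_positive_iff)
  then have "0 < (\<delta> / 2) * measure m ?B" using assms by simp
  also have "\<dots> = (\<integral>g. (\<delta> / 2) * indicat_real ?B g \<partial>m)" using B by (simp add: space_m)
  also have "\<dots> \<le> reflected_integral (bump \<delta>)"
    unfolding reflected_integral_def
  proof (rule integral_mono)
    show "integrable m (\<lambda>g. (\<delta> / 2) * indicat_real ?B g)" using B fin by simp
    show "integrable m (\<lambda>g. bump \<delta> (- g))" by (rule integrable_reflected[OF compactly_supported_bump])
    show "(\<delta> / 2) * indicat_real ?B g \<le> bump \<delta> (- g)" for g
      unfolding bump(3) by (auto simp: bump_def indicator_def max_def)
  qed
  finally show ?thesis .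
qed

lemma reflected_integral_nonneg: "(\<And>x. 0 \<le> h x) \<Longrightarrow> 0 \<le> reflected_integral (h :: 'g \<Rightarrow> real)"
  unfolding reflected_integral_def by (rule Bochner_Integration.integral_nonneg) simp

end

section \<open>Densities of pairs and the Campbell formula\<close>

context flc_hull
begin

lemma point_sum_hull:
  assumes P: "P \<in> \<Omega>" and h: "\<And>x. h x \<noteq> 0 \<Longrightarrow> d 0 x \<le> R"
  shows "finite (pair_points z P \<inter> {y. d 0 y \<le> R})"
    "point_sum h (pair_points z P) = (\<Sum>x\<in>pair_points z P \<inter> {y. d 0 y \<le> R}. h x)"
proof -
  have "finite (P \<inter> {y. d 0 y \<le> R})" by (rule finite_hull_bounded[OF P compact_closed_ball])
  then show "finite (pair_points z P \<inter> {y. d 0 y \<le> R})"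
    by (rule finite_subset[rotated]) (auto simp: pair_points_def)
  then show "point_sum h (pair_points z P) = (\<Sum>x\<in>pair_points z P \<inter> {y. d 0 y \<le> R}. h x)"
    using h by (intro point_sum_eq) auto
qed

end

context uniquely_ergodic_hull
begin

lemma P0_in_hull: "P\<^sub>0 \<in> \<Omega>"
  using translate_mem_hull[of 0] by simp

lemma hull1_subset: "P \<in> \<Omega>\<^sub>1 \<Longrightarrow> P \<in> \<Omega>"
  unfolding punctured_hull_def by simp

lemma finite_pair_points_F: "t > 0 \<Longrightarrow> finite (pair_points z P\<^sub>0 \<inter> F t)"
  by (rule finite_subset[OF _ finite_hull_bounded[OF P0_in_hull compact_F]]) (auto simp: pair_points_def)

text \<open>The intensity functional of the random point set \<open>pair_points z P\<close>, where
  \<open>P\<close> has law \<open>\<nu>\<close>.\<close>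

definition campbell :: "'g \<Rightarrow> ('g \<Rightarrow> 'b::{banach, second_countable_topology}) \<Rightarrow> 'b" where
  "campbell z h = (\<integral>P. point_sum h (pair_points z P) \<partial>\<nu>)"

lemma continuous_pair_sum':
  fixes h :: "'g \<Rightarrow> 'b::real_normed_vector"
  shows "compactly_supported h \<Longrightarrow> continuous_map X\<^sub>1 euclidean (\<lambda>P. point_sum h (pair_points z P))"
  by (erule compactly_supportedE) (rule continuous_pair_sum)

lemma campbell_translate:
  fixes h :: "'g \<Rightarrow> 'b::{banach, second_countable_topology}"
  assumes "compactly_supported h"
  shows "campbell z (\<lambda>x. h (g + x)) = campbell z h"
  using integral_nu_translate[OF continuous_pair_sum'[OF assms], of z g]
  unfolding campbell_def by (simp add: pair_points_translate point_sum_translate)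

lemma campbell_sum:
  fixes h :: "'i \<Rightarrow> 'g \<Rightarrow> 'b::{banach, second_countable_topology}"
  assumes h: "\<And>i. i \<in> I \<Longrightarrow> compactly_supported (h i)" and I: "finite I"
  shows "campbell z (\<lambda>x. \<Sum>i\<in>I. h i x) = (\<Sum>i\<in>I. campbell z (h i))"
proof -
  have "\<exists>R. \<forall>x. h i x \<noteq> 0 \<longrightarrow> d 0 x \<le> R" if "i \<in> I" for i
    using h[OF that] unfolding compactly_supported_def by blast
  then obtain r where r: "\<And>i x. i \<in> I \<Longrightarrow> h i x \<noteq> 0 \<Longrightarrow> d 0 x \<le> r i" by metis
  define R where "R = (\<Sum>i\<in>I. \<bar>r i\<bar>)"
  have R: "d 0 x \<le> R" if "i \<in> I" "h i x \<noteq> 0" for i x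
  proof -
    have "\<bar>r i\<bar> \<le> R" unfolding R_def using I that(1) by (intro member_le_sum) auto
    then show ?thesis using r[OF that] by linarith
  qed
  have "point_sum (\<lambda>x. \<Sum>i\<in>I. h i x) (pair_points z P) = (\<Sum>i\<in>I. point_sum (h i) (pair_points z P))"
    if P: "P \<in> \<Omega>" for P
  proof -
    let ?A = "pair_points z P \<inter> {y. d 0 y \<le> R}"
    have "d 0 x \<le> R" if "(\<Sum>i\<in>I. h i x) \<noteq> 0" for x
      using that R by (meson sum.neutral)
    then have "point_sum (\<lambda>x. \<Sum>i\<in>I. h i x) (pair_points z P) = (\<Sum>x\<in>?A. \<Sum>i\<in>I. h i x)"
      by (rule point_sum_hull(2)[OF P])
    also have "\<dots> = (\<Sum>i\<in>I. \<Sum>x\<in>?A. h i x)" by (rule sum.swap)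
    also have "\<dots> = (\<Sum>i\<in>I. point_sum (h i) (pair_points z P))"
      by (intro sum.cong refl point_sum_hull(2)[OF P, symmetric] R)
    finally show ?thesis .
  qed
  then have "campbell z (\<lambda>x. \<Sum>i\<in>I. h i x) = (\<integral>P. (\<Sum>i\<in>I. point_sum (h i) (pair_points z P)) \<partial>\<nu>)"
    unfolding campbell_def by (intro Bochner_Integration.integral_cong) (auto simp: space_nu hull1_subset)
  also have "\<dots> = (\<Sum>i\<in>I. campbell z (h i))"
    unfolding campbell_def
    by (rule Bochner_Integration.integral_sum) (rule integrable_nu[OF continuous_pair_sum'[OF h]])
  finally show ?thesis .
qed

lemma reflected_integral_sum:
  fixes h :: "'i \<Rightarrow> 'g \<Rightarrow> 'b::{banach, second_countable_topology}"
  assumes h: "\<And>i. i \<in> I \<Longrightarrow> compactly_supported (h i)"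
  shows "reflected_integral (\<lambda>x. \<Sum>i\<in>I. h i x) = (\<Sum>i\<in>I. reflected_integral (h i))"
  unfolding reflected_integral_def using integrable_reflected[OF h] by (rule Bochner_Integration.integral_sum)

lemma campbell_bounded_linear:
  fixes h :: "'g \<Rightarrow> 'b::{banach, second_countable_topology}" and T :: "'b \<Rightarrow> 'c::{banach, second_countable_topology}"
  assumes h: "compactly_supported h" and T: "bounded_linear T"
  shows "campbell z (\<lambda>x. T (h x)) = T (campbell z h)"
    "reflected_integral (\<lambda>x. T (h x)) = T (reflected_integral h)"
proof -
  obtain R where R: "\<And>x. h x \<noteq> 0 \<Longrightarrow> d 0 x \<le> R" using h unfolding compactly_supported_def by blast
  have R': "d 0 x \<le> R" if "T (h x) \<noteq> 0" for x
    using R[of x] that linear_simps(3)[OF T] by (cases "h x = 0") auto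
  have "point_sum (\<lambda>x. T (h x)) (pair_points z P) = T (point_sum h (pair_points z P))" if P: "P \<in> \<Omega>" for P
    using point_sum_hull(2)[OF P, of h, OF R] point_sum_hull(2)[OF P, of "\<lambda>x. T (h x)", OF R']
    by (simp add: bounded_linear.linear[OF T] linear_sum)
  then have "campbell z (\<lambda>x. T (h x)) = (\<integral>P. T (point_sum h (pair_points z P)) \<partial>\<nu>)"
    unfolding campbell_def by (intro Bochner_Integration.integral_cong) (auto simp: space_nu hull1_subset)
  also have "\<dots> = T (campbell z h)"
    unfolding campbell_def by (rule integral_bounded_linear[OF T integrable_nu[OF continuous_pair_sum'[OF h]]])
  finally show "campbell z (\<lambda>x. T (h x)) = T (campbell z h)" .
  show "reflected_integral (\<lambda>x. T (h x)) = T (reflected_integral h)"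
    unfolding reflected_integral_def by (rule integral_bounded_linear[OF T integrable_reflected[OF h]])
qed

definition pair_frequency :: "'g \<Rightarrow> real \<Rightarrow> real" where
  "pair_frequency z t = real (card (pair_points z P\<^sub>0 \<inter> F t)) / measure m (F t)"

lemma orbit_average_pair_sum:
  "orbit_average t (\<lambda>P. point_sum h (pair_points z P)) =
     (\<integral>g. indicat_real (F t) g * point_sum (\<lambda>x. h (- g + x)) (pair_points z P\<^sub>0) \<partial>m) / measure m (F t)"
  unfolding orbit_average_def average_def by (simp add: pair_points_translate point_sum_translate)

text \<open>If \<open>h\<close> lives on the ball of radius \<open>\<delta>\<close>, then
  \<open>h (- g + x)\<close> vanishes unless \<open>g\<close> and \<open>x\<close> have distance less
  than \<open>\<delta>\<close>. Hence integrating over \<open>g \<in> F t\<close> charges only points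
  \<open>x\<close> in the thickening of \<open>F t\<close>, and charges completely the points
  \<open>x\<close> whose \<open>\<delta>\<close>-ball lies in \<open>F t\<close>. Each point that is
  charged completely contributes \<open>reflected_integral h\<close>.\<close>

lemma orbit_average_frequency:
  assumes h: "compactly_supported h" "\<And>x. 0 \<le> h x" "\<And>x. h x \<noteq> 0 \<Longrightarrow> d 0 x < \<delta>"
    and t: "t > 0" and a: "a \<ge> 0" and thick: "\<And>x y. x \<in> F t \<Longrightarrow> d x y < \<delta> \<Longrightarrow> y \<in> F (t + a)"
    and ratio: "measure m (F (t + a)) \<le> (1 + \<epsilon>) * measure m (F t)"
  shows "orbit_average t (\<lambda>P. point_sum h (pair_points z P))
           \<le> (1 + \<epsilon>) * (reflected_integral h * pair_frequency z (t + a))"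
    "reflected_integral h * pair_frequency z t
       \<le> (1 + \<epsilon>) * orbit_average (t + a) (\<lambda>P. point_sum h (pair_points z P))"
proof -
  let ?N = "pair_points z P\<^sub>0" and ?\<kappa> = "reflected_integral h"
  have ta: "t + a > 0" using t a by simp
  have \<kappa>: "?\<kappa> \<ge> 0" by (rule reflected_integral_nonneg[OF h(2)])
  have close: "d g x < \<delta>" "d x g < \<delta>" if "h (- g + x) \<noteq> 0" for g x
    using h(3)[OF that] dist_eq[of g x] commute[of g x] by auto
  have int: "integrable m (\<lambda>g. h (- g + x))" for x
    using integrable_compactly_supported[OF radon_m
        compactly_supported_translate[OF compactly_supported_minus[OF h(1)], of "- x"]]
    by (simp add: minus_add)
  have "(\<integral>g. indicat_real (F t) g * point_sum (\<lambda>x. h (- g + x)) ?N \<partial>m)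
      = (\<integral>g. (\<Sum>x\<in>?N \<inter> F (t + a). indicat_real (F t) g * h (- g + x)) \<partial>m)"
  proof (rule Bochner_Integration.integral_cong)
    fix g
    show "indicat_real (F t) g * point_sum (\<lambda>x. h (- g + x)) ?N
        = (\<Sum>x\<in>?N \<inter> F (t + a). indicat_real (F t) g * h (- g + x))"
    proof (cases "g \<in> F t")
      case True
      have "point_sum (\<lambda>x. h (- g + x)) ?N = (\<Sum>x\<in>?N \<inter> F (t + a). h (- g + x))"
        by (rule point_sum_eq[OF finite_pair_points_F[OF ta]]) (use close thick[OF True] in auto)
      then show ?thesis using True by simp
    qed simp
  qed simp
  also have "\<dots> = (\<Sum>x\<in>?N \<inter> F (t + a). \<integral>g. indicat_real (F t) g * h (- g + x) \<partial>m)"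
    using integrable_mult_indicator[OF F_in_sets[OF t] int] by (intro Bochner_Integration.integral_sum) simp
  also have "\<dots> \<le> (\<Sum>x\<in>?N \<inter> F (t + a). \<integral>g. h (- g + x) \<partial>m)"
    using integrable_mult_indicator[OF F_in_sets[OF t] int] h(2)
    by (intro sum_mono integral_mono int) (auto simp: indicator_def)
  also have "\<dots> = ?\<kappa> * card (?N \<inter> F (t + a))"
    by (simp add: integral_reflected_translate[OF h(1)])
  finally have "orbit_average t (\<lambda>P. point_sum h (pair_points z P)) \<le> ?\<kappa> * card (?N \<inter> F (t + a)) / measure m (F t)"
    unfolding orbit_average_pair_sum using measure_F_pos[OF t] by (simp add: divide_right_mono)
  also have "\<dots> \<le> (1 + \<epsilon>) * (?\<kappa> * pair_frequency z (t + a))"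
  proof -
    have "1 / measure m (F t) \<le> (1 + \<epsilon>) / measure m (F (t + a))"
      using ratio measure_F_pos[OF t] measure_F_pos[OF ta] by (simp add: field_simps)
    from mult_left_mono[OF this, of "?\<kappa> * card (?N \<inter> F (t + a))"] show ?thesis
      unfolding pair_frequency_def using \<kappa> by (simp add: algebra_simps)
  qed
  finally show "orbit_average t (\<lambda>P. point_sum h (pair_points z P)) \<le> (1 + \<epsilon>) * (?\<kappa> * pair_frequency z (t + a))" .

  have fin: "finite {x \<in> ?N. h (- g + x) \<noteq> 0}" for g
  proof -
    have "finite (P\<^sub>0 \<inter> {x. d g x \<le> \<delta>})" by (rule finite_hull_bounded[OF P0_in_hull compact_closed_ball])
    then show ?thesis by (rule finite_subset[rotated]) (auto simp: pair_points_def dest: close(1) less_imp_le)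
  qed
  have intA: "integrable m (\<lambda>g. indicat_real (F (t + a)) g * point_sum (\<lambda>x. h (- g + x)) ?N)"
  proof -
    note c = continuous_pair_sum'[OF h(1), of z]
    obtain B where "\<And>g. \<bar>point_sum h (pair_points z ((+) (- g) ` P\<^sub>0))\<bar> \<le> B"
      using orbit_function(2)[OF c] by blast
    from integrable_on_F[OF ta orbit_function(1)[OF c] this]
    show ?thesis by (simp add: pair_points_translate point_sum_translate)
  qed
  have "?\<kappa> * card (?N \<inter> F t) = (\<Sum>x\<in>?N \<inter> F t. \<integral>g. h (- g + x) \<partial>m)"
    by (simp add: integral_reflected_translate[OF h(1)])
  also have "\<dots> = (\<integral>g. (\<Sum>x\<in>?N \<inter> F t. h (- g + x)) \<partial>m)"
    using int by (intro Bochner_Integration.integral_sum[symmetric])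
  also have "\<dots> \<le> (\<integral>g. indicat_real (F (t + a)) g * point_sum (\<lambda>x. h (- g + x)) ?N \<partial>m)"
  proof (rule integral_mono[OF _ intA])
    show "integrable m (\<lambda>g. \<Sum>x\<in>?N \<inter> F t. h (- g + x))" using int by (rule Bochner_Integration.integrable_sum)
    fix g
    show "(\<Sum>x\<in>?N \<inter> F t. h (- g + x)) \<le> indicat_real (F (t + a)) g * point_sum (\<lambda>x. h (- g + x)) ?N"
    proof (cases "g \<in> F (t + a)")
      case True
      have "(\<Sum>x\<in>?N \<inter> F t. h (- g + x)) = (\<Sum>x\<in>(?N \<inter> F t) \<inter> {x \<in> ?N. h (- g + x) \<noteq> 0}. h (- g + x))"
        using finite_pair_points_F[OF t, of z] by (intro sum.mono_neutral_right) auto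
      also have "\<dots> \<le> (\<Sum>x\<in>{x \<in> ?N. h (- g + x) \<noteq> 0}. h (- g + x))"
        using fin h(2) by (intro sum_mono2) auto
      also have "\<dots> = point_sum (\<lambda>x. h (- g + x)) ?N" unfolding point_sum_def by simp
      finally show ?thesis using True by simp
    next
      case False
      have "h (- g + x) = 0" if "x \<in> ?N \<inter> F t" for x
        using close(2)[of g x] thick[of x g] that False by auto
      then have "(\<Sum>x\<in>?N \<inter> F t. h (- g + x)) = 0" by (intro sum.neutral) auto
      then show ?thesis using False by simp
    qed
  qed
  finally have *: "?\<kappa> * card (?N \<inter> F t) \<le> measure m (F (t + a)) * orbit_average (t + a) (\<lambda>P. point_sum h (pair_points z P))"
    unfolding orbit_average_pair_sum using measure_F_pos[OF ta] by simp
  also have "\<dots> \<le> ((1 + \<epsilon>) * measure m (F t)) * orbit_average (t + a) (\<lambda>P. point_sum h (pair_points z P))"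
  proof (rule mult_right_mono[OF ratio])
    show "0 \<le> orbit_average (t + a) (\<lambda>P. point_sum h (pair_points z P))"
      unfolding orbit_average_def point_sum_def by (intro average_nonneg sum_nonneg h(2))
  qed
  finally show "?\<kappa> * pair_frequency z t \<le> (1 + \<epsilon>) * orbit_average (t + a) (\<lambda>P. point_sum h (pair_points z P))"
    unfolding pair_frequency_def using measure_F_pos[OF t] by (simp add: field_simps)
qed

lemma campbell_eq_limit:
  assumes "compactly_supported (h :: 'g \<Rightarrow> real)"
  shows "((\<lambda>t. orbit_average t (\<lambda>P. point_sum h (pair_points z P))) \<longlongrightarrow> campbell z h) at_top"
  unfolding campbell_def by (rule orbit_average_tendsto[OF continuous_pair_sum'[OF assms]])

lemma eventually_shift: "eventually Q at_top \<Longrightarrow> eventually (\<lambda>t::real. Q (t + a)) at_top"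
  unfolding eventually_at_top_linorder by (metis add.commute diff_le_eq)

text \<open>Let \<open>t\<close> tend to infinity in the orbit averages of the preceding estimates. One
  of them relates the average at \<open>t\<close> to the frequency at \<open>t + a\<close>; it is used
  at \<open>t - a\<close>.\<close>

lemma small_support_squeeze:
  assumes e: "\<epsilon> > 0"
  shows "\<exists>\<delta>>0. \<forall>h z \<eta>. compactly_supported h \<longrightarrow> (\<forall>x. 0 \<le> h x) \<longrightarrow> (\<forall>x. h x \<noteq> 0 \<longrightarrow> d 0 x < \<delta>) \<longrightarrow> \<eta> > 0 \<longrightarrow>
    eventually (\<lambda>t. campbell z h \<le> (1 + \<epsilon>) * (reflected_integral h * pair_frequency z t) + \<eta> \<and>
                    reflected_integral h * pair_frequency z t \<le> (1 + \<epsilon>) * campbell z h + \<eta>) at_top"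
proof -
  obtain \<delta> a where \<delta>: "\<delta> > 0" and a: "a \<ge> 0"
    and thick: "\<And>t x y. t > 0 \<Longrightarrow> x \<in> F t \<Longrightarrow> d x y < \<delta> \<Longrightarrow> y \<in> F (t + a)"
    and ratio: "\<And>t. t > 0 \<Longrightarrow> measure m (F (t + a)) \<le> (1 + \<epsilon>) * measure m (F t)"
    using small_thickening[OF e] by metis
  have "eventually (\<lambda>t. campbell z h \<le> (1 + \<epsilon>) * (reflected_integral h * pair_frequency z t) + \<eta> \<and>
                    reflected_integral h * pair_frequency z t \<le> (1 + \<epsilon>) * campbell z h + \<eta>) at_top"
    if h: "compactly_supported h" "\<And>x. 0 \<le> h x" "\<And>x. h x \<noteq> 0 \<Longrightarrow> d 0 x < \<delta>" and \<eta>: "\<eta> > 0" for h z \<eta>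
  proof -
    define A where "A = (\<lambda>t. orbit_average t (\<lambda>P. point_sum h (pair_points z P)))"
    define \<eta>' where "\<eta>' = \<eta> / (1 + \<epsilon>)"
    have \<eta>': "\<eta>' > 0" "(1 + \<epsilon>) * \<eta>' = \<eta>" "\<eta>' \<le> \<eta>" unfolding \<eta>'_def using e \<eta> by (auto simp: field_simps)
    have A: "eventually (\<lambda>t. \<bar>A t - campbell z h\<bar> < \<eta>') at_top"
      using tendstoD[OF campbell_eq_limit[OF h(1)] \<eta>'(1), of z] unfolding A_def dist_real_def .
    have 1: "A t \<le> (1 + \<epsilon>) * (reflected_integral h * pair_frequency z (t + a))"
      "reflected_integral h * pair_frequency z t \<le> (1 + \<epsilon>) * A (t + a)" if t: "t > 0" for t
      using orbit_average_frequency[OF h t a thick[OF t] ratio[OF t], where z=z] unfolding A_def by auto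
    have "eventually (\<lambda>t. \<bar>A (t + - a) - campbell z h\<bar> < \<eta>') at_top" by (rule eventually_shift[OF A])
    moreover have "eventually (\<lambda>t. \<bar>A (t + a) - campbell z h\<bar> < \<eta>') at_top" by (rule eventually_shift[OF A])
    moreover have "eventually (\<lambda>t. t > a) at_top" by (rule eventually_gt_at_top)
    ultimately show ?thesis
    proof eventually_elim
      case (elim t)
      have t: "t > 0" "t - a > 0" using elim(3) a by auto
      have "campbell z h \<le> A (t - a) + \<eta>'" using elim(1) by simp
      then have "campbell z h \<le> (1 + \<epsilon>) * (reflected_integral h * pair_frequency z t) + \<eta>"
        using 1(1)[OF t(2)] \<eta>'(3) by simp
      moreover have "(1 + \<epsilon>) * A (t + a) \<le> (1 + \<epsilon>) * (campbell z h + \<eta>')"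
        using elim(2) e by (intro mult_left_mono) auto
      then have "reflected_integral h * pair_frequency z t \<le> (1 + \<epsilon>) * campbell z h + \<eta>"
        using 1(2)[OF t(1)] \<eta>'(2) by (simp add: algebra_simps)
      ultimately show ?case by simp
    qed
  qed
  then show ?thesis using \<delta> by blast
qed

text \<open>Bumps of shrinking support bound all late values of \<open>pair_frequency z\<close> between
  \<open>l / (1 + \<epsilon>)\<close> and \<open>(1 + \<epsilon>) l\<close> for some
  \<open>l\<close> depending on \<open>\<epsilon>\<close>, up to an additive error. Any cluster point
  obeys the same bounds, so it is the limit.\<close>

lemma pair_frequency_converges: "\<exists>c\<ge>0. (pair_frequency z \<longlongrightarrow> c) at_top"
proof -
  let ?q = "pair_frequency z"
  have q0: "?q t \<ge> 0" for t unfolding pair_frequency_def by (simp add: measure_nonneg)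
  have sq: "\<exists>l. eventually (\<lambda>t. l \<le> (1 + \<epsilon>) * ?q t + \<epsilon> \<and> ?q t \<le> (1 + \<epsilon>) * l + \<epsilon>) at_top" if e: "\<epsilon> > 0" for \<epsilon>
  proof -
    from small_support_squeeze[OF e] obtain \<delta> where \<delta>: "\<delta> > 0"
      and s: "\<And>h z \<eta>. compactly_supported h \<Longrightarrow> (\<forall>x. 0 \<le> h x) \<Longrightarrow> (\<forall>x. h x \<noteq> 0 \<longrightarrow> d 0 x < \<delta>) \<Longrightarrow> \<eta> > 0 \<Longrightarrow>
        eventually (\<lambda>t. campbell z h \<le> (1 + \<epsilon>) * (reflected_integral h * pair_frequency z t) + \<eta> \<and>
                    reflected_integral h * pair_frequency z t \<le> (1 + \<epsilon>) * campbell z h + \<eta>) at_top"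
      by blast
    define \<kappa> where "\<kappa> = reflected_integral (bump \<delta>)"
    have \<kappa>: "\<kappa> > 0" unfolding \<kappa>_def by (rule reflected_integral_bump_pos[OF \<delta>])
    have "eventually (\<lambda>t. campbell z (bump \<delta>) \<le> (1 + \<epsilon>) * (\<kappa> * ?q t) + \<epsilon> * \<kappa> \<and>
                    \<kappa> * ?q t \<le> (1 + \<epsilon>) * campbell z (bump \<delta>) + \<epsilon> * \<kappa>) at_top"
      unfolding \<kappa>_def using bump e \<kappa>[unfolded \<kappa>_def] by (intro s compactly_supported_bump) auto
    then have "eventually (\<lambda>t. campbell z (bump \<delta>) / \<kappa> \<le> (1 + \<epsilon>) * ?q t + \<epsilon> \<and>
                    ?q t \<le> (1 + \<epsilon>) * (campbell z (bump \<delta>) / \<kappa>) + \<epsilon>) at_top"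
      by (rule eventually_mono) (use \<kappa> in \<open>simp add: field_simps\<close>)
    then show ?thesis by blast
  qed
  \<comment> \<open>The case \<open>\<epsilon> = 1\<close> bounds the frequencies, which yields a cluster point \<open>c\<close>.\<close>
  obtain l1 where "eventually (\<lambda>t. l1 \<le> (1 + 1) * ?q t + 1 \<and> ?q t \<le> (1 + 1) * l1 + 1) at_top"
    using sq[of 1] by auto
  then have "eventually (\<lambda>t. ?q t \<le> 2 * l1 + 1) at_top" by (rule eventually_mono) simp
  then have bd: "eventually (\<lambda>t. ?q t \<in> {0..2 * l1 + 1}) at_top"
    by (rule eventually_mono) (simp add: q0)
  define M where "M = 2 * l1 + 1"
  have "eventually (\<lambda>y. y \<in> {0..M}) (filtermap ?q at_top)"
    using bd unfolding eventually_filtermap M_def .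
  moreover have "filtermap ?q at_top \<noteq> bot" by (simp add: filtermap_bot_iff)
  ultimately obtain c where c: "c \<in> {0..M}" "inf (nhds c) (filtermap ?q at_top) \<noteq> bot"
    using compact_Icc[of 0 M] unfolding compact_filter by blast
  have transfer: "c \<in> S" if "eventually (\<lambda>t. ?q t \<in> S) at_top" "closed S" for S
  proof (rule ccontr)
    assume "c \<notin> S"
    then have "eventually (\<lambda>y. y \<in> - S) (nhds c)"
      using that(2) by (intro eventually_nhds_in_open) (auto simp: open_Compl)
    moreover have "eventually (\<lambda>y. y \<in> S) (filtermap ?q at_top)" using that(1) by (simp add: eventually_filtermap)
    ultimately have "eventually (\<lambda>y. False) (inf (nhds c) (filtermap ?q at_top))"
      unfolding eventually_inf by fastforce
    then show False using c(2) by (simp add: trivial_limit_def)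
  qed
  have "(?q \<longlongrightarrow> c) at_top"
  proof (rule tendstoI)
    fix \<eta> :: real assume \<eta>: "\<eta> > 0"
    define \<epsilon> where "\<epsilon> = min 1 (\<eta> / (4 * (M + 1)))"
    have M: "M \<ge> 0" using c(1) by simp
    have e: "\<epsilon> > 0" "\<epsilon> \<le> 1" unfolding \<epsilon>_def using \<eta> M by auto
    have "\<epsilon> * (4 * (M + 1)) \<le> \<eta>"
      using M pos_le_divide_eq[of "4 * (M + 1)" \<epsilon> \<eta>] unfolding \<epsilon>_def by simp
    moreover have "0 < \<epsilon> * (M + 1)" using e(1) M by simp
    ultimately have e3: "3 * \<epsilon> * (M + 1) < \<eta>" by linarith
    obtain l where l: "eventually (\<lambda>t. l \<le> (1 + \<epsilon>) * ?q t + \<epsilon> \<and> ?q t \<le> (1 + \<epsilon>) * l + \<epsilon>) at_top"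
      using sq[OF e(1)] by blast
    have "c \<in> {y. l \<le> (1 + \<epsilon>) * y + \<epsilon> \<and> y \<le> (1 + \<epsilon>) * l + \<epsilon>}"
      using l by (intro transfer closed_Collect_conj closed_Collect_le continuous_intros) auto
    then have lc: "l \<le> (1 + \<epsilon>) * c + \<epsilon>" "c \<le> (1 + \<epsilon>) * l + \<epsilon>" by auto
    have close: "x - y < \<eta>" if "x \<le> (1 + \<epsilon>) * l + \<epsilon>" "l \<le> (1 + \<epsilon>) * y + \<epsilon>" "0 \<le> y" "y \<le> M" for x y
    proof -
      have "(1 + \<epsilon>) * l \<le> (1 + \<epsilon>) * ((1 + \<epsilon>) * y + \<epsilon>)" using that(2) e(1) by (intro mult_left_mono) auto
      then have "x - y \<le> (2 * \<epsilon> + \<epsilon> * \<epsilon>) * y + (2 * \<epsilon> + \<epsilon> * \<epsilon>)" using that(1) by (simp add: algebra_simps)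
      also have "\<dots> \<le> (3 * \<epsilon>) * y + 3 * \<epsilon>"
        using e that(3) by (intro add_mono mult_right_mono) (auto simp: mult_left_le)
      also have "\<dots> \<le> (3 * \<epsilon>) * M + 3 * \<epsilon>" using that(4) e(1) by simp
      also have "\<dots> < \<eta>" using e3 by (simp add: algebra_simps)
      finally show ?thesis .
    qed
    show "eventually (\<lambda>t. dist (?q t) c < \<eta>) at_top"
      using l bd
    proof eventually_elim
      case (elim t)
      have "?q t - c < \<eta>" using elim lc c(1) by (intro close) auto
      moreover have "c - ?q t < \<eta>" using elim lc c(1) by (intro close) (auto simp: M_def)
      ultimately show ?case by (simp add: dist_real_def abs_less_iff)
    qed
  qed
  then show ?thesis using c(1) by auto
qed

definition pair_density :: "'g \<Rightarrow> real" where
  "pair_density z = Lim at_top (pair_frequency z)"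

lemma pair_frequency_tendsto: "(pair_frequency z \<longlongrightarrow> pair_density z) at_top"
  and pair_density_nonneg: "pair_density z \<ge> 0"
  using pair_frequency_converges[of z] tendsto_Lim[of at_top "pair_frequency z"]
  unfolding pair_density_def by auto

lemma campbell_small_support:
  assumes e: "\<epsilon> > 0"
  shows "\<exists>\<delta>>0. \<forall>h z. compactly_supported h \<longrightarrow> (\<forall>x. 0 \<le> h x) \<longrightarrow> (\<forall>x. h x \<noteq> 0 \<longrightarrow> d 0 x < \<delta>) \<longrightarrow>
    campbell z h \<le> (1 + \<epsilon>) * (pair_density z * reflected_integral h) \<and>
    pair_density z * reflected_integral h \<le> (1 + \<epsilon>) * campbell z h"
proof -
  from small_support_squeeze[OF e] obtain \<delta> where \<delta>: "\<delta> > 0"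
    and s: "\<And>h z \<eta>. compactly_supported h \<Longrightarrow> (\<forall>x. 0 \<le> h x) \<Longrightarrow> (\<forall>x. h x \<noteq> 0 \<longrightarrow> d 0 x < \<delta>) \<Longrightarrow> \<eta> > 0 \<Longrightarrow>
      eventually (\<lambda>t. campbell z h \<le> (1 + \<epsilon>) * (reflected_integral h * pair_frequency z t) + \<eta> \<and>
                  reflected_integral h * pair_frequency z t \<le> (1 + \<epsilon>) * campbell z h + \<eta>) at_top"
    by blast
  have "campbell z h \<le> (1 + \<epsilon>) * (pair_density z * reflected_integral h) \<and>
    pair_density z * reflected_integral h \<le> (1 + \<epsilon>) * campbell z h"
    if h: "compactly_supported h" "\<forall>x. 0 \<le> h x" "\<forall>x. h x \<noteq> 0 \<longrightarrow> d 0 x < \<delta>" for h z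
  proof (intro conjI; rule field_le_epsilon)
    fix \<eta> :: real assume \<eta>: "\<eta> > 0"
    note ev = s[OF h \<eta>, of z]
    have "((\<lambda>t. (1 + \<epsilon>) * (reflected_integral h * pair_frequency z t) + \<eta>) \<longlongrightarrow>
        (1 + \<epsilon>) * (reflected_integral h * pair_density z) + \<eta>) at_top"
      by (intro tendsto_intros pair_frequency_tendsto)
    from tendsto_lowerbound[OF this, of "campbell z h"] eventually_mono[OF ev conjunct1]
    show "campbell z h \<le> (1 + \<epsilon>) * (pair_density z * reflected_integral h) + \<eta>"
      by (simp add: mult.commute)
    have "((\<lambda>t. reflected_integral h * pair_frequency z t) \<longlongrightarrow> reflected_integral h * pair_density z) at_top"
      by (intro tendsto_intros pair_frequency_tendsto)
    from tendsto_upperbound[OF this eventually_mono[OF ev conjunct2]]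
    show "pair_density z * reflected_integral h \<le> (1 + \<epsilon>) * campbell z h + \<eta>"
      by (simp add: mult.commute)
  qed
  then show ?thesis using \<delta> by blast
qed

text \<open>A continuous function of compact support is cut into finitely many pieces of small support.
  Both sides are additive and invariant under left translation, which moves each piece to the
  identity.\<close>

lemma campbell_formula_nonneg:
  assumes h: "compactly_supported (h :: 'g \<Rightarrow> real)" "\<And>x. 0 \<le> h x"
  shows "campbell z h = pair_density z * reflected_integral h"
proof -
  obtain R where R: "continuous_on UNIV h" "\<And>x. h x \<noteq> 0 \<Longrightarrow> d 0 x \<le> R"
    using h(1) unfolding compactly_supported_def by blast
  have main: "campbell z h \<le> (1 + \<epsilon>) * (pair_density z * reflected_integral h) \<and>
    pair_density z * reflected_integral h \<le> (1 + \<epsilon>) * campbell z h" if e: "\<epsilon> > 0" for \<epsilon>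
  proof -
    from campbell_small_support[OF e] obtain \<delta> where \<delta>: "\<delta> > 0"
      and s: "\<And>h z. compactly_supported h \<Longrightarrow> (\<forall>x. 0 \<le> h x) \<Longrightarrow> (\<forall>x. h x \<noteq> 0 \<longrightarrow> d 0 x < \<delta>) \<Longrightarrow>
        campbell z h \<le> (1 + \<epsilon>) * (pair_density z * reflected_integral h) \<and>
        pair_density z * reflected_integral h \<le> (1 + \<epsilon>) * campbell z h"
      by blast
    obtain I where I: "finite I" "{y. d 0 y \<le> R} \<subseteq> (\<Union>x\<in>I. {y. d x y < \<delta> / 2})"
      using finite_ball_cover[OF compact_closed_ball, of 0 R "\<lambda>x. \<delta> / 2"] \<delta> by auto
    \<comment> \<open>Each \<open>b x\<close> is at least \<open>1\<close> on the ball of radius \<open>\<delta> / 2\<close> and vanishes off the ball of radius \<open>\<delta>\<close>. The maximum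
      in \<open>S\<close> keeps the denominator away from \<open>0\<close>; on the support of \<open>h\<close> it is the sum itself.\<close>
    define b where "b = (\<lambda>x y. max 0 (2 - (2 / \<delta>) * d x y))"
    define S where "S = (\<lambda>y. max 1 (\<Sum>x\<in>I. b x y))"
    have b0: "b x y \<ge> 0" for x y unfolding b_def by simp
    have S1: "S y \<ge> 1" for y unfolding S_def by simp
    have cb: "continuous_on UNIV (b x)" for x unfolding b_def by (intro continuous_intros continuous_dist)
    have cS: "continuous_on UNIV S" unfolding S_def by (intro continuous_intros cb)
    define p where "p = (\<lambda>x y. h y * (b x y / S y))"
    have cbS: "continuous_on UNIV (\<lambda>y. b x y / S y)" for x
    proof (intro continuous_on_divide cb cS ballI)
      show "S y \<noteq> 0" for y using S1[of y] by simp
    qed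
    have p: "compactly_supported (p x)" for x
      unfolding p_def by (rule compactly_supported_times[OF h(1) cbS])
    have p0: "p x y \<ge> 0" for x y unfolding p_def using h(2)[of y] b0[of x y] S1[of y] by simp
    have h_sum: "h y = (\<Sum>x\<in>I. p x y)" for y
    proof (cases "h y = 0")
      case True
      then show ?thesis by (simp add: p_def)
    next
      case False
      then obtain x where x: "x \<in> I" "d x y < \<delta> / 2" using R(2) I(2) by blast
      then have "1 \<le> b x y" unfolding b_def using \<delta> by (simp add: field_simps le_max_iff_disj)
      also have "\<dots> \<le> (\<Sum>x\<in>I. b x y)" using x(1) I(1) b0 by (intro member_le_sum) auto
      finally have "S y = (\<Sum>x\<in>I. b x y)" unfolding S_def by simp
      moreover have "(\<Sum>x\<in>I. p x y) = h y * ((\<Sum>x\<in>I. b x y) / S y)"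
        unfolding p_def by (simp add: sum_distrib_left sum_divide_distrib)
      ultimately show ?thesis using S1[of y] by simp
    qed
    have piece: "campbell z (p x) \<le> (1 + \<epsilon>) * (pair_density z * reflected_integral (p x)) \<and>
        pair_density z * reflected_integral (p x) \<le> (1 + \<epsilon>) * campbell z (p x)" for x
    proof -
      have "d 0 y < \<delta>" if "p x (x + y) \<noteq> 0" for y
      proof -
        have "b x (x + y) \<noteq> 0" using that unfolding p_def by auto
        then have "d x (x + y) < \<delta>" unfolding b_def using \<delta> by (simp add: field_simps max_def split: if_splits)
        then show ?thesis using dist_translate[of x 0 y] by simp
      qed
      then show ?thesis
        using s[OF compactly_supported_translate[OF p, of x x], of z] p0
          campbell_translate[OF p, of z x x] reflected_integral_translate[OF p, of x x] by simp
    qed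
    have eq: "h = (\<lambda>y. \<Sum>x\<in>I. p x y)" using h_sum by blast
    have L: "campbell z h = (\<Sum>x\<in>I. campbell z (p x))"
      by (subst eq) (rule campbell_sum[OF p I(1)])
    have K: "reflected_integral h = (\<Sum>x\<in>I. reflected_integral (p x))"
      by (subst eq) (rule reflected_integral_sum[OF p])
    show ?thesis unfolding L K sum_distrib_left using piece by (auto intro!: sum_mono)
  qed
  have lim: "((\<lambda>\<epsilon>. (1 + \<epsilon>) * x) \<longlongrightarrow> (1 + 0) * x) (at_right 0)" for x :: real
    by (intro tendsto_intros)
  have "campbell z h \<le> (1 + 0) * (pair_density z * reflected_integral h)"
    by (rule tendsto_lowerbound[OF lim]) (use main in \<open>auto simp: eventually_at_right_less intro: eventually_mono[OF eventually_at_right_less]\<close>)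
  moreover have "pair_density z * reflected_integral h \<le> (1 + 0) * campbell z h"
    by (rule tendsto_lowerbound[OF lim]) (use main in \<open>auto intro: eventually_mono[OF eventually_at_right_less]\<close>)
  ultimately show ?thesis by simp
qed

lemma campbell_formula_real:
  assumes h: "compactly_supported (h :: 'g \<Rightarrow> real)"
  shows "campbell z h = pair_density z * reflected_integral h"
proof -
  define h1 where "h1 = (\<lambda>x. max 0 (h x))"
  define h2 where "h2 = (\<lambda>x. max 0 (- h x))"
  have c: "compactly_supported h1" "compactly_supported h2"
    unfolding h1_def h2_def
    by (rule compactly_supported_compose[OF h]; simp add: continuous_intros)+
  have c2: "compactly_supported (\<lambda>x. - h2 x)"
    by (rule compactly_supported_compose[OF c(2)]) (simp_all add: continuous_intros)
  have bl: "bounded_linear (uminus :: real \<Rightarrow> real)" by (rule bounded_linear_minus[OF bounded_linear_ident])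
  have eq: "h = (\<lambda>x. \<Sum>i\<in>{True, False}. (if i then h1 else (\<lambda>x. - h2 x)) x)"
    by (auto simp: h1_def h2_def fun_eq_iff)
  have cc: "compactly_supported (if i then h1 else (\<lambda>x. - h2 x))" for i using c c2 by simp
  have "campbell z h = campbell z h1 - campbell z h2"
    by (subst eq, subst campbell_sum[OF cc]) (simp_all add: campbell_bounded_linear(1)[OF c(2) bl])
  moreover have "reflected_integral h = reflected_integral h1 - reflected_integral h2"
    by (subst eq, subst reflected_integral_sum[OF cc]) (simp_all add: campbell_bounded_linear(2)[OF c(2) bl])
  ultimately show ?thesis
    using campbell_formula_nonneg[OF c(1)] campbell_formula_nonneg[OF c(2)]
    by (simp add: h1_def h2_def right_diff_distrib)
qed

theorem campbell_formula:
  assumes h: "compactly_supported (h :: 'g \<Rightarrow> complex)"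
  shows "campbell z h = complex_of_real (pair_density z) * reflected_integral h"
proof (rule complex_eqI)
  have c: "compactly_supported (\<lambda>x. Re (h x))" "compactly_supported (\<lambda>x. Im (h x))"
    by (rule compactly_supported_compose[OF h]; simp add: continuous_intros)+
  show "Re (campbell z h) = Re (complex_of_real (pair_density z) * reflected_integral h)"
    using campbell_bounded_linear[OF h bounded_linear_Re] campbell_formula_real[OF c(1)] by simp
  show "Im (campbell z h) = Im (complex_of_real (pair_density z) * reflected_integral h)"
    using campbell_bounded_linear[OF h bounded_linear_Im] campbell_formula_real[OF c(2)] by simp
qed

end

section \<open>Convolutions and the uniqueness of the auto-correlation measure\<close>

context admissible_group
begin

lemma continuous_onI_dist:
  fixes f :: "'g \<Rightarrow> 'b::real_normed_vector"
  assumes "\<And>x \<epsilon>. \<epsilon> > 0 \<Longrightarrow> \<exists>\<delta>>0. \<forall>y. d x y < \<delta> \<longrightarrow> norm (f y - f x) < \<epsilon>"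
  shows "continuous_on UNIV f"
  unfolding continuous_on_open_vimage[OF open_UNIV]
proof (intro allI impI, unfold open_iff, safe)
  fix B :: "'b set" and x assume B: "open B" "f x \<in> B"
  then obtain e where e: "e > 0" "\<And>y. norm (y - f x) < e \<Longrightarrow> y \<in> B"
    unfolding open_dist dist_norm by blast
  obtain \<delta> where "\<delta> > 0" "\<And>y. d x y < \<delta> \<Longrightarrow> norm (f y - f x) < e" using assms[OF e(1)] by blast
  then show "\<exists>r>0. {y. d x y < r} \<subseteq> f -` B \<inter> UNIV" using e(2) by (intro exI[of _ \<delta>]) auto
qed

lemma compactly_supported_star: "compactly_supported f \<Longrightarrow> compactly_supported (star f)"
  unfolding star_def
  by (rule compactly_supported_compose[OF compactly_supported_minus]) (auto intro: continuous_intros)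

lemma compactly_supported_scale:
  assumes "compactly_supported f"
  shows "compactly_supported (\<lambda>x. c * f x :: complex)"
  by (rule compactly_supported_compose[OF assms]) (auto intro: continuous_intros)

lemma compactly_supported_add:
  fixes f h :: "'g \<Rightarrow> 'b::real_normed_vector"
  assumes f: "compactly_supported f" and h: "compactly_supported h"
  shows "compactly_supported (\<lambda>x. f x + h x)"
proof -
  obtain R where R: "continuous_on UNIV f" "\<And>x. f x \<noteq> 0 \<Longrightarrow> d 0 x \<le> R"
    using f unfolding compactly_supported_def by blast
  obtain S where S: "continuous_on UNIV h" "\<And>x. h x \<noteq> 0 \<Longrightarrow> d 0 x \<le> S"
    using h unfolding compactly_supported_def by blast
  have "d 0 x \<le> max R S" if "f x + h x \<noteq> 0" for x
    using that R(2)[of x] S(2)[of x] by (cases "f x = 0") auto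
  moreover have "continuous_on UNIV (\<lambda>x. f x + h x)" by (intro continuous_intros R(1) S(1))
  ultimately show ?thesis by (rule compactly_supportedI[rotated])
qed

lemma uniformly_continuous_supported:
  fixes f :: "'g \<Rightarrow> 'b::real_normed_vector"
  assumes "compactly_supported f" "\<epsilon> > 0"
  shows "\<exists>\<delta>>0. \<forall>x y. d x y < \<delta> \<longrightarrow> norm (f x - f y) < \<epsilon>"
  using assms uniformly_continuous unfolding compactly_supported_def by metis

definition distance_to :: "'g set \<Rightarrow> 'g \<Rightarrow> real" where
  "distance_to K x = (INF k\<in>K. d x k)"

lemma distance_to_lipschitz:
  assumes "K \<noteq> {}"
  shows "\<bar>distance_to K x - distance_to K y\<bar> \<le> d x y"
proof -
  have bdd: "bdd_below (d x ` K)" for x by (rule bdd_belowI[of _ 0]) auto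
  have "distance_to K x \<le> d x y + distance_to K y" for x y
  proof -
    have "distance_to K x - d x y \<le> d y k" if "k \<in> K" for k
    proof -
      have "distance_to K x \<le> d x k" unfolding distance_to_def by (rule cINF_lower[OF bdd that])
      then show ?thesis using triangle[of x y k] by simp
    qed
    then have "distance_to K x - d x y \<le> distance_to K y"
      unfolding distance_to_def[of K y] using assms by (intro cINF_greatest)
    then show ?thesis by simp
  qed
  from this[of x y] this[of y x] show ?thesis using commute[of x y] by (simp add: abs_le_iff)
qed

lemma distance_to_nonneg: "K \<noteq> {} \<Longrightarrow> 0 \<le> distance_to K x"
  unfolding distance_to_def by (rule cINF_greatest) auto

lemma distance_to_mem: "k \<in> K \<Longrightarrow> distance_to K k = 0"
proof -
  assume k: "k \<in> K"
  have "distance_to K k \<le> d k k" unfolding distance_to_def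
    by (rule cINF_lower[OF bdd_belowI[of _ 0] k]) auto
  then show ?thesis using distance_to_nonneg[of K k] k by auto
qed

lemma distance_to_pos:
  assumes K: "closed K" "K \<noteq> {}" and x: "x \<notin> K"
  shows "distance_to K x > 0"
proof -
  obtain r where r: "r > 0" "{y. d x y < r} \<subseteq> - K"
    using open_contains_ball[of "- K" x] K(1) x by (auto simp: open_Compl)
  have "r \<le> distance_to K x" unfolding distance_to_def
  proof (rule cINF_greatest[OF K(2)])
    fix k assume "k \<in> K"
    then show "r \<le> d x k" using r(2) by (auto simp: subset_iff not_less[symmetric])
  qed
  then show ?thesis using r(1) by simp
qed

lemma sets_borel_eq_compact: "sets (borel :: 'g measure) = sigma_sets UNIV {K. compact K}"
proof
  have "K \<in> sets borel" if "compact K" for K :: "'g set" using compact_imp_closed[OF that] by (rule borel_closed)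
  then show "sigma_sets UNIV {K. compact K} \<subseteq> sets (borel :: 'g measure)"
    using sets.sigma_sets_subset[of "{K. compact K}" borel] by auto
  interpret sigma_algebra UNIV "sigma_sets UNIV {K :: 'g set. compact K}"
    by (rule sigma_algebra_sigma_sets) auto
  have "C \<in> sigma_sets UNIV {K. compact K}" if "closed C" for C :: "'g set"
  proof -
    have "C = (\<Union>n::nat. C \<inter> {y. d 0 y \<le> real n})" using real_arch_simple by blast
    moreover have "compact (C \<inter> {y. d 0 y \<le> real n})" for n
      by (rule closed_Int_compact[OF that compact_closed_ball])
    then have "(\<Union>n::nat. C \<inter> {y. d 0 y \<le> real n}) \<in> sigma_sets UNIV {K. compact K}"
      by (intro countable_UN) auto
    ultimately show ?thesis by simp
  qed
  then have "sigma_sets UNIV (Collect closed) \<subseteq> sigma_sets UNIV {K :: 'g set. compact K}"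
    by (intro sigma_sets_subset) auto
  then show "sets (borel :: 'g measure) \<subseteq> sigma_sets UNIV {K. compact K}"
    unfolding borel_eq_closed by simp
qed

text \<open>The indicator of a compact set \<open>K\<close> is the decreasing limit of the functions
  \<open>max 0 (1 - n * distance_to K x)\<close>, which have compact support, and the compact sets
  generate the Borel sets.\<close>

lemma radon_measure_eqI:
  assumes \<mu>: "radon_measure \<mu>" and \<mu>': "radon_measure \<mu>'"
    and eq: "\<And>f :: 'g \<Rightarrow> complex. compactly_supported f \<Longrightarrow> (\<integral>x. f x \<partial>\<mu>) = (\<integral>x. f x \<partial>\<mu>')"
  shows "\<mu> = \<mu>'"
proof -
  have eq_real: "(\<integral>x. f x \<partial>\<mu>) = (\<integral>x. f x \<partial>\<mu>')" if "compactly_supported f" for f :: "'g \<Rightarrow> real"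
  proof -
    have "compactly_supported (\<lambda>x. complex_of_real (f x))"
      by (rule compactly_supported_compose[OF that]) (auto intro: continuous_intros)
    from eq[OF this] show ?thesis by simp
  qed
  have compact_eq: "emeasure \<mu> K = emeasure \<mu>' K" if K: "compact K" for K
  proof (cases "K = {}")
    case False
    define f where "f = (\<lambda>n x. max 0 (1 - real (Suc n) * distance_to K x))"
    obtain R where R: "K \<subseteq> {y. d 0 y \<le> R}" using compact_bounded[OF K] by blast
    have dK: "d 0 x \<le> R + 1" if "distance_to K x < 1" for x
    proof -
      have "\<exists>k\<in>K. d x k < 1"
        using that False unfolding distance_to_def by (subst (asm) cINF_less_iff) (auto intro: bdd_belowI[of _ 0])
      then obtain k where "k \<in> K" "d x k < 1" by blast
      then show ?thesis using R triangle[of 0 k x] commute[of k x] by force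
    qed
    have cd: "continuous_on UNIV (distance_to K)"
    proof (rule continuous_onI_dist)
      fix x and \<epsilon> :: real assume "\<epsilon> > 0"
      then show "\<exists>\<delta>>0. \<forall>y. d x y < \<delta> \<longrightarrow> norm (distance_to K y - distance_to K x) < \<epsilon>"
        using distance_to_lipschitz[OF False] commute by (intro exI[of _ \<epsilon>]) (metis le_less_trans real_norm_def)
    qed
    have f: "compactly_supported (f n)" for n
    proof (rule compactly_supportedI)
      show "continuous_on UNIV (f n)" unfolding f_def by (intro continuous_intros cd)
      fix x assume "f n x \<noteq> 0"
      then have "real (Suc n) * distance_to K x < 1" unfolding f_def by (auto simp: max_def split: if_splits)
      moreover have "1 * distance_to K x \<le> real (Suc n) * distance_to K x"
        by (intro mult_right_mono distance_to_nonneg False) simp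
      ultimately show "d 0 x \<le> R + 1" by (intro dK) simp
    qed
    have lim: "(\<lambda>n. f n x) \<longlonglongrightarrow> indicat_real K x" for x
    proof (cases "x \<in> K")
      case True
      then have "f n x = 1" for n unfolding f_def by (simp add: distance_to_mem)
      then show ?thesis using True by simp
    next
      case xK: False
      have pos: "distance_to K x > 0" by (rule distance_to_pos[OF compact_imp_closed[OF K] False xK])
      obtain N :: nat where N: "1 / distance_to K x < real N" using reals_Archimedean2 by blast
      have "f n x = 0" if "n \<ge> N" for n
      proof -
        have "1 < real N * distance_to K x" using N pos by (simp add: field_simps)
        also have "\<dots> \<le> real (Suc n) * distance_to K x" using that pos by (intro mult_right_mono) auto
        finally show ?thesis unfolding f_def by simp
      qed
      then have "eventually (\<lambda>n. f n x = 0) sequentially" by (auto simp: eventually_sequentially)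
      then show ?thesis using xK by (simp add: tendsto_eventually)
    qed
    have meas: "measure \<theta> K = lim (\<lambda>n. \<integral>x. f n x \<partial>\<theta>)" if \<theta>: "radon_measure \<theta>" for \<theta>
    proof -
      note [measurable_cong] = radon_measureD(1)[OF \<theta>]
      have Km: "K \<in> sets \<theta>" using compact_imp_closed[OF K] radon_measureD(1)[OF \<theta>] by auto
      have "(\<lambda>n. \<integral>x. f n x \<partial>\<theta>) \<longlonglongrightarrow> (\<integral>x. indicat_real K x \<partial>\<theta>)"
      proof (rule integral_dominated_convergence[where w = "f 0"])
        show "integrable \<theta> (f 0)" by (rule integrable_compactly_supported[OF \<theta> f])
        show "f n \<in> borel_measurable \<theta>" for n
          using integrable_compactly_supported[OF \<theta> f] by (rule borel_measurable_integrable)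
        show "indicat_real K \<in> borel_measurable \<theta>" using Km by simp
        show "AE x in \<theta>. (\<lambda>n. f n x) \<longlonglongrightarrow> indicat_real K x" using lim by simp
        have "norm (f n x) \<le> f 0 x" for n x
        proof -
          have "1 * distance_to K x \<le> real (Suc n) * distance_to K x"
            by (intro mult_right_mono distance_to_nonneg False) simp
          then show ?thesis unfolding f_def by simp
        qed
        then show "AE x in \<theta>. norm (f n x) \<le> f 0 x" for n by simp
      qed
      also have "(\<integral>x. indicat_real K x \<partial>\<theta>) = measure \<theta> K"
        using Km sets_eq_imp_space_eq[OF radon_measureD(1)[OF \<theta>]] by simp
      finally show ?thesis by (simp add: limI)
    qed
    have "measure \<mu> K = measure \<mu>' K" unfolding meas[OF \<mu>] meas[OF \<mu>'] using eq_real[OF f] by simp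
    moreover have "emeasure \<mu> K \<noteq> \<infinity>" "emeasure \<mu>' K \<noteq> \<infinity>"
      using \<mu> \<mu>' K unfolding radon_measure_def by (metis less_irrefl)+
    ultimately show ?thesis by (simp add: emeasure_eq_ennreal_measure)
  qed simp
  show ?thesis
  proof (rule measure_eqI_generator_eq[where \<Omega> = UNIV and E = "{K. compact K}" and A = "\<lambda>n. {y. d 0 y \<le> real n}"])
    show "Int_stable {K :: 'g set. compact K}" by (auto simp: Int_stable_def compact_Int)
    show "(\<Union>n::nat. {y. d 0 y \<le> real n}) = UNIV" using real_arch_simple by blast
    show "emeasure \<mu> {y. d 0 y \<le> real i} \<noteq> \<infinity>" for i
      using radon_measureD(2)[OF \<mu>, of 0 "real i"] by simp
  qed (use compact_eq compact_closed_ball radon_measureD(1)[OF \<mu>] radon_measureD(1)[OF \<mu>'] sets_borel_eq_compact in auto)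
qed

end

context haar_group
begin

lemma integrable_conv:
  fixes f h :: "'g \<Rightarrow> complex"
  assumes "compactly_supported f" "compactly_supported h"
  shows "integrable m (\<lambda>r. f r * h (- r + g))"
proof (rule integrable_compactly_supported[OF radon_m])
  have "continuous_on UNIV h" using assms(2) unfolding compactly_supported_def by blast
  then have "continuous_on UNIV (\<lambda>r. h (- r + g))"
    by (rule continuous_on_compose2) (auto intro!: continuous_intros)
  then show "compactly_supported (\<lambda>r. f r * h (- r + g))" by (rule compactly_supported_times[OF assms(1)])
qed

lemma compactly_supported_conv:
  assumes f: "compactly_supported f" and h: "compactly_supported h"
  shows "compactly_supported (conv m f h)"
    "\<lbrakk>\<And>x. f x \<noteq> 0 \<Longrightarrow> d 0 x \<le> R; \<And>x. h x \<noteq> 0 \<Longrightarrow> d 0 x \<le> S; conv m f h g \<noteq> 0\<rbrakk> \<Longrightarrow> d 0 g \<le> R + S"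
proof -
  have supp: "d 0 g \<le> R + S"
    if RS: "\<And>x. f x \<noteq> 0 \<Longrightarrow> d 0 x \<le> R" "\<And>x. h x \<noteq> 0 \<Longrightarrow> d 0 x \<le> S" and g: "conv m f h g \<noteq> 0" for R S g
  proof (rule ccontr)
    assume n: "\<not> d 0 g \<le> R + S"
    have "f r * h (- r + g) = 0" for r
      using n RS(1)[of r] RS(2)[of "- r + g"] triangle[of 0 r g] dist_eq[of r g] by force
    then have "conv m f h g = (\<integral>r. 0 \<partial>m)" unfolding conv_def by (intro Bochner_Integration.integral_cong refl)
    then show False using g by simp
  qed
  then show "\<lbrakk>\<And>x. f x \<noteq> 0 \<Longrightarrow> d 0 x \<le> R; \<And>x. h x \<noteq> 0 \<Longrightarrow> d 0 x \<le> S; conv m f h g \<noteq> 0\<rbrakk> \<Longrightarrow> d 0 g \<le> R + S" .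
  have "continuous_on UNIV (conv m f h)"
  proof (rule continuous_onI_dist)
    fix x and \<epsilon> :: real assume e: "\<epsilon> > 0"
    define J where "J = (\<integral>r. norm (f r) \<partial>m)"
    have J: "J \<ge> 0" unfolding J_def by simp
    have intf: "integrable m (\<lambda>r. norm (f r))" using integrable_compactly_supported[OF radon_m f] by simp
    obtain \<delta> where \<delta>: "\<delta> > 0" "\<And>x y. d x y < \<delta> \<Longrightarrow> norm (h x - h y) < \<epsilon> / (J + 1)"
      using uniformly_continuous_supported[OF h, of "\<epsilon> / (J + 1)"] e J by auto
    have "norm (conv m f h y - conv m f h x) < \<epsilon>" if xy: "d x y < \<delta>" for y
    proof -
      have "conv m f h y - conv m f h x = (\<integral>r. f r * h (- r + y) - f r * h (- r + x) \<partial>m)"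
        unfolding conv_def using integrable_conv[OF f h] by simp
      also have "norm \<dots> \<le> (\<integral>r. norm (f r * h (- r + y) - f r * h (- r + x)) \<partial>m)"
        by (rule integral_norm_bound)
      also have "\<dots> \<le> (\<integral>r. norm (f r) * (\<epsilon> / (J + 1)) \<partial>m)"
      proof (rule integral_mono)
        show "integrable m (\<lambda>r. norm (f r * h (- r + y) - f r * h (- r + x)))"
          using integrable_conv[OF f h] by (intro integrable_norm) simp
        show "integrable m (\<lambda>r. norm (f r) * (\<epsilon> / (J + 1)))" using intf by simp
        fix r
        have "norm (h (- r + y) - h (- r + x)) \<le> \<epsilon> / (J + 1)"
          using \<delta>(2)[of "- r + y" "- r + x"] xy dist_translate[of "- r" y x] commute[of x y] by simp
        then show "norm (f r * h (- r + y) - f r * h (- r + x)) \<le> norm (f r) * (\<epsilon> / (J + 1))"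
          unfolding right_diff_distrib[symmetric] norm_mult by (rule mult_left_mono) simp
      qed
      also have "\<dots> = J * (\<epsilon> / (J + 1))" using intf unfolding J_def by simp
      also have "\<dots> < \<epsilon>" using e J by (simp add: field_simps)
      finally show ?thesis .
    qed
    then show "\<exists>\<delta>>0. \<forall>y. d x y < \<delta> \<longrightarrow> norm (conv m f h y - conv m f h x) < \<epsilon>" using \<delta>(1) by blast
  qed
  moreover obtain R where "\<And>x. f x \<noteq> 0 \<Longrightarrow> d 0 x \<le> R" using f unfolding compactly_supported_def by blast
  moreover obtain S where "\<And>x. h x \<noteq> 0 \<Longrightarrow> d 0 x \<le> S" using h unfolding compactly_supported_def by blast
  ultimately show "compactly_supported (conv m f h)" using supp by (intro compactly_supportedI[of _ "R + S"]) auto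
qed

lemma conv_expand:
  assumes f: "compactly_supported f" and h: "compactly_supported h"
  shows "conv m (star (\<lambda>x. f x + u * h x)) (\<lambda>x. f x + u * h x) g =
    conv m (star f) f g + u * conv m (star f) h g + cnj u * conv m (star h) f g + (cnj u * u) * conv m (star h) h g"
proof -
  note i = integrable_conv[OF compactly_supported_star[OF f] f, of g] integrable_conv[OF compactly_supported_star[OF f] h, of g]
    integrable_conv[OF compactly_supported_star[OF h] f, of g] integrable_conv[OF compactly_supported_star[OF h] h, of g]
  have "conv m (star (\<lambda>x. f x + u * h x)) (\<lambda>x. f x + u * h x) g =
      (\<integral>r. star f r * f (- r + g) + u * (star f r * h (- r + g)) + cnj u * (star h r * f (- r + g))
         + (cnj u * u) * (star h r * h (- r + g)) \<partial>m)"
    unfolding conv_def by (intro Bochner_Integration.integral_cong refl) (simp add: star_def algebra_simps)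
  also have "\<dots> = conv m (star f) f g + u * conv m (star f) h g + cnj u * conv m (star h) f g + (cnj u * u) * conv m (star h) h g"
    unfolding conv_def using i by (simp del: complex_cnj_mult)
  finally show ?thesis .
qed

text \<open>Expanding the squares of \<open>f + h\<close> and \<open>f + \<i> h\<close> leaves the
  two mixed terms, with different signs in the second case; the combination isolates the one with
  \<open>f\<close> in front.\<close>

lemma polarization:
  assumes \<mu>: "radon_measure \<mu>" and f: "compactly_supported f" and h: "compactly_supported h"
  defines "Q \<equiv> \<lambda>k. \<integral>x. conv m (star k) k x \<partial>\<mu>"
  shows "2 * (\<integral>x. conv m (star f) h x \<partial>\<mu>) =
    (Q (\<lambda>x. f x + 1 * h x) - Q f - Q h) - \<i> * (Q (\<lambda>x. f x + \<i> * h x) - Q f - Q h)"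
proof -
  define S where "S = (\<lambda>f h. \<integral>x. conv m (star f) h x \<partial>\<mu>)"
  have i: "integrable \<mu> (conv m (star f) h)" if "compactly_supported f" "compactly_supported h" for f h
    using that by (intro integrable_compactly_supported[OF \<mu>] compactly_supported_conv compactly_supported_star)
  note ii = i[OF f f] i[OF f h] i[OF h f] i[OF h h]
  have "Q (\<lambda>x. f x + u * h x) = Q f + u * S f h + cnj u * S h f + (cnj u * u) * Q h" for u
    unfolding Q_def S_def conv_expand[OF f h] using ii by (simp del: complex_cnj_mult)
  from this[of 1] this[of \<i>]
  have "Q (\<lambda>x. f x + 1 * h x) - Q f - Q h = S f h + S h f"
    "Q (\<lambda>x. f x + \<i> * h x) - Q f - Q h = \<i> * (S f h - S h f)"
    by (simp_all add: algebra_simps)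
  then have "2 * S f h = (Q (\<lambda>x. f x + 1 * h x) - Q f - Q h) - \<i> * (Q (\<lambda>x. f x + \<i> * h x) - Q f - Q h)"
    by (simp only:) (simp add: algebra_simps)
  then show ?thesis unfolding S_def .
qed

text \<open>With the bump in the second factor, \<open>conv m f k g\<close> averages the values
  \<open>f (g + r)\<close> over small \<open>r\<close>; these are uniformly close to
  \<open>f g\<close>, because \<open>d\<close> is left invariant.\<close>

lemma conv_approximation:
  assumes f: "compactly_supported f" and e: "\<epsilon> > 0" and supp: "\<And>x. f x \<noteq> 0 \<Longrightarrow> d 0 x \<le> R"
  shows "\<exists>k. compactly_supported k \<and> (\<forall>g. norm (conv m f k g - f g) \<le> \<epsilon>) \<and> (\<forall>g. conv m f k g \<noteq> 0 \<longrightarrow> d 0 g \<le> R + 1)"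
proof -
  obtain \<delta>0 where \<delta>0: "\<delta>0 > 0" "\<And>x y. d x y < \<delta>0 \<Longrightarrow> norm (f x - f y) < \<epsilon>"
    using uniformly_continuous_supported[OF f e] by blast
  define \<delta> where "\<delta> = min \<delta>0 1"
  have \<delta>: "\<delta> > 0" "\<delta> \<le> \<delta>0" "\<delta> \<le> 1" using \<delta>0(1) by (auto simp: \<delta>_def)
  define \<kappa> where "\<kappa> = reflected_integral (bump \<delta>)"
  have \<kappa>: "\<kappa> > 0" unfolding \<kappa>_def by (rule reflected_integral_bump_pos[OF \<delta>(1)])
  define b where "b = (\<lambda>x. bump \<delta> x / \<kappa>)"
  have b0: "b x \<ge> 0" for x using bump(1)[of \<delta> x] \<kappa> by (simp add: b_def)
  have b_supp: "d 0 x < \<delta>" if "b x \<noteq> 0" for x using bump(2)[of \<delta> x] that by (auto simp: b_def)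
  have cb: "compactly_supported b" unfolding b_def
    by (rule compactly_supported_compose[OF compactly_supported_bump]) (use \<kappa> in \<open>auto intro!: continuous_intros\<close>)
  have int_b: "(\<integral>r. b (- r) \<partial>m) = 1"
    using \<kappa> unfolding b_def \<kappa>_def reflected_integral_def by simp
  define k where "k = (\<lambda>x. complex_of_real (b x))"
  have k: "compactly_supported k" unfolding k_def
    by (rule compactly_supported_compose[OF cb]) (auto intro: continuous_intros)
  have cf: "continuous_on UNIV f" using f unfolding compactly_supported_def by blast
  have "norm (conv m f k g - f g) \<le> \<epsilon>" for g
  proof -
    have ck: "compactly_supported (\<lambda>r. k (- r))" by (rule compactly_supported_minus[OF k])
    have cfg: "continuous_on UNIV (\<lambda>r. f (g + r))"
      by (rule continuous_on_compose2[OF cf]) (auto intro!: continuous_intros)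
    have i1: "integrable m (\<lambda>r. k (- r) * f (g + r))"
      by (rule integrable_compactly_supported[OF radon_m compactly_supported_times[OF ck cfg]])
    have i2: "integrable m (\<lambda>r. k (- r) * f g)"
      by (rule integrable_compactly_supported[OF radon_m compactly_supported_times[OF ck]]) simp
    have ib: "integrable m (\<lambda>r. b (- r))"
      by (rule integrable_compactly_supported[OF radon_m compactly_supported_minus[OF cb]])
    have "continuous_on UNIV k" using k unfolding compactly_supported_def by blast
    then have "continuous_on UNIV (\<lambda>r. k (- r + g))"
      by (rule continuous_on_compose2) (auto intro!: continuous_intros)
    then have ckg: "continuous_on UNIV (\<lambda>r. f r * k (- r + g))" by (rule continuous_on_mult[OF cf])
    have "conv m f k g = (\<integral>r. f (g + r) * k (- (g + r) + g) \<partial>m)"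
      unfolding conv_def
      by (rule integral_left[OF borel_measurable_continuous_onI[OF ckg], symmetric])
    also have "\<dots> = (\<integral>r. k (- r) * f (g + r) \<partial>m)"
      by (simp add: minus_add add.assoc mult.commute del: add_uminus_conv_diff)
    finally have c1: "conv m f k g = (\<integral>r. k (- r) * f (g + r) \<partial>m)" .
    have c2: "f g = (\<integral>r. k (- r) * f g \<partial>m)"
      using int_b ib by (simp add: k_def)
    have "conv m f k g - f g = (\<integral>r. k (- r) * f (g + r) \<partial>m) - (\<integral>r. k (- r) * f g \<partial>m)"
      by (rule arg_cong2[OF c1 c2])
    also have "\<dots> = (\<integral>r. k (- r) * f (g + r) - k (- r) * f g \<partial>m)"
      using i1 i2 by (rule Bochner_Integration.integral_diff[symmetric])
    finally have "conv m f k g - f g = (\<integral>r. k (- r) * f (g + r) - k (- r) * f g \<partial>m)" .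
    then have "norm (conv m f k g - f g) = norm (\<integral>r. k (- r) * f (g + r) - k (- r) * f g \<partial>m)"
      by (rule arg_cong)
    also have "\<dots> \<le> (\<integral>r. norm (k (- r) * f (g + r) - k (- r) * f g) \<partial>m)" by (rule integral_norm_bound)
    also have "\<dots> \<le> (\<integral>r. b (- r) * \<epsilon> \<partial>m)"
    proof (rule integral_mono)
      show "integrable m (\<lambda>r. norm (k (- r) * f (g + r) - k (- r) * f g))" using i1 i2 by simp
      show "integrable m (\<lambda>r. b (- r) * \<epsilon>)" using ib by simp
      fix r
      show "norm (k (- r) * f (g + r) - k (- r) * f g) \<le> b (- r) * \<epsilon>"
      proof (cases "b (- r) = 0")
        case False
        have "d (g + r) g < \<delta>0"
          using b_supp[OF False] \<delta>(2) dist_translate[of g r 0] commute[of r 0] dist_zero_minus[of r] by simp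
        then have "norm (f (g + r) - f g) \<le> \<epsilon>" using \<delta>0(2) less_imp_le by blast
        then show ?thesis unfolding right_diff_distrib[symmetric] norm_mult
          using b0[of "- r"] by (simp add: k_def mult_left_mono)
      qed (simp add: k_def)
    qed
    also have "\<dots> = \<epsilon>" using int_b by simp
    finally show ?thesis .
  qed
  moreover have "d 0 g \<le> R + 1" if "conv m f k g \<noteq> 0" for g
  proof (rule compactly_supported_conv(2)[OF f k supp _ that])
    show "d 0 x \<le> 1" if "k x \<noteq> 0" for x using b_supp[of x] that \<delta>(3) by (simp add: k_def)
  qed
  ultimately show ?thesis using k by blast
qed

text \<open>By polarization the squares determine the integrals of all convolutions, and convolutions
  with bumps approximate every continuous function of compact support uniformly, with supports in a fixed
  ball.\<close>

theorem radon_measure_determined_by_squares: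
  assumes \<mu>: "radon_measure \<mu>" and \<mu>': "radon_measure \<mu>'"
    and sq: "\<And>f. compactly_supported f \<Longrightarrow> (\<integral>x. conv m (star f) f x \<partial>\<mu>) = (\<integral>x. conv m (star f) f x \<partial>\<mu>')"
  shows "\<mu> = \<mu>'"
proof (rule radon_measure_eqI[OF \<mu> \<mu>'])
  fix f :: "'g \<Rightarrow> complex" assume f: "compactly_supported f"
  have prod: "(\<integral>x. conv m (star f) h x \<partial>\<mu>) = (\<integral>x. conv m (star f) h x \<partial>\<mu>')"
    if f: "compactly_supported f" and h: "compactly_supported h" for f h
  proof -
    have c: "compactly_supported (\<lambda>x. f x + u * h x)" for u
      by (intro compactly_supported_add compactly_supported_scale f h)
    have "2 * (\<integral>x. conv m (star f) h x \<partial>\<mu>) = 2 * (\<integral>x. conv m (star f) h x \<partial>\<mu>')"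
      unfolding polarization[OF \<mu> f h] polarization[OF \<mu>' f h] sq[OF c] sq[OF f] sq[OF h] ..
    then show ?thesis by simp
  qed
  obtain R where R: "\<And>x. f x \<noteq> 0 \<Longrightarrow> d 0 x \<le> R" using f unfolding compactly_supported_def by blast
  let ?D = "{y. d 0 y \<le> R + 1}"
  define M where "M = measure \<mu> ?D + measure \<mu>' ?D"
  have M: "M \<ge> 0" unfolding M_def by simp
  have approx: "norm ((\<integral>x. conv m f k x \<partial>\<theta>) - (\<integral>x. f x \<partial>\<theta>)) \<le> \<epsilon> * measure \<theta> ?D"
    if \<theta>: "radon_measure \<theta>" and k: "compactly_supported k" "\<And>g. norm (conv m f k g - f g) \<le> \<epsilon>"
      "\<And>g. conv m f k g \<noteq> 0 \<Longrightarrow> d 0 g \<le> R + 1" for \<theta> k \<epsilon>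
  proof -
    have i: "integrable \<theta> (conv m f k)" "integrable \<theta> f"
      using integrable_compactly_supported[OF \<theta>] compactly_supported_conv(1)[OF f k(1)] f by auto
    have D: "?D \<in> sets \<theta>" "emeasure \<theta> ?D < \<infinity>"
      using closed_ball_in_sets radon_measureD[OF \<theta>] by auto
    have sp: "space \<theta> = UNIV" using sets_eq_imp_space_eq[OF radon_measureD(1)[OF \<theta>]] by simp
    have "(\<integral>x. conv m f k x \<partial>\<theta>) - (\<integral>x. f x \<partial>\<theta>) = (\<integral>x. conv m f k x - f x \<partial>\<theta>)" using i by simp
    also have "norm \<dots> \<le> (\<integral>x. norm (conv m f k x - f x) \<partial>\<theta>)" by (rule integral_norm_bound)
    also have "\<dots> \<le> (\<integral>x. \<epsilon> * indicat_real ?D x \<partial>\<theta>)"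
    proof (rule integral_mono)
      show "integrable \<theta> (\<lambda>x. norm (conv m f k x - f x))" using i by simp
      show "integrable \<theta> (\<lambda>x. \<epsilon> * indicat_real ?D x)" using D by simp
      fix x
      show "norm (conv m f k x - f x) \<le> \<epsilon> * indicat_real ?D x"
      proof (cases "x \<in> ?D")
        case False
        then have "conv m f k x = 0" "f x = 0" using k(3)[of x] R[of x] by auto
        then show ?thesis using False by simp
      qed (use k(2) in simp)
    qed
    also have "\<dots> = \<epsilon> * measure \<theta> ?D" using D sp by simp
    finally show ?thesis .
  qed
  have "norm ((\<integral>x. f x \<partial>\<mu>) - (\<integral>x. f x \<partial>\<mu>')) \<le> 0"
  proof (rule field_le_epsilon)
    fix \<eta> :: real assume \<eta>: "\<eta> > 0"
    define \<epsilon> where "\<epsilon> = \<eta> / (M + 1)"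
    have e: "\<epsilon> > 0" unfolding \<epsilon>_def using \<eta> M by simp
    from conv_approximation[OF f e R] obtain k where k: "compactly_supported k"
      "\<And>g. norm (conv m f k g - f g) \<le> \<epsilon>" "\<And>g. conv m f k g \<noteq> 0 \<Longrightarrow> d 0 g \<le> R + 1" by metis
    have "star (star f) = f" by (simp add: star_def fun_eq_iff)
    then have same: "(\<integral>x. conv m f k x \<partial>\<mu>) = (\<integral>x. conv m f k x \<partial>\<mu>')"
      using prod[OF compactly_supported_star[OF f] k(1)] by simp
    have "norm ((\<integral>x. f x \<partial>\<mu>) - (\<integral>x. f x \<partial>\<mu>')) \<le>
        norm ((\<integral>x. conv m f k x \<partial>\<mu>) - (\<integral>x. f x \<partial>\<mu>)) + norm ((\<integral>x. conv m f k x \<partial>\<mu>') - (\<integral>x. f x \<partial>\<mu>'))"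
      using norm_triangle_ineq4[of "(\<integral>x. conv m f k x \<partial>\<mu>') - (\<integral>x. f x \<partial>\<mu>')" "(\<integral>x. conv m f k x \<partial>\<mu>) - (\<integral>x. f x \<partial>\<mu>)"]
      unfolding same by simp
    also have "\<dots> \<le> \<epsilon> * measure \<mu> ?D + \<epsilon> * measure \<mu>' ?D"
      by (intro add_mono approx \<mu> \<mu>' k)
    also have "\<dots> = \<epsilon> * M" unfolding M_def by (simp add: algebra_simps)
    also have "\<dots> \<le> 0 + \<eta>" unfolding \<epsilon>_def using M \<eta> by (simp add: field_simps)
    finally show "norm ((\<integral>x. f x \<partial>\<mu>) - (\<integral>x. f x \<partial>\<mu>')) \<le> 0 + \<eta>" .
  qed
  then show "(\<integral>x. f x \<partial>\<mu>) = (\<integral>x. f x \<partial>\<mu>')" by simp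
qed

end

section \<open>The auto-correlation as a sum of point masses\<close>

lemma infsum_finite_support:
  fixes h :: "'g \<Rightarrow> 'b::{comm_monoid_add, t2_space, topological_space}"
  assumes "finite A" "A \<subseteq> P" "\<And>x. x \<in> P \<Longrightarrow> h x \<noteq> 0 \<Longrightarrow> x \<in> A"
  shows "(\<Sum>\<^sub>\<infinity>x\<in>P. h x) = (\<Sum>x\<in>A. h x)"
proof -
  have "(\<Sum>\<^sub>\<infinity>x\<in>P. h x) = (\<Sum>\<^sub>\<infinity>x\<in>A. h x)"
    using assms by (intro infsum_cong_neutral) auto
  then show ?thesis using assms(1) by simp
qed

context uniquely_ergodic_hull
begin

text \<open>The explicit form of the auto-correlation: the point \<open>z\<close> carries the density of
  the pairs of points of \<open>P\<^sub>0\<close> with difference \<open>z\<close>. Finite local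
  complexity makes this locally a finite sum.\<close>

definition difference_measure :: "'g measure" where
  "difference_measure = distr (density (count_space differences) (\<lambda>z. ennreal (pair_density z))) borel (\<lambda>z. z)"

lemma sets_difference_measure: "sets difference_measure = sets borel"
  unfolding difference_measure_def by simp

lemma integral_difference_measure:
  assumes f: "compactly_supported (f :: 'g \<Rightarrow> complex)" "\<And>x. f x \<noteq> 0 \<Longrightarrow> d 0 x \<le> R"
  shows "(\<integral>x. f x \<partial>difference_measure) = (\<Sum>z\<in>differences \<inter> {y. d 0 y \<le> R}. complex_of_real (pair_density z) * f z)"
proof -
  have fm: "f \<in> borel_measurable borel"
    using f(1) unfolding compactly_supported_def by (blast intro: borel_measurable_continuous_onI)
  have fin: "finite {z \<in> differences. pair_density z *\<^sub>R f z \<noteq> 0}"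
    by (rule finite_subset[OF _ finite_differences_bounded[of R]]) (use f(2) in auto)
  have "(\<integral>x. f x \<partial>difference_measure) = (\<integral>z. f z \<partial>density (count_space differences) (\<lambda>z. ennreal (pair_density z)))"
    unfolding difference_measure_def using fm by (subst integral_distr) auto
  also have "\<dots> = (\<integral>z. pair_density z *\<^sub>R f z \<partial>count_space differences)"
    by (rule integral_density) (auto simp: pair_density_nonneg)
  also have "\<dots> = (\<Sum>z | z \<in> differences \<and> pair_density z *\<^sub>R f z \<noteq> 0. pair_density z *\<^sub>R f z)"
    using fin by (rule lebesgue_integral_count_space_finite_support)
  also have "\<dots> = (\<Sum>z\<in>differences \<inter> {y. d 0 y \<le> R}. complex_of_real (pair_density z) * f z)"
    using f(2) finite_differences_bounded[of R]
    by (intro sum.mono_neutral_cong_left) (auto simp: scaleR_conv_of_real)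
  finally show ?thesis .
qed

lemma radon_difference_measure: "radon_measure difference_measure"
  unfolding radon_measure_def
proof (intro conjI allI impI sets_difference_measure)
  fix K :: "'g set" assume K: "compact K"
  obtain R where R: "K \<subseteq> {y. d 0 y \<le> R}" using compact_bounded[OF K] by blast
  have Km: "K \<in> sets borel" using compact_imp_closed[OF K] by (rule borel_closed)
  have "emeasure difference_measure K = (\<integral>\<^sup>+z. ennreal (pair_density z) * indicator (K \<inter> differences) z \<partial>count_space differences)"
    unfolding difference_measure_def using Km by (subst emeasure_distr) (auto simp: emeasure_density)
  also have "\<dots> = (\<Sum>z | z \<in> differences \<and> 0 < ennreal (pair_density z) * indicator (K \<inter> differences) z.
      ennreal (pair_density z) * indicator (K \<inter> differences) z)"
  proof (rule nn_integral_count_space)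
    show "finite {z \<in> differences. 0 < ennreal (pair_density z) * indicator (K \<inter> differences) z}"
      by (rule finite_subset[OF _ finite_differences_bounded[of R]]) (use R in \<open>auto simp: indicator_def split: if_splits\<close>)
  qed
  also have "\<dots> = ennreal (\<Sum>z | z \<in> differences \<and> 0 < ennreal (pair_density z) * indicator (K \<inter> differences) z.
      pair_density z * indicat_real (K \<inter> differences) z)"
    by (subst sum_ennreal[symmetric]) (auto simp: pair_density_nonneg indicator_def intro!: sum.cong)
  also have "\<dots> < \<infinity>" by simp
  finally show "emeasure difference_measure K < \<infinity>" .
qed

lemma periodization_eq:
  assumes P: "P \<in> \<Omega>" and f: "\<And>x. f x \<noteq> 0 \<Longrightarrow> d 0 x \<le> R"
  shows "periodization f P = (\<Sum>x\<in>P \<inter> {y. d 0 y \<le> R}. f x)"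
  unfolding periodization_def
  by (rule infsum_finite_support[OF finite_hull_bounded[OF P compact_closed_ball]]) (use f in auto)

lemma pair_function:
  assumes f: "compactly_supported (f :: 'g \<Rightarrow> complex)"
  shows "compactly_supported (\<lambda>x. cnj (f x) * f (x + z))"
proof (rule compactly_supported_times)
  show "compactly_supported (\<lambda>x. cnj (f x))"
    by (rule compactly_supported_compose[OF f]) (auto intro: continuous_intros)
  have "continuous_on UNIV f" using f unfolding compactly_supported_def by blast
  then show "continuous_on UNIV (\<lambda>x. f (x + z))"
    by (rule continuous_on_compose2) (auto intro!: continuous_intros)
qed

text \<open>Expanding the square of the sum over \<open>P\<close> and sorting the pairs by their
  difference.\<close>

lemma square_periodization:
  assumes P: "P \<in> \<Omega>" and f: "\<And>x. f x \<noteq> 0 \<Longrightarrow> d 0 x \<le> R"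
  shows "complex_of_real ((cmod (periodization f P))\<^sup>2) =
    (\<Sum>z\<in>differences \<inter> {y. d 0 y \<le> R + R}. point_sum (\<lambda>x. cnj (f x) * f (x + z)) (pair_points z P))"
proof -
  let ?A = "P \<inter> {y. d 0 y \<le> R}" and ?Z = "differences \<inter> {y. d 0 y \<le> R + R}"
  have A: "finite ?A" by (rule finite_hull_bounded[OF P compact_closed_ball])
  have Z: "finite ?Z" by (rule finite_differences_bounded)
  have inner: "(\<Sum>z\<in>{z\<in>?Z. x + z \<in> P}. f (x + z)) = (\<Sum>y\<in>?A. f y)" if x: "x \<in> ?A" for x
  proof -
    have "(\<Sum>z\<in>{z\<in>?Z. x + z \<in> P}. f (x + z)) = (\<Sum>y\<in>(+) x ` {z\<in>?Z. x + z \<in> P}. f y)"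
      by (rule sum.reindex[symmetric, unfolded o_def]) simp
    also have "\<dots> = (\<Sum>y\<in>?A. f y)"
    proof (rule sum.mono_neutral_right)
      show "finite ((+) x ` {z\<in>?Z. x + z \<in> P})" by (intro finite_imageI finite_subset[OF _ Z]) auto
      show "?A \<subseteq> (+) x ` {z\<in>?Z. x + z \<in> P}"
      proof
        fix y assume y: "y \<in> ?A"
        have "d 0 (- x + y) \<le> R + R"
          using x y triangle[of x 0 y] commute[of x 0] dist_eq[of x y] by simp
        then have "- x + y \<in> ?Z" using hull_differences[OF P, of x y] x y by auto
        then show "y \<in> (+) x ` {z\<in>?Z. x + z \<in> P}" using y by (intro image_eqI[of _ _ "- x + y"]) (auto simp: add.assoc[symmetric])
      qed
      show "\<forall>y\<in>(+) x ` {z\<in>?Z. x + z \<in> P} - ?A. f y = 0" using f by auto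
    qed
    finally show ?thesis .
  qed
  have "complex_of_real ((cmod (periodization f P))\<^sup>2) = cnj (periodization f P) * periodization f P"
    by (metis complex_norm_square mult.commute of_real_power)
  also have "\<dots> = cnj (\<Sum>x\<in>?A. f x) * (\<Sum>y\<in>?A. f y)"
    using periodization_eq[OF P, of f R] f by simp
  also have "\<dots> = (\<Sum>x\<in>?A. cnj (f x) * (\<Sum>y\<in>?A. f y))"
    by (simp add: sum_distrib_right cnj_sum)
  also have "\<dots> = (\<Sum>x\<in>?A. cnj (f x) * (\<Sum>z\<in>{z\<in>?Z. x + z \<in> P}. f (x + z)))"
    using inner by (intro sum.cong) auto
  also have "\<dots> = (\<Sum>x\<in>?A. \<Sum>z\<in>?Z. if x + z \<in> P then cnj (f x) * f (x + z) else 0)"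
    unfolding sum_distrib_left sum.inter_filter[OF Z] by (intro sum.cong refl) simp
  also have "\<dots> = (\<Sum>z\<in>?Z. \<Sum>x\<in>?A. if x + z \<in> P then cnj (f x) * f (x + z) else 0)"
    by (rule sum.swap)
  also have "\<dots> = (\<Sum>z\<in>?Z. point_sum (\<lambda>x. cnj (f x) * f (x + z)) (pair_points z P))"
  proof (rule sum.cong[OF refl])
    fix z
    have "d 0 x \<le> R" if "cnj (f x) * f (x + z) \<noteq> 0" for x using f[of x] that by auto
    then have "point_sum (\<lambda>x. cnj (f x) * f (x + z)) (pair_points z P)
        = (\<Sum>x\<in>pair_points z P \<inter> {y. d 0 y \<le> R}. cnj (f x) * f (x + z))"
      by (rule point_sum_hull(2)[OF P])
    also have "pair_points z P \<inter> {y. d 0 y \<le> R} = {x\<in>?A. x + z \<in> P}" by (auto simp: pair_points_def)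
    also have "(\<Sum>x\<in>{x\<in>?A. x + z \<in> P}. cnj (f x) * f (x + z)) = (\<Sum>x\<in>?A. if x + z \<in> P then cnj (f x) * f (x + z) else 0)"
      by (rule sum.inter_filter[OF A])
    finally show "(\<Sum>x\<in>?A. if x + z \<in> P then cnj (f x) * f (x + z) else 0) =
      point_sum (\<lambda>x. cnj (f x) * f (x + z)) (pair_points z P)" by simp
  qed
  finally show ?thesis .
qed

text \<open>At the point \<open>z\<close> the convolution \<open>conv m (star f) f\<close> is the
  reflected integral of \<open>\<lambda>x. cnj (f x) * f (x + z)\<close>, to which the Campbell
  formula applies; summing over \<open>z\<close> yields the square of the periodization.\<close>

theorem difference_measure_squares:
  assumes f: "compactly_supported f"
  shows "(\<integral>x. conv m (star f) f x \<partial>difference_measure) =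
    complex_of_real (\<integral>P. (cmod (periodization f P))\<^sup>2 \<partial>\<nu>)"
proof -
  obtain R where R: "\<And>x. f x \<noteq> 0 \<Longrightarrow> d 0 x \<le> R" using f unfolding compactly_supported_def by blast
  have R': "d 0 x \<le> R" if "star f x \<noteq> 0" for x using R[of "- x"] that dist_zero_minus[of x] by (simp add: star_def)
  let ?Z = "differences \<inter> {y. d 0 y \<le> R + R}" and ?h = "\<lambda>z x. cnj (f x) * f (x + z)"
  have conv_eq: "conv m (star f) f z = reflected_integral (?h z)" for z
    unfolding conv_def reflected_integral_def star_def ..
  have "(\<integral>x. conv m (star f) f x \<partial>difference_measure) = (\<Sum>z\<in>?Z. complex_of_real (pair_density z) * conv m (star f) f z)"
    using compactly_supported_conv[OF compactly_supported_star[OF f] f] R R' by (intro integral_difference_measure) blast+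
  also have "\<dots> = (\<Sum>z\<in>?Z. campbell z (?h z))"
    unfolding conv_eq campbell_formula[OF pair_function[OF f]] ..
  also have "\<dots> = (\<integral>P. (\<Sum>z\<in>?Z. point_sum (?h z) (pair_points z P)) \<partial>\<nu>)"
    unfolding campbell_def
    by (rule Bochner_Integration.integral_sum[symmetric]) (rule integrable_nu[OF continuous_pair_sum'[OF pair_function[OF f]]])
  also have "\<dots> = (\<integral>P. complex_of_real ((cmod (periodization f P))\<^sup>2) \<partial>\<nu>)"
    by (intro Bochner_Integration.integral_cong refl square_periodization[OF _ R, symmetric])
       (auto simp: space_nu hull1_subset)
  also have "\<dots> = complex_of_real (\<integral>P. (cmod (periodization f P))\<^sup>2 \<partial>\<nu>)" by (rule integral_complex_of_real)
  finally show ?thesis .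
qed

theorem autocorrelation_eq_difference_measure: "autocorrelation m P\<^sub>0 = difference_measure"
  unfolding autocorrelation_def
proof (rule the_equality)
  have "(\<integral>x. conv m (star f) f x \<partial>difference_measure) \<in> \<real>\<^sub>\<ge>\<^sub>0" if "f \<in> Cc" for f
    using difference_measure_squares[of f] that by (simp add: compactly_supported_Cc)
  then show "radon_measure difference_measure \<and> positive_definite m difference_measure \<and>
     (\<forall>f\<in>Cc. (\<integral>x. conv m (star f) f x \<partial>difference_measure) = complex_of_real (\<integral>P. (cmod (periodization f P))\<^sup>2 \<partial>\<nu>))"
    using radon_difference_measure difference_measure_squares unfolding positive_definite_def by (simp add: compactly_supported_Cc)
  show "\<eta> = difference_measure" if \<eta>: "radon_measure \<eta> \<and> positive_definite m \<eta> \<and>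
     (\<forall>f\<in>Cc. (\<integral>x. conv m (star f) f x \<partial>\<eta>) = complex_of_real (\<integral>P. (cmod (periodization f P))\<^sup>2 \<partial>\<nu>))" for \<eta>
    using \<eta> difference_measure_squares
    by (intro radon_measure_determined_by_squares radon_difference_measure) (auto simp: compactly_supported_Cc)
qed

text \<open>Sorted by the difference \<open>z = - x + y\<close>, the double sum becomes a finite
  combination of the frequencies of pairs, whose limits are the masses of the auto-correlation.\<close>

theorem autocorrelation_sampling:
  assumes f: "compactly_supported (f :: 'g \<Rightarrow> complex)"
  shows "((\<lambda>t. (\<Sum>x\<in>P\<^sub>0 \<inter> F t. \<Sum>\<^sub>\<infinity>y\<in>P\<^sub>0. f (- x + y)) / complex_of_real (measure m (F t)))
       \<longlongrightarrow> (\<integral>x. f x \<partial>autocorrelation m P\<^sub>0)) at_top"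
proof -
  obtain R where R: "\<And>x. f x \<noteq> 0 \<Longrightarrow> d 0 x \<le> R" using f unfolding compactly_supported_def by blast
  let ?Z = "differences \<inter> {y. d 0 y \<le> R}"
  have Z: "finite ?Z" by (rule finite_differences_bounded)
  have inner: "(\<Sum>\<^sub>\<infinity>y\<in>P\<^sub>0. f (- x + y)) = (\<Sum>z\<in>?Z. if x + z \<in> P\<^sub>0 then f z else 0)" if x: "x \<in> P\<^sub>0" for x
  proof -
    have "(\<Sum>\<^sub>\<infinity>y\<in>P\<^sub>0. f (- x + y)) = (\<Sum>y\<in>(+) x ` {z\<in>?Z. x + z \<in> P\<^sub>0}. f (- x + y))"
    proof (rule infsum_finite_support)
      show "y \<in> (+) x ` {z\<in>?Z. x + z \<in> P\<^sub>0}" if y: "y \<in> P\<^sub>0" "f (- x + y) \<noteq> 0" for y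
      proof -
        have "- x + y \<in> ?Z" using differencesI[OF x y(1)] R y(2) by auto
        then show ?thesis
          using y by (intro image_eqI[of _ _ "- x + y"]) (auto simp: add.assoc[symmetric])
      qed
      show "finite ((+) x ` {z\<in>?Z. x + z \<in> P\<^sub>0})" by (intro finite_imageI finite_subset[OF _ Z]) auto
    qed auto
    also have "\<dots> = (\<Sum>z\<in>{z\<in>?Z. x + z \<in> P\<^sub>0}. f z)"
      by (subst sum.reindex) (auto simp: add.assoc[symmetric])
    also have "\<dots> = (\<Sum>z\<in>?Z. if x + z \<in> P\<^sub>0 then f z else 0)" by (rule sum.inter_filter[OF Z])
    finally show ?thesis .
  qed
  have eq: "(\<Sum>z\<in>?Z. complex_of_real (pair_frequency z t) * f z) =
      (\<Sum>x\<in>P\<^sub>0 \<inter> F t. \<Sum>\<^sub>\<infinity>y\<in>P\<^sub>0. f (- x + y)) / complex_of_real (measure m (F t))" if t: "t > 0" for t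
  proof -
    have fin: "finite (P\<^sub>0 \<inter> F t)" by (rule finite_hull_bounded[OF P0_in_hull compact_F[OF t]])
    have "(\<Sum>x\<in>P\<^sub>0 \<inter> F t. \<Sum>\<^sub>\<infinity>y\<in>P\<^sub>0. f (- x + y)) = (\<Sum>x\<in>P\<^sub>0 \<inter> F t. \<Sum>z\<in>?Z. if x + z \<in> P\<^sub>0 then f z else 0)"
      using inner by (intro sum.cong) auto
    also have "\<dots> = (\<Sum>z\<in>?Z. \<Sum>x\<in>P\<^sub>0 \<inter> F t. if x + z \<in> P\<^sub>0 then f z else 0)" by (rule sum.swap)
    also have "\<dots> = (\<Sum>z\<in>?Z. of_nat (card (pair_points z P\<^sub>0 \<inter> F t)) * f z)"
    proof (rule sum.cong[OF refl])
      fix z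
      have "(\<Sum>x\<in>P\<^sub>0 \<inter> F t. if x + z \<in> P\<^sub>0 then f z else 0) = (\<Sum>x\<in>{x\<in>P\<^sub>0 \<inter> F t. x + z \<in> P\<^sub>0}. f z)"
        by (rule sum.inter_filter[OF fin, symmetric])
      also have "{x\<in>P\<^sub>0 \<inter> F t. x + z \<in> P\<^sub>0} = pair_points z P\<^sub>0 \<inter> F t" by (auto simp: pair_points_def)
      finally show "(\<Sum>x\<in>P\<^sub>0 \<inter> F t. if x + z \<in> P\<^sub>0 then f z else 0) = of_nat (card (pair_points z P\<^sub>0 \<inter> F t)) * f z"
        by simp
    qed
    finally show ?thesis by (simp add: pair_frequency_def sum_divide_distrib)
  qed
  have "((\<lambda>t. \<Sum>z\<in>?Z. complex_of_real (pair_frequency z t) * f z) \<longlongrightarrow>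
      (\<Sum>z\<in>?Z. complex_of_real (pair_density z) * f z)) at_top"
    by (intro tendsto_intros pair_frequency_tendsto)
  moreover have "(\<integral>x. f x \<partial>autocorrelation m P\<^sub>0) = (\<Sum>z\<in>?Z. complex_of_real (pair_density z) * f z)"
    unfolding autocorrelation_eq_difference_measure by (rule integral_difference_measure[OF f R])
  ultimately have "((\<lambda>t. \<Sum>z\<in>?Z. complex_of_real (pair_frequency z t) * f z) \<longlongrightarrow> (\<integral>x. f x \<partial>autocorrelation m P\<^sub>0)) at_top"
    by simp
  then show ?thesis
    by (rule Lim_transform_eventually) (rule eventually_mono[OF eventually_gt_at_top[of 0] eq])
qed

end

theorem corollary5p4:
  fixes m :: "'g :: {topological_group_add, second_countable_topology, t2_space} measure"
    and d :: "'g \<Rightarrow> 'g \<Rightarrow> real"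
    and F :: "real \<Rightarrow> 'g set"
    and P\<^sub>0 :: "'g set"
  assumes "locally_compact_space (euclidean :: 'g topology)"
    and "left_haar_measure m"
    and "unimodular m"
    and "amenable m"
    and "admissible_metric d"
    and "weakly_admissible d m F"
    and "folner m F"
    and "finite_local_complexity P\<^sub>0"
    and "compactin chabauty_fell (punctured_hull P\<^sub>0)"
    and "uniquely_ergodic P\<^sub>0"
  shows "\<forall>f\<in>Cc.
    ((\<lambda>t. (\<Sum>x\<in>P\<^sub>0 \<inter> F t. \<Sum>\<^sub>\<infinity>y\<in>P\<^sub>0. f (- x + y)) / complex_of_real (measure m (F t)))
       \<longlongrightarrow> (\<integral>x. f x \<partial>autocorrelation m P\<^sub>0)) at_top"
proof
  interpret uniquely_ergodic_hull d m F P\<^sub>0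
    using assms by unfold_locales
  show "((\<lambda>t. (\<Sum>x\<in>P\<^sub>0 \<inter> F t. \<Sum>\<^sub>\<infinity>y\<in>P\<^sub>0. f (- x + y)) / complex_of_real (measure m (F t)))
       \<longlongrightarrow> (\<integral>x. f x \<partial>autocorrelation m P\<^sub>0)) at_top" if "f \<in> Cc" for f
    using autocorrelation_sampling that by (simp add: compactly_supported_Cc)
qed

end
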